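(* Let $\Bbbk$ be an algebraically closed field of characteristic $0$, let $n\ge 1$, and let $A$ be the incidence algebra over $\Bbbk$ of the symmetric group $\mathfrak{S}_n$ partially ordered by the Bruhat order. Let $v\in\mathfrak{S}_n$ be a boolean permutation and let $L_v$ be the simple $A$-module indexed by $v$. Then $\mathbf{grade}(L_v)=\mathbf{a}(v)$, where $\mathbf{a}$ is Lusztig's $\mathbf{a}$-function.
   Context: $\mathfrak{S}_n$ is the Coxeter group with simple reflections $\sigma_i=(i,i+1)$, $i\in[1,n-1]$; $\ell$ is the Coxeter length. A permutation $v$ is boolean if its principal order ideal $\{u: u\le v\}$ in the Bruhat order is isomorphic to a boolean lattice (equivalently, reduced words of $v$ have no repeated letters). The incidence algebra $A=\mathcal{I}(\mathfrak{S}_n,\le)$ is the path algebra of the quiver whose vertices are the elements of $\mathfrak{S}_n$ with an arrow $p\to q$ whenever $p$ covers $q$, modulo the relations that any two paths with the same start and end coincide. For $p\in\mathfrak{S}_n$, the simple module $L_p$ is one-dimensional at vertex $p$, zero elsewhere, with all arrows acting by zero. All modules are finite-dimensional left modules. For a nonzero module $M$, $\mathbf{grade}(M)=\min\{i: \mathrm{Ext}^i_A(M,A)\neq 0\}$. Lusztig's $\mathbf{a}$-function $\mathbf{a}:\mathfrak{S}_n\to\mathbb{Z}_{\ge0}$ (defined by Lusztig via the Kazhdan–Lusztig basis of the Hecke algebra) is, for $\mathfrak{S}_n$, the unique function that is constant on two-sided Kazhdan–Lusztig cells (i.e. on sets of permutations having the same Robinson–Schensted shape) and satisfies $\mathbf{a}(w)=\ell(w)$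 whenever $w$ is the longest element of a parabolic subgroup generated by a subset of the simple reflections. *)

theory Defs
  imports "HOL-Computational_Algebra.Polynomial" "HOL-Combinatorics.Combinatorics"
begin

text \<open>A poset is given by a carrier P and an order le (le y x means y is below x).
  Left modules over the incidence algebra (quiver with an arrow x -> y whenever x covers y,
  all parallel paths identified) are the same as representations: a finite-dimensional
  space M(x) at each vertex x and, for every y below x, the linear map M(x) -> M(y) given
  by the (unique) path x -> y, functorially.  The space M(x) is encoded as the space of
  functions 'i => 'a supported in a finite set B x.\<close>

definition vsp :: "('v \<Rightarrow> 'i set) \<Rightarrow> 'v \<Rightarrow> ('i \<Rightarrow> 'a::zero) set" where
  "vsp B x = {u. \<forall>i. i \<notin> B x \<longrightarrow> u i = 0}"

definition lin_on :: "('i \<Rightarrow> 'a::field) set \<Rightarrow> ('j \<Rightarrow> 'a) set \<Rightarrow> (('i \<Rightarrow> 'a) \<Rightarrow> ('j \<Rightarrow> 'a)) \<Rightarrow> bool" where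
  "lin_on V W h \<longleftrightarrow> (\<forall>u\<in>V. h u \<in> W)
     \<and> (\<forall>u\<in>V. \<forall>w\<in>V. h (\<lambda>i. u i + w i) = (\<lambda>j. h u j + h w j))
     \<and> (\<forall>c. \<forall>u\<in>V. h (\<lambda>i. c * u i) = (\<lambda>j. c * h u j))"

type_synonym ('v, 'i, 'a) rep = "('v \<Rightarrow> 'i set) \<times> ('v \<Rightarrow> 'v \<Rightarrow> ('i \<Rightarrow> 'a) \<Rightarrow> ('i \<Rightarrow> 'a))"
type_synonym ('v, 'i, 'a) hom = "'v \<Rightarrow> ('i \<Rightarrow> 'a) \<Rightarrow> ('i \<Rightarrow> 'a)"

definition sp :: "('v, 'i, 'a::zero) rep \<Rightarrow> 'v \<Rightarrow> ('i \<Rightarrow> 'a) set" where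
  "sp M x = vsp (fst M) x"

definition act :: "('v, 'i, 'a) rep \<Rightarrow> 'v \<Rightarrow> 'v \<Rightarrow> ('i \<Rightarrow> 'a) \<Rightarrow> ('i \<Rightarrow> 'a)" where
  "act M x y = snd M x y"

definition is_rep :: "'v set \<Rightarrow> ('v \<Rightarrow> 'v \<Rightarrow> bool) \<Rightarrow> ('v, 'i, 'a::field) rep \<Rightarrow> bool" where
  "is_rep P le M \<longleftrightarrow>
     (\<forall>x\<in>P. finite (fst M x))
     \<and> (\<forall>x\<in>P. \<forall>y\<in>P. le y x \<longrightarrow> lin_on (sp M x) (sp M y) (act M x y))
     \<and> (\<forall>x\<in>P. \<forall>u\<in>sp M x. act M x x u = u)
     \<and> (\<forall>x\<in>P. \<forall>y\<in>P. \<forall>z\<in>P. le y x \<longrightarrow> le z y \<longrightarrow>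
          (\<forall>u\<in>sp M x. act M y z (act M x y u) = act M x z u))"

definition is_hom :: "'v set \<Rightarrow> ('v \<Rightarrow> 'v \<Rightarrow> bool) \<Rightarrow> ('v, 'i, 'a::field) rep \<Rightarrow> ('v, 'j, 'a) rep
    \<Rightarrow> ('v \<Rightarrow> ('i \<Rightarrow> 'a) \<Rightarrow> ('j \<Rightarrow> 'a)) \<Rightarrow> bool" where
  "is_hom P le M N g \<longleftrightarrow>
     (\<forall>x\<in>P. lin_on (sp M x) (sp N x) (g x))
     \<and> (\<forall>x\<in>P. \<forall>y\<in>P. le y x \<longrightarrow> (\<forall>u\<in>sp M x. g y (act M x y u) = act N x y (g x u)))"

definition hom_eq :: "'v set \<Rightarrow> ('v, 'i, 'a::zero) rep \<Rightarrow> ('v \<Rightarrow> ('i \<Rightarrow> 'a) \<Rightarrow> 'b)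
    \<Rightarrow> ('v \<Rightarrow> ('i \<Rightarrow> 'a) \<Rightarrow> 'b) \<Rightarrow> bool" where
  "hom_eq P M g h \<longleftrightarrow> (\<forall>x\<in>P. \<forall>u\<in>sp M x. g x u = h x u)"

definition hcomp :: "('v \<Rightarrow> 'b \<Rightarrow> 'c) \<Rightarrow> ('v \<Rightarrow> 'a \<Rightarrow> 'b) \<Rightarrow> ('v \<Rightarrow> 'a \<Rightarrow> 'c)" where
  "hcomp g h = (\<lambda>x u. g x (h x u))"

definition is_zero_hom :: "'v set \<Rightarrow> ('v, 'i, 'a::zero) rep \<Rightarrow> ('v \<Rightarrow> ('i \<Rightarrow> 'a) \<Rightarrow> ('j \<Rightarrow> 'a)) \<Rightarrow> bool" where
  "is_zero_hom P M g \<longleftrightarrow> (\<forall>x\<in>P. \<forall>u\<in>sp M x. g x u = (\<lambda>_. 0))"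

definition surj_hom :: "'v set \<Rightarrow> ('v, 'i, 'a::zero) rep \<Rightarrow> ('v, 'j, 'a) rep
    \<Rightarrow> ('v \<Rightarrow> ('i \<Rightarrow> 'a) \<Rightarrow> ('j \<Rightarrow> 'a)) \<Rightarrow> bool" where
  "surj_hom P M N g \<longleftrightarrow> (\<forall>x\<in>P. g x ` sp M x = sp N x)"

text \<open>Projective modules (lifting property against surjections; the test modules range over
  all finite-dimensional modules encodable with the same (in the application: infinite)
  index type).\<close>
definition projective :: "'v set \<Rightarrow> ('v \<Rightarrow> 'v \<Rightarrow> bool) \<Rightarrow> ('v, 'i, 'a::field) rep \<Rightarrow> bool" where
  "projective P le Q \<longleftrightarrow> is_rep P le Q \<and>
     (\<forall>(X::('v, 'i, 'a) rep) (Y::('v, 'i, 'a) rep) g f.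
        is_rep P le X \<and> is_rep P le Y \<and> is_hom P le X Y g \<and> surj_hom P X Y g \<and> is_hom P le Q Y f
        \<longrightarrow> (\<exists>h. is_hom P le Q X h \<and> hom_eq P Q (hcomp g h) f))"

definition proj_res :: "'v set \<Rightarrow> ('v \<Rightarrow> 'v \<Rightarrow> bool) \<Rightarrow> ('v, 'i, 'a::field) rep
    \<Rightarrow> (nat \<Rightarrow> ('v, 'i, 'a) rep) \<Rightarrow> (nat \<Rightarrow> ('v, 'i, 'a) hom) \<Rightarrow> ('v, 'i, 'a) hom \<Rightarrow> bool" where
  "proj_res P le M Pr d eps \<longleftrightarrow>
     (\<forall>i. projective P le (Pr i))
     \<and> is_hom P le (Pr 0) M eps \<and> surj_hom P (Pr 0) M eps
     \<and> (\<forall>i. is_hom P le (Pr (Suc i)) (Pr i) (d i))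
     \<and> (\<forall>x\<in>P. {u \<in> sp (Pr 0) x. eps x u = (\<lambda>_. 0)} = d 0 x ` sp (Pr 1) x)
     \<and> (\<forall>i. \<forall>x\<in>P. {u \<in> sp (Pr (Suc i)) x. d i x u = (\<lambda>_. 0)} = d (Suc i) x ` sp (Pr (Suc (Suc i))) x)"

definition hom_cohom_nz :: "'v set \<Rightarrow> ('v \<Rightarrow> 'v \<Rightarrow> bool) \<Rightarrow> (nat \<Rightarrow> ('v, 'i, 'a::field) rep)
    \<Rightarrow> (nat \<Rightarrow> ('v, 'i, 'a) hom) \<Rightarrow> ('v, 'j, 'a) rep \<Rightarrow> nat \<Rightarrow> bool" where
  "hom_cohom_nz P le Pr d N i \<longleftrightarrow>
     (\<exists>\<phi>. is_hom P le (Pr i) N \<phi> \<and> is_zero_hom P (Pr (Suc i)) (hcomp \<phi> (d i)) \<and>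
        (case i of
           0 \<Rightarrow> \<not> is_zero_hom P (Pr 0) \<phi>
         | Suc j \<Rightarrow> \<not> (\<exists>\<psi>. is_hom P le (Pr j) N \<psi> \<and> hom_eq P (Pr (Suc j)) \<phi> (hcomp \<psi> (d j)))))"

text \<open>Ext^i_A(M, N) \<noteq> 0 (computed from a projective resolution of M; independent of the choice).\<close>
definition Ext_nonzero :: "'v set \<Rightarrow> ('v \<Rightarrow> 'v \<Rightarrow> bool) \<Rightarrow> ('v, 'i, 'a::field) rep
    \<Rightarrow> ('v, 'j, 'a) rep \<Rightarrow> nat \<Rightarrow> bool" where
  "Ext_nonzero P le M N i \<longleftrightarrow>
     (\<exists>(Pr :: nat \<Rightarrow> ('v, 'i, 'a) rep) d eps. proj_res P le M Pr d eps \<and> hom_cohom_nz P le Pr d N i)"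

text \<open>grade(M) = g, where the grade is taken with respect to the regular module N = A.\<close>
definition has_grade :: "'v set \<Rightarrow> ('v \<Rightarrow> 'v \<Rightarrow> bool) \<Rightarrow> ('v, 'i, 'a::field) rep
    \<Rightarrow> ('v, 'j, 'a) rep \<Rightarrow> nat \<Rightarrow> bool" where
  "has_grade P le M N g \<longleftrightarrow> Ext_nonzero P le M N g \<and> (\<forall>i<g. \<not> Ext_nonzero P le M N i)"

definition simple_rep :: "'v \<Rightarrow> ('v, 'v, 'a::zero) rep" where
  "simple_rep v = ((\<lambda>x. if x = v then {v} else {}),
                   (\<lambda>x y u. if x = y then u else (\<lambda>_. 0)))"

text \<open>The regular left module A = direct sum of the indecomposable projectives A e_p:
  at vertex y it has basis the paths p -> y, i.e. the p with y \<le> p; the path y -> z sends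
  the basis vector of p -> y to that of p -> z.\<close>
definition regular_rep :: "'v set \<Rightarrow> ('v \<Rightarrow> 'v \<Rightarrow> bool) \<Rightarrow> ('v, 'v, 'a::zero) rep" where
  "regular_rep P le = ((\<lambda>y. {p \<in> P. le y p}),
                       (\<lambda>y z u. (\<lambda>p. if p \<in> P \<and> le z p then u p else 0)))"

definition Sn :: "nat \<Rightarrow> (nat \<Rightarrow> nat) set" where
  "Sn n = {p. p permutes {1..n}}"

definition sref :: "nat \<Rightarrow> nat \<Rightarrow> nat" where
  "sref i = Transposition.transpose i (Suc i)"

fun wprod :: "nat list \<Rightarrow> nat \<Rightarrow> nat" where
  "wprod [] = id"
| "wprod (i # is) = sref i \<circ> wprod is"

definition valid_word :: "nat \<Rightarrow> nat list \<Rightarrow> bool" where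
  "valid_word n w \<longleftrightarrow> (\<forall>i\<in>set w. 1 \<le> i \<and> i < n)"

definition clen :: "nat \<Rightarrow> (nat \<Rightarrow> nat) \<Rightarrow> nat" where
  "clen n p = (LEAST k. \<exists>w. length w = k \<and> valid_word n w \<and> wprod w = p)"

definition bruhat_step :: "nat \<Rightarrow> (nat \<Rightarrow> nat) \<Rightarrow> (nat \<Rightarrow> nat) \<Rightarrow> bool" where
  "bruhat_step n u w \<longleftrightarrow> u \<in> Sn n \<and>
     (\<exists>i j. 1 \<le> i \<and> i < j \<and> j \<le> n \<and> w = u \<circ> Transposition.transpose i j \<and> clen n u < clen n w)"

definition bruhat :: "nat \<Rightarrow> (nat \<Rightarrow> nat) \<Rightarrow> (nat \<Rightarrow> nat) \<Rightarrow> bool" where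
  "bruhat n = (bruhat_step n)\<^sup>*\<^sup>*"

definition boolean_perm :: "nat \<Rightarrow> (nat \<Rightarrow> nat) \<Rightarrow> bool" where
  "boolean_perm n v \<longleftrightarrow> (\<exists>(S :: nat set) f. finite S \<and>
      bij_betw f {u \<in> Sn n. bruhat n u v} (Pow S) \<and>
      (\<forall>u\<in>{u \<in> Sn n. bruhat n u v}. \<forall>u'\<in>{u \<in> Sn n. bruhat n u v}.
          bruhat n u u' \<longleftrightarrow> f u \<subseteq> f u'))"

fun rs_insert :: "nat \<Rightarrow> nat list list \<Rightarrow> nat list list" where
  "rs_insert x [] = [[x]]"
| "rs_insert x (r # rs) =
     (case filter (\<lambda>y. x < y) r of
        [] \<Rightarrow> (r @ [x]) # rs
      | (y # _) \<Rightarrow> map (\<lambda>z. if z = y then x else z) r # rs_insert y rs)"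

definition rs_P :: "nat \<Rightarrow> (nat \<Rightarrow> nat) \<Rightarrow> nat list list" where
  "rs_P n w = foldl (\<lambda>T i. rs_insert (w i) T) [] [1..<Suc n]"

definition rs_shape :: "nat \<Rightarrow> (nat \<Rightarrow> nat) \<Rightarrow> nat list" where
  "rs_shape n w = map length (rs_P n w)"

definition parabolic :: "nat set \<Rightarrow> (nat \<Rightarrow> nat) set" where
  "parabolic J = {wprod w | w. set w \<subseteq> J}"

text \<open>Lusztig's a-function on S_n: the unique function (zero outside S_n) constant on
  two-sided cells (= RS-shape classes) with a(w) = l(w) for w the longest element of a
  standard parabolic subgroup.\<close>
definition a_fun :: "nat \<Rightarrow> (nat \<Rightarrow> nat) \<Rightarrow> nat" where
  "a_fun n = (THE f. (\<forall>w. w \<notin> Sn n \<longrightarrow> f w = 0)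
       \<and> (\<forall>u\<in>Sn n. \<forall>w\<in>Sn n. rs_shape n u = rs_shape n w \<longrightarrow> f u = f w)
       \<and> (\<forall>J. J \<subseteq> {1..<n} \<longrightarrow> (\<forall>w\<in>parabolic J.
             (\<forall>u\<in>parabolic J. clen n u \<le> clen n w) \<longrightarrow> f w = clen n w)))"

end

theory Submission
  imports Defs "HOL-Library.Sublist"
begin

text \<open>
  A boolean \<open>v\<close> has a reduced word \<open>w\<close> without repeated letters, and the interval below \<open>v\<close> consists
  of the subwords \<open>v_T\<close> of \<open>w\<close>, for sets \<open>T\<close> of letters.  The Koszul complex of this boolean lattice is a
  projective resolution of the simple module at \<open>v\<close>.  Applying \<open>Hom(-, A)\<close> gives, for each \<open>p\<close>, the
  reduced simplicial chain complex of \<open>K_p = {T. v_T \<le> p}\<close>, graded by the codimension of \<open>T\<close>.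

  By the rank criterion for the Bruhat order, the minimal nonfaces of \<open>K_p\<close> are intervals of letters
  that occur in \<open>w\<close> in monotone order.  If every cover of the letters by such runs has at least \<open>a\<close>
  members, then the homology of \<open>K_p\<close> vanishes in codimension below \<open>a\<close>.  Cutting the letters greedily
  into maximal runs from the left gives a cover with the minimal number \<open>a\<close> of members, and there is a \<open>p\<close>
  for which \<open>K_p\<close> is the join of the boundaries of the simplices on these runs, a sphere with homology in
  codimension \<open>a\<close>.

  Finally \<open>v\<close> avoids 321, so \<open>a(v) = n - l\<close> for the length \<open>l\<close> of a longest increasing subsequence.  The
  starting points of the greedy runs give disjoint inversions, and deleting one position per run destroys
  all inversions; hence \<open>n - l = a\<close>.
\<close>

section \<open>Chain complexes of set systems\<close>


text \<open>The starting letters of the greedy runs settle all the bounds at once: no run contains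
  two of them, so every cover needs a separate run for each start, and inversions straddling
  different starts share no position. Order and runs are tied together by the fact that the rank
  function of a product without repeated letters exceeds its least possible value by at most one.

  Two obstacles shape the rest. \<open>Ext_nonzero\<close> asks for some projective resolution, so
  vanishing has to be shown for all of them; this calls for the comparison theorem, for projectives
  whose lifting property is only tested on modules with one fixed index type. And in the
  construction of \<open>p\<close> consecutive greedy runs may be adjacent; short runs from the last
  letter of one into the next must still stay below \<open>p\<close>, which decides on which side
  each new factor is multiplied. Finally, \<open>a_fun\<close> is a definite description, so its
  value on every shape has to be computed before it can be used at \<open>v\<close>.\<close>

definition elem_sign :: "nat \<Rightarrow> nat set \<Rightarrow> 'a::comm_ring_1" where
  "elem_sign s T = (-1) ^ card {t \<in> T. t < s}"

lemma elem_sign_sq [simp]: "elem_sign s T * elem_sign s T = (1::'a::comm_ring_1)"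
  by (simp add: elem_sign_def power_mult_distrib[symmetric])

lemma elem_sign_sq' [simp]: "elem_sign s T * (elem_sign s T * x) = (x::'a::comm_ring_1)"
  by (simp add: mult.assoc[symmetric])

lemma elem_sign_insert:
  assumes "finite T" "s \<notin> T"
  shows "elem_sign t (insert s T) = (if s < t then - elem_sign t T else elem_sign t T)"
proof (cases "s < t")
  case True
  then have "{u \<in> insert s T. u < t} = insert s {u \<in> T. u < t}" by auto
  then show ?thesis using assms True by (simp add: elem_sign_def)
next
  case False
  then have "{u \<in> insert s T. u < t} = {u \<in> T. u < t}" by auto
  then show ?thesis using False by (simp add: elem_sign_def)
qed

text \<open>The coefficient at the face \<open>U\<close> of the simplicial boundary of the chain
  \<open>z\<close>. The empty set counts as a face, so the homology is reduced.\<close>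

definition bdry :: "nat set \<Rightarrow> (nat set \<Rightarrow> 'a::comm_ring_1) \<Rightarrow> nat set \<Rightarrow> 'a" where
  "bdry S z U = (\<Sum>s\<in>S - U. elem_sign s U * z (insert s U))"

text \<open>For \<open>X = {}\<close> this is the transpose of \<open>bdry\<close>. For general
  \<open>X\<close>, on sets containing \<open>X\<close>, it is the coboundary of the simplex on the
  vertices outside \<open>X\<close>.\<close>

definition cobdry :: "nat set \<Rightarrow> (nat set \<Rightarrow> 'a::comm_ring_1) \<Rightarrow> nat set \<Rightarrow> 'a" where
  "cobdry X u T = (\<Sum>t\<in>T - X. elem_sign t (T - {t}) * u (T - {t}))"

lemma antisym_double_sum:
  fixes g :: "'b \<Rightarrow> 'b \<Rightarrow> 'a::field_char_0"
  assumes "finite A" and anti: "\<And>s t. s \<in> A \<Longrightarrow> t \<in> A \<Longrightarrow> s \<noteq> t \<Longrightarrow> g s t = - g t s"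
  shows "(\<Sum>s\<in>A. \<Sum>t\<in>A - {s}. g s t) = 0"
proof -
  define h where "h s t = (if s = t then 0 else g s t)" for s t
  have "(\<Sum>s\<in>A. \<Sum>t\<in>A - {s}. g s t) = (\<Sum>s\<in>A. \<Sum>t\<in>A. h s t)"
  proof (rule sum.cong[OF refl])
    fix s assume "s \<in> A"
    have "(\<Sum>t\<in>A. h s t) = (\<Sum>t\<in>A - {s}. h s t)"
      by (rule sum.mono_neutral_right) (use assms in \<open>auto simp: h_def\<close>)
    then show "(\<Sum>t\<in>A - {s}. g s t) = (\<Sum>t\<in>A. h s t)"
      by (metis (no_types, lifting) Diff_iff h_def insertI1 sum.cong)
  qed
  moreover have "(\<Sum>s\<in>A. \<Sum>t\<in>A. h s t) = - (\<Sum>s\<in>A. \<Sum>t\<in>A. h s t)"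
  proof -
    have "(\<Sum>s\<in>A. \<Sum>t\<in>A. h s t) = (\<Sum>t\<in>A. \<Sum>s\<in>A. h s t)"
      by (rule sum.swap)
    also have "\<dots> = (\<Sum>t\<in>A. \<Sum>s\<in>A. - h t s)"
      by (intro sum.cong refl) (metis anti h_def neg_0_equal_iff_equal)
    finally show ?thesis unfolding sum_negf .
  qed
  then have "2 * (\<Sum>s\<in>A. \<Sum>t\<in>A. h s t) = 0"
    unfolding eq_neg_iff_add_eq_0 mult_2 .
  ultimately show ?thesis by simp
qed

lemma bdry_bdry:
  fixes z :: "nat set \<Rightarrow> 'a::field_char_0"
  assumes "finite S" "U \<subseteq> S"
  shows "bdry S (bdry S z) U = 0"
proof -
  have fU: "finite U" using assms finite_subset by blast
  have "bdry S (bdry S z) U =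
     (\<Sum>s\<in>S - U. \<Sum>t\<in>(S - U) - {s}. elem_sign s U * (elem_sign t (insert s U) * z (insert t (insert s U))))"
    unfolding bdry_def by (intro sum.cong refl) (auto simp: sum_distrib_left intro!: sum.cong)
  also have "\<dots> = 0"
  proof (rule antisym_double_sum)
    show "finite (S - U)" using assms by auto
  next
    fix s t assume st: "s \<in> S - U" "t \<in> S - U" "s \<noteq> t"
    have "insert t (insert s U) = insert s (insert t U)" by auto
    then show "elem_sign s U * (elem_sign t (insert s U) * z (insert t (insert s U))) =
       - (elem_sign t U * (elem_sign s (insert t U) * z (insert s (insert t U))))"
      using st fU by (cases "s < t") (auto simp: elem_sign_insert)
  qed
  finally show ?thesis .
qed

lemma bdry_diff: "bdry S (\<lambda>T. y T - x T) U = bdry S y U - bdry S x U"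
  by (simp add: bdry_def right_diff_distrib sum_subtractf)

text \<open>
  Chains live on the sets \<open>T\<close> with \<open>B \<subseteq> T \<subseteq> S\<close> that contain no member of the family, and are
  graded by \<open>card (S - T)\<close>.  In the induction step, a filling for the smaller family is corrected on the sets
  containing the new member \<open>C\<close>, where it is a cycle relative to \<open>B \<union> C\<close>.
\<close>

lemma chain_vanish:
  fixes z :: "nat set \<Rightarrow> 'a::field_char_0"
  assumes "finite \<C>" and S: "finite S" and "B \<subseteq> S"
    and "\<And>\<D>. \<D> \<subseteq> \<C> \<Longrightarrow> S - B \<subseteq> \<Union>\<D> \<Longrightarrow> k < card \<D>"
    and "\<And>T. z T \<noteq> 0 \<Longrightarrow> B \<subseteq> T \<and> T \<subseteq> S \<and> card (S - T) = k \<and> (\<forall>C\<in>\<C>. \<not> C \<subseteq> T)"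
    and "\<And>U. B \<subseteq> U \<Longrightarrow> U \<subseteq> S \<Longrightarrow> bdry S z U = 0"
  shows "\<exists>y. (\<forall>T. y T \<noteq> 0 \<longrightarrow> B \<subseteq> T \<and> T \<subseteq> S \<and> Suc (card (S - T)) = k \<and> (\<forall>C\<in>\<C>. \<not> C \<subseteq> T)) \<and>
             (\<forall>U. B \<subseteq> U \<longrightarrow> U \<subseteq> S \<longrightarrow> bdry S y U = z U)"
  using assms(1,3-6)
proof (induction \<C> arbitrary: B z k rule: finite_induct)
  case empty
  \<comment> \<open>If \<open>S = B\<close>, the empty family would be a cover and the hypothesis
    would give \<open>k < 0\<close>.\<close>
  have "\<not> S - B \<subseteq> {}" using empty.prems(2)[of "{}"] by auto
  then obtain s0 where s0: "s0 \<in> S" "s0 \<notin> B" by auto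
  \<comment> \<open>The cone over \<open>z\<close> with apex \<open>s0\<close>: without forbidden
    sets the faces form a full simplex, which is contractible.\<close>
  define y where "y T = (if s0 \<in> T then elem_sign s0 (T - {s0}) * z (T - {s0}) else 0)" for T
  have "Suc (card (S - T)) = k \<and> B \<subseteq> T \<and> T \<subseteq> S" if "y T \<noteq> 0" for T
  proof -
    from that have sT: "s0 \<in> T" and nz: "z (T - {s0}) \<noteq> 0" by (auto simp: y_def split: if_splits)
    from empty.prems(3)[OF nz] have *: "B \<subseteq> T" "T \<subseteq> S" "card (S - (T - {s0})) = k"
      using s0 by auto
    have "S - (T - {s0}) = insert s0 (S - T)" using sT * s0 by auto
    then show ?thesis using * sT S by auto
  qed
  moreover have "bdry S y U = z U" if U: "B \<subseteq> U" "U \<subseteq> S" for U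
  proof (cases "s0 \<in> U")
    case False
    have "bdry S y U = (\<Sum>s\<in>{s0}. elem_sign s U * y (insert s U))"
      unfolding bdry_def
      by (rule sum.mono_neutral_right) (use s0 S False in \<open>auto simp: y_def\<close>)
    then show ?thesis using False by (simp add: y_def)
  next
    case True
    define W where "W = U - {s0}"
    have W: "U = insert s0 W" "s0 \<notin> W" "finite W" "W \<subseteq> S" "B \<subseteq> W"
      using True U S s0 by (auto simp: W_def finite_subset)
    have "0 = bdry S z W" using empty.prems(4) W by simp
    also have "\<dots> = elem_sign s0 W * z U + (\<Sum>s\<in>S - U. elem_sign s W * z (insert s W))"
    proof -
      have "S - W = insert s0 (S - U)" using W s0 by auto
      moreover have "s0 \<notin> S - U" using True by simp
      ultimately show ?thesis unfolding bdry_def using S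
        by (simp only: sum.insert finite_Diff W(1)[symmetric] not_False_eq_True if_True)
    qed
    finally have e: "(\<Sum>s\<in>S - U. elem_sign s W * z (insert s W)) = - (elem_sign s0 W * z U)"
      by (simp add: eq_neg_iff_add_eq_0 add.commute)
    have "bdry S y U = (\<Sum>s\<in>S - U. - elem_sign s0 W * (elem_sign s W * z (insert s W)))"
      unfolding bdry_def
    proof (rule sum.cong[OF refl])
      fix s assume s: "s \<in> S - U"
      have "insert s U - {s0} = insert s W" using s W by auto
      then show "elem_sign s U * y (insert s U) = - elem_sign s0 W * (elem_sign s W * z (insert s W))"
        using s W by (auto simp: y_def elem_sign_insert)
    qed
    also have "\<dots> = z U" using e by (simp add: sum_distrib_left[symmetric] sum_negf)
    finally show ?thesis .
  qed
  ultimately show ?case by (intro exI[of _ y]) auto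
next
  case (insert C \<C>)
  obtain y where y: "\<And>T. y T \<noteq> 0 \<Longrightarrow> B \<subseteq> T \<and> T \<subseteq> S \<and> Suc (card (S - T)) = k \<and> (\<forall>C\<in>\<C>. \<not> C \<subseteq> T)"
    "\<And>U. B \<subseteq> U \<Longrightarrow> U \<subseteq> S \<Longrightarrow> bdry S y U = z U"
  proof -
    have "\<exists>y. (\<forall>T. y T \<noteq> 0 \<longrightarrow> B \<subseteq> T \<and> T \<subseteq> S \<and> Suc (card (S - T)) = k \<and> (\<forall>C\<in>\<C>. \<not> C \<subseteq> T)) \<and>
             (\<forall>U. B \<subseteq> U \<longrightarrow> U \<subseteq> S \<longrightarrow> bdry S y U = z U)"
      using insert.prems(3) by (intro insert.IH insert.prems(1,2,4)) auto
    then show ?thesis using that by blast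
  qed
  show ?case
  proof (cases "C \<subseteq> S")
    case False
    then have "\<And>T. T \<subseteq> S \<Longrightarrow> \<not> C \<subseteq> T" by blast
    then show ?thesis using y by (intro exI[of _ y]) (metis insert_iff)
  next
    case True
    define y' where "y' T = (if C \<subseteq> T then y T else 0)" for T
    define k' where "k' = k - 1"
    have kk: "Suc k' = k" if "y T \<noteq> 0" for T using y(1)[OF that] by (auto simp: k'_def)
    have "\<exists>x. (\<forall>T. x T \<noteq> 0 \<longrightarrow> B \<union> C \<subseteq> T \<and> T \<subseteq> S \<and> Suc (card (S - T)) = k' \<and> (\<forall>C\<in>\<C>. \<not> C \<subseteq> T)) \<and>
             (\<forall>U. B \<union> C \<subseteq> U \<longrightarrow> U \<subseteq> S \<longrightarrow> bdry S x U = y' U)"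
    proof (cases "\<exists>T. y T \<noteq> 0")
      case False
      then show ?thesis by (intro exI[of _ "\<lambda>_. 0"]) (auto simp: y'_def bdry_def)
    next
      case True
      then have k: "Suc k' = k" using kk by blast
      show ?thesis
      proof (rule insert.IH)
        show "B \<union> C \<subseteq> S" using \<open>C \<subseteq> S\<close> insert.prems(1) by auto
        fix \<D> assume D: "\<D> \<subseteq> \<C>" "S - (B \<union> C) \<subseteq> \<Union>\<D>"
        \<comment> \<open>Adding \<open>C\<close> to a family covering
          \<open>S - (B \<union> C)\<close> covers \<open>S - B\<close> at the cost of one member,
          so the bound on covers survives with \<open>k'\<close> in place of
          \<open>k\<close>.\<close>
        have "k < card (insert C \<D>)" by (rule insert.prems(2)) (use D in auto)
        also have "\<dots> \<le> Suc (card \<D>)" by (simp add: card_insert_le_m1 card_insert_if)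
        finally show "k' < card \<D>" using k by simp
      next
        fix T assume "y' T \<noteq> 0"
        then have "C \<subseteq> T" "y T \<noteq> 0" by (auto simp: y'_def split: if_splits)
        then show "B \<union> C \<subseteq> T \<and> T \<subseteq> S \<and> card (S - T) = k' \<and> (\<forall>C\<in>\<C>. \<not> C \<subseteq> T)"
          using y(1)[of T] k by auto
      next
        fix U assume U: "B \<union> C \<subseteq> U" "U \<subseteq> S"
        have "bdry S y' U = bdry S y U" unfolding bdry_def
          by (intro sum.cong refl) (use U in \<open>auto simp: y'_def\<close>)
        also have "\<dots> = z U" using y(2) U by auto
        also have "\<dots> = 0" using insert.prems(3)[of U] U by auto
        finally show "bdry S y' U = 0" .
      qed
    qed
    then obtain x where x: "\<And>T. x T \<noteq> 0 \<Longrightarrow> B \<union> C \<subseteq> T \<and> T \<subseteq> S \<and> Suc (card (S - T)) = k' \<and> (\<forall>C\<in>\<C>. \<not> C \<subseteq> T)"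
      "\<And>U. B \<union> C \<subseteq> U \<Longrightarrow> U \<subseteq> S \<Longrightarrow> bdry S x U = y' U" by blast
    \<comment> \<open>On sets containing \<open>C\<close> the boundary of \<open>x\<close> equals
      \<open>y\<close>, so the difference lives on sets that do not contain \<open>C\<close>;
      subtracting a boundary leaves the boundary of \<open>y\<close> unchanged.\<close>
    define w where "w T = (if T \<subseteq> S \<and> B \<subseteq> T then y T - bdry S x T else 0)" for T
    have bdx: "T \<subseteq> S \<and> (\<forall>C\<in>\<C>. \<not> C \<subseteq> T) \<and> Suc (card (S - T)) = k"
      if "bdry S x T \<noteq> 0" "T \<subseteq> S" for T
    proof -
      from that(1) obtain s where s: "s \<in> S - T" "x (insert s T) \<noteq> 0"
        unfolding bdry_def by (metis (mono_tags, lifting) mult_zero_right sum.neutral)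
      have "S - T = insert s (S - insert s T)" using s by auto
      then have "card (S - T) = Suc (card (S - insert s T))" using S s
        by (metis Diff_insert Diff_iff card_insert_disjoint finite_Diff insertI1)
      moreover have "Suc k' = k" using x(1)[OF s(2)] by (auto simp: k'_def)
      ultimately show ?thesis using x(1)[OF s(2)] that(2) by (metis subset_insertI2)
    qed
    have "B \<subseteq> T \<and> T \<subseteq> S \<and> Suc (card (S - T)) = k \<and> (\<forall>C'\<in>insert C \<C>. \<not> C' \<subseteq> T)" if "w T \<noteq> 0" for T
    proof -
      from that have T: "B \<subseteq> T" "T \<subseteq> S" "y T - bdry S x T \<noteq> 0" by (auto simp: w_def split: if_splits)
      have "\<not> C \<subseteq> T" using x(2)[of T] T by (auto simp: y'_def)
      moreover have "y T \<noteq> 0 \<or> bdry S x T \<noteq> 0" using T by auto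
      ultimately show ?thesis using T y(1)[of T] bdx[of T] by auto
    qed
    moreover have "bdry S w U = z U" if U: "B \<subseteq> U" "U \<subseteq> S" for U
    proof -
      have "bdry S w U = bdry S (\<lambda>T. y T - bdry S x T) U" unfolding bdry_def[of S w] bdry_def[of S "\<lambda>T. y T - bdry S x T"]
        by (intro sum.cong refl) (use U in \<open>auto simp: w_def\<close>)
      also have "\<dots> = z U" using y(2) U bdry_bdry[OF S U(2)] by (simp add: bdry_diff)
      finally show ?thesis .
    qed
    ultimately show ?thesis by (intro exI[of _ w]) auto
  qed
qed

text \<open>A cycle of the sphere obtained by joining the boundaries of the simplices on the
  members; its sets omit exactly one point of each. When a member \<open>C\<close> is added, the
  cycle \<open>y\<close> for the larger base \<open>B \<union> C\<close> lives on sets containing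
  \<open>C\<close>, and its boundary over \<open>B\<close> is the new cycle.\<close>

lemma chain_nonvanish:
  assumes "finite \<C>" and S: "finite S" and "B \<subseteq> S"
    and "disjoint \<C>" and "{} \<notin> \<C>" and "\<Union>\<C> = S - B"
  shows "\<exists>z :: nat set \<Rightarrow> 'a::field_char_0. (\<exists>T. z T \<noteq> 0) \<and>
      (\<forall>T. z T \<noteq> 0 \<longrightarrow> B \<subseteq> T \<and> T \<subseteq> S \<and> card (S - T) = card \<C> \<and> (\<forall>C\<in>\<C>. \<not> C \<subseteq> T)) \<and>
      (\<forall>U. B \<subseteq> U \<longrightarrow> U \<subseteq> S \<longrightarrow> bdry S z U = 0)"
  using assms(1,3-6)
proof (induction \<C> arbitrary: B rule: finite_induct)
  case empty
  then have "B = S" by auto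
  then show ?case
    by (intro exI[of _ "\<lambda>T. if T = S then 1 else 0"]) (auto simp: bdry_def)
next
  case (insert C \<C>)
  have C: "C \<subseteq> S" "C \<inter> B = {}" "C \<noteq> {}" using insert.prems by auto
  have dC: "C \<inter> C' = {}" if "C' \<in> \<C>" for C'
    using insert.prems(2) insert.hyps(2) that
    by (metis disjoint_def disjointD insertCI)
  have U: "\<Union>\<C> = S - (B \<union> C)" using insert.prems(4) dC by auto
  have "disjoint \<C>" using insert.prems(2) by (rule pairwise_subset) auto
  with U have "\<exists>z :: nat set \<Rightarrow> 'a. (\<exists>T. z T \<noteq> 0) \<and>
      (\<forall>T. z T \<noteq> 0 \<longrightarrow> B \<union> C \<subseteq> T \<and> T \<subseteq> S \<and> card (S - T) = card \<C> \<and> (\<forall>C\<in>\<C>. \<not> C \<subseteq> T)) \<and>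
      (\<forall>U. B \<union> C \<subseteq> U \<longrightarrow> U \<subseteq> S \<longrightarrow> bdry S z U = 0)"
    using insert.prems(1,3) C(1) by (intro insert.IH) (simp_all del: Union_iff)
  then obtain y :: "nat set \<Rightarrow> 'a" where "\<exists>T. y T \<noteq> 0" and
    y: "\<forall>T. y T \<noteq> 0 \<longrightarrow> B \<union> C \<subseteq> T \<and> T \<subseteq> S \<and> card (S - T) = card \<C> \<and> (\<forall>C\<in>\<C>. \<not> C \<subseteq> T)"
    and cyc: "\<forall>U. B \<union> C \<subseteq> U \<longrightarrow> U \<subseteq> S \<longrightarrow> bdry S y U = 0"
    by (elim exE conjE) (rule that[OF exI])
  then obtain T0 where T0: "y T0 \<noteq> 0" by blast
  note y = y[rule_format] and cyc = cyc[rule_format]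
  define z where "z U = (if B \<subseteq> U \<and> U \<subseteq> S then bdry S y U else 0)" for U
  obtain c where c: "c \<in> C" using C by auto
  \<comment> \<open>The coefficient of \<open>z\<close> at this set has a single contribution, from
    \<open>T0\<close>: adding any other point still leaves out \<open>c\<close>, and
    \<open>y\<close> vanishes on sets that do not contain \<open>C\<close>.\<close>
  define U0 where "U0 = T0 - {c}"
  have T0': "B \<union> C \<subseteq> T0" "T0 \<subseteq> S" using y[OF T0] by auto
  have U0: "insert c U0 = T0" "c \<in> S - U0" "B \<subseteq> U0" "U0 \<subseteq> S" using c C T0' by (auto simp: U0_def)
  have "z U0 = (\<Sum>s\<in>{c}. elem_sign s U0 * y (insert s U0))"
  proof -
    have "z U0 = (\<Sum>s\<in>S - U0. elem_sign s U0 * y (insert s U0))"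
      using U0(3,4) by (simp add: z_def bdry_def)
    also have "\<dots> = (\<Sum>s\<in>{c}. elem_sign s U0 * y (insert s U0))"
    proof (rule sum.mono_neutral_right)
      show "\<forall>i\<in>S - U0 - {c}. elem_sign i U0 * y (insert i U0) = 0"
      proof
        fix i assume i: "i \<in> S - U0 - {c}"
        have "\<not> C \<subseteq> insert i U0" using c i by (auto simp: U0_def)
        then have "y (insert i U0) = 0" using y[of "insert i U0"] by blast
        then show "elem_sign i U0 * y (insert i U0) = 0" by simp
      qed
    qed (use S U0(2) in auto)
    finally show ?thesis .
  qed
  then have "z U0 * elem_sign c U0 = y T0" using U0 by (simp add: mult.commute)
  then have "\<exists>T. z T \<noteq> 0" using T0 by (metis mult_zero_left)
  moreover have "B \<subseteq> T \<and> T \<subseteq> S \<and> card (S - T) = card (insert C \<C>) \<and> (\<forall>C\<in>insert C \<C>. \<not> C \<subseteq> T)"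
    if "z T \<noteq> 0" for T
  proof -
    from that have T: "B \<subseteq> T" "T \<subseteq> S" "bdry S y T \<noteq> 0" by (auto simp: z_def split: if_splits)
    then obtain s where s: "s \<in> S - T" "y (insert s T) \<noteq> 0"
      unfolding bdry_def by (metis (mono_tags, lifting) mult_zero_right sum.neutral)
    have "S - T = insert s (S - insert s T)" using s by auto
    then have "card (S - T) = Suc (card (S - insert s T))" using S s
      by (metis Diff_insert Diff_iff card_insert_disjoint finite_Diff insertI1)
    then have "card (S - T) = card (insert C \<C>)" using y[OF s(2)] insert.hyps by simp
    moreover have "\<not> C \<subseteq> T" using cyc[of T] T by auto
    moreover have "\<forall>C\<in>\<C>. \<not> C \<subseteq> T" using y[OF s(2)] by (meson subset_insertI2)
    ultimately show ?thesis using T by auto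
  qed
  moreover have "bdry S z U = 0" if U: "B \<subseteq> U" "U \<subseteq> S" for U
  proof -
    have "bdry S z U = bdry S (bdry S y) U" unfolding bdry_def[of S z] bdry_def[of S "bdry S y"]
      by (intro sum.cong refl) (use U in \<open>auto simp: z_def\<close>)
    then show ?thesis using bdry_bdry[OF S U(2)] by simp
  qed
  ultimately show ?case by (intro exI[of _ z]) auto
qed

lemma cobdry_cobdry:
  fixes u :: "nat set \<Rightarrow> 'a::field_char_0"
  assumes "finite T"
  shows "cobdry X (cobdry X u) T = 0"
proof -
  have "cobdry X (cobdry X u) T =
     (\<Sum>s\<in>T - X. \<Sum>t\<in>(T - X) - {s}. elem_sign s (T - {s}) * (elem_sign t (T - {s} - {t}) * u (T - {s} - {t})))"
    unfolding cobdry_def by (intro sum.cong refl) (auto simp: sum_distrib_left intro!: sum.cong)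
  also have "\<dots> = 0"
  proof (rule antisym_double_sum)
    show "finite (T - X)" using assms by auto
  next
    fix s t assume st: "s \<in> T - X" "t \<in> T - X" "s \<noteq> t"
    define W where "W = T - {s} - {t}"
    have "T - {t} - {s} = W" "T - {s} = insert t W" "T - {t} = insert s W" "finite W" "s \<notin> W" "t \<notin> W"
      using st assms by (auto simp: W_def)
    then show "elem_sign s (T - {s}) * (elem_sign t (T - {s} - {t}) * u (T - {s} - {t})) =
       - (elem_sign t (T - {t}) * (elem_sign s (T - {t} - {s}) * u (T - {t} - {s})))"
      using st by (cases "s < t") (auto simp: elem_sign_insert W_def[symmetric])
  qed
  finally show ?thesis .
qed

text \<open>The primitive evaluates \<open>u\<close> on the cone over \<open>T\<close> with apex
  \<open>s0\<close>, the standard contraction of a simplex with a vertex outside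
  \<open>X\<close>.\<close>

lemma cobdry_exact:
  fixes u :: "nat set \<Rightarrow> 'a::field_char_0"
  assumes S: "finite S" "s0 \<in> S" "s0 \<notin> X" 
    and cyc: "\<And>T. X \<subseteq> T \<Longrightarrow> T \<subseteq> S \<Longrightarrow> cobdry X u T = 0"
    and T: "X \<subseteq> T" "T \<subseteq> S"
  shows "cobdry X (\<lambda>T. if s0 \<in> T then 0 else elem_sign s0 T * u (insert s0 T)) T = u T"
proof (cases "s0 \<in> T")
  case True
  have "cobdry X (\<lambda>T. if s0 \<in> T then 0 else elem_sign s0 T * u (insert s0 T)) T
    = (\<Sum>s\<in>{s0}. elem_sign s (T - {s}) * (if s0 \<in> T - {s} then 0 else elem_sign s0 (T - {s}) * u (insert s0 (T - {s}))))"
    unfolding cobdry_def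
    by (rule sum.mono_neutral_right) (use True assms in \<open>auto simp: finite_subset\<close>)
  then show ?thesis using True by (simp add: insert_absorb)
next
  case False
  have fT: "finite T" using S T finite_subset by blast
  have "0 = cobdry X u (insert s0 T)" using cyc[of "insert s0 T"] T S by auto
  also have "\<dots> = elem_sign s0 T * u T + (\<Sum>t\<in>T - X. elem_sign t (insert s0 T - {t}) * u (insert s0 T - {t}))"
  proof -
    have "insert s0 T - X = insert s0 (T - X)" using S by auto
    then show ?thesis unfolding cobdry_def using False fT by simp
  qed
  finally have e: "(\<Sum>t\<in>T - X. elem_sign t (insert s0 T - {t}) * u (insert s0 T - {t})) = - (elem_sign s0 T * u T)"
    by (simp add: eq_neg_iff_add_eq_0 add.commute)
  have "cobdry X (\<lambda>T. if s0 \<in> T then 0 else elem_sign s0 T * u (insert s0 T)) T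
    = (\<Sum>t\<in>T - X. - elem_sign s0 T * (elem_sign t (insert s0 T - {t}) * u (insert s0 T - {t})))"
    unfolding cobdry_def
  proof (rule sum.cong[OF refl])
    fix t assume t: "t \<in> T - X"
    define W where "W = T - {t}"
    have W: "T = insert t W" "t \<notin> W" "finite W" "insert s0 T - {t} = insert s0 W" "s0 \<notin> W"
      using t False fT by (auto simp: W_def)
    show "elem_sign t (T - {t}) * (if s0 \<in> T - {t} then 0 else elem_sign s0 (T - {t}) * u (insert s0 (T - {t})))
      = - elem_sign s0 T * (elem_sign t (insert s0 T - {t}) * u (insert s0 T - {t}))"
      using W t False unfolding W(4) W_def[symmetric] unfolding W(1)
      by (cases "s0 < t") (auto simp: elem_sign_insert)
  qed
  also have "\<dots> = u T" using e by (simp add: sum_distrib_left[symmetric] sum_negf)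
  finally show ?thesis .
qed

section \<open>Representations and projective resolutions\<close>


definition unit_vec :: "'i \<Rightarrow> 'i \<Rightarrow> 'a::zero_neq_one" where
  "unit_vec e = (\<lambda>i. if i = e then 1 else 0)"

lemma sp_iff: "u \<in> sp M x \<longleftrightarrow> (\<forall>i. i \<notin> fst M x \<longrightarrow> u i = 0)"
  by (simp add: sp_def vsp_def)

lemma sp_zero [simp]: "(\<lambda>_. 0) \<in> sp M x"
  by (simp add: sp_iff)

lemma sp_add: "u \<in> sp M x \<Longrightarrow> w \<in> sp M x \<Longrightarrow> (\<lambda>i. u i + w i :: 'a::field) \<in> sp M x"
  by (simp add: sp_iff)

lemma sp_diff: "u \<in> sp M x \<Longrightarrow> w \<in> sp M x \<Longrightarrow> (\<lambda>i. u i - w i :: 'a::field) \<in> sp M x"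
  by (simp add: sp_iff)

lemma sp_scale: "u \<in> sp M x \<Longrightarrow> (\<lambda>i. c * u i :: 'a::field) \<in> sp M x"
  by (simp add: sp_iff)

lemma sp_sum: "(\<And>g. g \<in> G \<Longrightarrow> f g \<in> sp M x) \<Longrightarrow> (\<lambda>i. \<Sum>g\<in>G. c g * f g i :: 'a::field) \<in> sp M x"
  by (simp add: sp_iff)

lemma sp_unit: "e \<in> fst M x \<Longrightarrow> unit_vec e \<in> sp M x"
  by (auto simp: sp_iff unit_vec_def)

lemma sp_expand:
  assumes "finite (fst M x)" "u \<in> sp M x"
  shows "(u :: 'i \<Rightarrow> 'a::field) = (\<lambda>j. \<Sum>i\<in>fst M x. u i * unit_vec i j)"
proof
  fix j
  have "(\<Sum>i\<in>fst M x. u i * unit_vec i j) = (\<Sum>i\<in>fst M x. if i = j then u i else 0)"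
    by (intro sum.cong refl) (auto simp: unit_vec_def)
  then show "u j = (\<Sum>i\<in>fst M x. u i * unit_vec i j)"
    using assms by (auto simp: sp_iff)
qed

lemma lin_onD:
  assumes "lin_on V W h"
  shows "u \<in> V \<Longrightarrow> h u \<in> W"
    and "u \<in> V \<Longrightarrow> w \<in> V \<Longrightarrow> h (\<lambda>i. u i + w i) = (\<lambda>j. h u j + h w j)"
    and "u \<in> V \<Longrightarrow> h (\<lambda>i. c * u i) = (\<lambda>j. c * h u j)"
  using assms by (auto simp: lin_on_def)

lemma lin_on_zero:
  assumes "lin_on (sp M x) W h"
  shows "h (\<lambda>_. 0) = (\<lambda>_. 0)"
  using lin_onD(3)[OF assms sp_zero, of 0] by simp

lemma lin_on_diff:
  assumes "lin_on (sp M x) W h" "u \<in> sp M x" "w \<in> sp M x"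
  shows "h (\<lambda>i. u i - w i) = (\<lambda>j. h u j - h w j)"
  using lin_onD(2)[OF assms(1,2) sp_scale[OF assms(3), of "-1"]]
    lin_onD(3)[OF assms(1,3), of "-1"] by simp

lemma lin_on_sum:
  assumes "lin_on (sp M x) W h" "\<And>g. g \<in> G \<Longrightarrow> f g \<in> sp M x"
  shows "h (\<lambda>i. \<Sum>g\<in>G. c g * f g i) = (\<lambda>j. \<Sum>g\<in>G. c g * h (f g) j)"
  using assms(2)
proof (induction G rule: infinite_finite_induct)
  case (insert a G)
  have "h (\<lambda>i. \<Sum>g\<in>insert a G. c g * f g i) = h (\<lambda>i. c a * f a i + (\<Sum>g\<in>G. c g * f g i))"
    using insert.hyps by simp
  also have "\<dots> = (\<lambda>j. h (\<lambda>i. c a * f a i) j + h (\<lambda>i. \<Sum>g\<in>G. c g * f g i) j)"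
    using insert.prems by (intro lin_onD(2)[OF assms(1)] sp_scale sp_sum) auto
  also have "\<dots> = (\<lambda>j. c a * h (f a) j + (\<Sum>g\<in>G. c g * h (f g) j))"
    using insert.IH insert.prems lin_onD(3)[OF assms(1), of "f a" "c a"] by simp
  finally show ?case using insert.hyps by simp
qed (use lin_on_zero[OF assms(1)] in auto)

lemma is_homD:
  assumes "is_hom P le M N g" "x \<in> P"
  shows "lin_on (sp M x) (sp N x) (g x)"
    and "y \<in> P \<Longrightarrow> le y x \<Longrightarrow> u \<in> sp M x \<Longrightarrow> g y (act M x y u) = act N x y (g x u)"
    and "u \<in> sp M x \<Longrightarrow> g x u \<in> sp N x"
  using assms by (auto simp: is_hom_def lin_on_def)

lemma is_repD:
  assumes "is_rep P le M" "x \<in> P"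
  shows "finite (fst M x)"
    and "y \<in> P \<Longrightarrow> le y x \<Longrightarrow> lin_on (sp M x) (sp M y) (act M x y)"
    and "u \<in> sp M x \<Longrightarrow> act M x x u = u"
    and "y \<in> P \<Longrightarrow> z \<in> P \<Longrightarrow> le y x \<Longrightarrow> le z y \<Longrightarrow> u \<in> sp M x \<Longrightarrow> act M y z (act M x y u) = act M x z u"
    and "y \<in> P \<Longrightarrow> le y x \<Longrightarrow> u \<in> sp M x \<Longrightarrow> act M x y u \<in> sp M y"
  using assms by (auto simp: is_rep_def lin_on_def)

lemma is_hom_comp:
  assumes "is_hom P le L M f" "is_hom P le M N g"
  shows "is_hom P le L N (\<lambda>x u. g x (f x u))"
  using assms unfolding is_hom_def lin_on_def by simp

lemma is_hom_id: "is_rep P le M \<Longrightarrow> is_hom P le M M (\<lambda>x u. u)"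
  by (simp add: is_hom_def lin_on_def)

lemma is_hom_zero:
  assumes "is_rep P le N"
  shows "is_hom P le M N (\<lambda>x u _. 0)"
proof -
  have "act N x y (\<lambda>_. 0) = (\<lambda>_. 0)" if "x \<in> P" "y \<in> P" "le y x" for x y
    using lin_on_zero[OF is_repD(2)[OF assms that]] .
  then show ?thesis by (simp add: is_hom_def lin_on_def)
qed

lemma is_hom_add:
  assumes "is_hom P le M N f" "is_hom P le M N g" "is_rep P le N"
  shows "is_hom P le M N (\<lambda>x u j. f x u j + g x u j)"
  unfolding is_hom_def
proof (intro conjI ballI impI)
  fix x assume x: "x \<in> P"
  show "lin_on (sp M x) (sp N x) (\<lambda>u j. f x u j + g x u j)"
    using lin_onD[OF is_homD(1)[OF assms(1) x]] lin_onD[OF is_homD(1)[OF assms(2) x]]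
    by (auto simp: lin_on_def sp_add algebra_simps)
  fix y u assume "y \<in> P" "le y x" "u \<in> sp M x"
  then show "(\<lambda>j. f y (act M x y u) j + g y (act M x y u) j) = act N x y (\<lambda>j. f x u j + g x u j)"
    using lin_onD(2)[OF is_repD(2)[OF assms(3) x]] is_homD(2,3)[OF assms(1) x] is_homD(2,3)[OF assms(2) x]
    by simp
qed

lemma is_hom_diff:
  assumes "is_hom P le M N f" "is_hom P le M N g" "is_rep P le N"
  shows "is_hom P le M N (\<lambda>x u j. f x u j - g x u j)"
  unfolding is_hom_def
proof (intro conjI ballI impI)
  fix x assume x: "x \<in> P"
  show "lin_on (sp M x) (sp N x) (\<lambda>u j. f x u j - g x u j)"
    using lin_onD[OF is_homD(1)[OF assms(1) x]] lin_onD[OF is_homD(1)[OF assms(2) x]]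
    by (auto simp: lin_on_def sp_diff algebra_simps)
  fix y u assume "y \<in> P" "le y x" "u \<in> sp M x"
  then show "(\<lambda>j. f y (act M x y u) j - g y (act M x y u) j) = act N x y (\<lambda>j. f x u j - g x u j)"
    using lin_on_diff[OF is_repD(2)[OF assms(3) x]] is_homD(2,3)[OF assms(1) x] is_homD(2,3)[OF assms(2) x]
    by simp
qed

text \<open>The direct sum over \<open>g \<in> G\<close> of the indecomposable projectives generated
  at \<open>loc g\<close>, with \<open>enc\<close> naming the basis vectors. The basis at a vertex
  is contained in the basis at every vertex below it, so all structure maps are the identity on
  functions.\<close>

definition free :: "('v \<Rightarrow> 'v \<Rightarrow> bool) \<Rightarrow> 'g set \<Rightarrow> ('g \<Rightarrow> 'v) \<Rightarrow> ('g \<Rightarrow> 'i) \<Rightarrow> ('v, 'i, 'a) rep" where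
  "free le G loc enc = ((\<lambda>x. enc ` {g \<in> G. le x (loc g)}), (\<lambda>x y u. u))"

definition free_hom :: "('v \<Rightarrow> 'v \<Rightarrow> bool) \<Rightarrow> 'g set \<Rightarrow> ('g \<Rightarrow> 'v) \<Rightarrow> ('g \<Rightarrow> 'i) \<Rightarrow>
    ('v, 'j, 'a::field) rep \<Rightarrow> ('g \<Rightarrow> 'j \<Rightarrow> 'a) \<Rightarrow> 'v \<Rightarrow> ('i \<Rightarrow> 'a) \<Rightarrow> 'j \<Rightarrow> 'a" where
  "free_hom le G loc enc X c x u = (\<lambda>j. \<Sum>g\<in>{g \<in> G. le x (loc g)}. u (enc g) * act X (loc g) x (c g) j)"

locale fin_preorder =
  fixes P :: "'v set" and le :: "'v \<Rightarrow> 'v \<Rightarrow> bool"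
  assumes finP: "finite P"
    and le_refl: "x \<in> P \<Longrightarrow> le x x"
    and le_trans: "x \<in> P \<Longrightarrow> y \<in> P \<Longrightarrow> z \<in> P \<Longrightarrow> le x y \<Longrightarrow> le y z \<Longrightarrow> le x z"

locale free_module = fin_preorder P le for P :: "'v set" and le +
  fixes G :: "'g set" and loc :: "'g \<Rightarrow> 'v" and enc :: "'g \<Rightarrow> 'i"
  assumes finG: "finite G" and locP: "g \<in> G \<Longrightarrow> loc g \<in> P" and enc_inj: "inj_on enc G"
begin

abbreviation "F \<equiv> free le G loc enc"

lemma act_F [simp]: "act F x y u = u"
  by (simp add: free_def act_def)

lemma fst_F: "fst F x = enc ` {g \<in> G. le x (loc g)}"
  by (simp add: free_def)

lemma F_zero: "u \<in> sp F x \<Longrightarrow> g \<in> G \<Longrightarrow> \<not> le x (loc g) \<Longrightarrow> u (enc g) = 0"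
  using enc_inj by (auto simp: sp_iff fst_F inj_on_def)

lemma free_rep: "is_rep P le (F :: ('v, 'i, 'a::field) rep)"
proof -
  have "sp F x \<subseteq> (sp F y :: ('i \<Rightarrow> 'a) set)" if "x \<in> P" "y \<in> P" "le y x" for x y
  proof -
    have "fst (F :: ('v, 'i, 'a) rep) x \<subseteq> fst (F :: ('v, 'i, 'a) rep) y"
      using le_trans[OF that(2,1) locP that(3)] unfolding fst_F by (intro image_mono) auto
    then show ?thesis unfolding sp_iff subset_iff by blast
  qed
  then show ?thesis unfolding is_rep_def lin_on_def using finG by (simp add: fst_F subset_iff)
qed

lemma act_c:
  assumes "is_rep P le X" "g \<in> G" "x \<in> P" "le x (loc g)" "c g \<in> sp X (loc g)"
  shows "act X (loc g) x (c g) \<in> sp X x"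
  using is_repD(5)[OF assms(1) locP[OF assms(2)] assms(3,4,5)] .

lemma free_hom_hom:
  fixes X :: "('v, 'j, 'a::field) rep"
  assumes X: "is_rep P le X" and c: "\<And>g. g \<in> G \<Longrightarrow> c g \<in> sp X (loc g)"
  shows "is_hom P le F X (free_hom le G loc enc X c)"
  unfolding is_hom_def
proof (intro conjI ballI impI)
  fix x assume x: "x \<in> P"
  show "lin_on (sp F x) (sp X x) (free_hom le G loc enc X c x)"
    unfolding lin_on_def free_hom_def using act_c[OF X _ x] c
    by (auto simp: distrib_right sum.distrib sum_distrib_left mult.assoc intro!: sp_sum)
  fix y and u :: "'i \<Rightarrow> 'a" assume y: "y \<in> P" "le y x" and u: "u \<in> sp F x"
  have lin: "lin_on (sp X x) (sp X y) (act X x y)" using is_repD(2)[OF X x y] .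
  have "act X x y (free_hom le G loc enc X c x u) =
    (\<lambda>j. \<Sum>g\<in>{g \<in> G. le x (loc g)}. u (enc g) * act X x y (act X (loc g) x (c g)) j)"
    unfolding free_hom_def by (rule lin_on_sum[OF lin]) (use act_c[OF X _ x] c in auto)
  also have "\<dots> = (\<lambda>j. \<Sum>g\<in>{g \<in> G. le x (loc g)}. u (enc g) * act X (loc g) y (c g) j)"
    using is_repD(4)[OF X locP x y(1) _ y(2)] c by (auto intro!: ext sum.cong)
  also have "\<dots> = (\<lambda>j. \<Sum>g\<in>{g \<in> G. le y (loc g)}. u (enc g) * act X (loc g) y (c g) j)"
    using F_zero[OF u] finG le_trans[OF y(1) x locP y(2)]
    by (intro ext sum.mono_neutral_left) auto
  finally show "free_hom le G loc enc X c y (act F x y u) = act X x y (free_hom le G loc enc X c x u)"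
    by (simp add: free_hom_def)
qed

lemma unit_F: "g \<in> G \<Longrightarrow> x \<in> P \<Longrightarrow> le x (loc g) \<Longrightarrow> unit_vec (enc g) \<in> sp F x"
  by (intro sp_unit) (simp add: fst_F)

lemma free_hom_unit:
  assumes "is_rep P le X" "g \<in> G" "c g \<in> sp X (loc g)"
  shows "free_hom le G loc enc X c (loc g) (unit_vec (enc g)) = c g"
proof
  fix j
  have "free_hom le G loc enc X c (loc g) (unit_vec (enc g)) j
     = (\<Sum>h\<in>{g}. unit_vec (enc g) (enc h) * act X (loc h) (loc g) (c h) j)"
    unfolding free_hom_def using assms finG le_refl locP enc_inj
    by (intro sum.mono_neutral_right) (auto simp: unit_vec_def inj_on_def)
  then show "free_hom le G loc enc X c (loc g) (unit_vec (enc g)) j = c g j"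
    using is_repD(3)[OF assms(1) locP] assms by (simp add: unit_vec_def)
qed

lemma free_hom_comp:
  assumes X: "is_rep P le X" and d: "is_hom P le X Y d" and x: "x \<in> P"
    and c: "\<And>g. g \<in> G \<Longrightarrow> c g \<in> sp X (loc g)"
  shows "d x (free_hom le G loc enc X c x u) = free_hom le G loc enc Y (\<lambda>g. d (loc g) (c g)) x u"
proof -
  have "d x (free_hom le G loc enc X c x u)
     = (\<lambda>j. \<Sum>g\<in>{g \<in> G. le x (loc g)}. u (enc g) * d x (act X (loc g) x (c g)) j)"
    unfolding free_hom_def
    by (rule lin_on_sum[OF is_homD(1)[OF d x]]) (use act_c[OF X _ x] c in auto)
  also have "\<dots> = (\<lambda>j. \<Sum>g\<in>{g \<in> G. le x (loc g)}. u (enc g) * act Y (loc g) x (d (loc g) (c g)) j)"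
    using is_homD(2)[OF d locP x] c by (auto intro!: ext sum.cong)
  finally show ?thesis by (simp add: free_hom_def)
qed

lemma hom_from_free:
  fixes X :: "('v, 'j, 'a::field) rep"
  assumes \<phi>: "is_hom P le F X \<phi>" and x: "x \<in> P" and u: "u \<in> sp F x"
  shows "\<phi> x u = free_hom le G loc enc X (\<lambda>g. \<phi> (loc g) (unit_vec (enc g))) x u"
proof -
  have inj: "inj_on enc {g \<in> G. le x (loc g)}" using enc_inj by (rule inj_on_subset) auto
  have "u = (\<lambda>j. \<Sum>i\<in>fst (F :: ('v, 'i, 'a) rep) x. u i * unit_vec i j)"
    by (rule sp_expand[OF _ u]) (simp add: fst_F finG)
  also have "\<dots> = (\<lambda>j. \<Sum>g\<in>{g \<in> G. le x (loc g)}. u (enc g) * unit_vec (enc g) j)"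
    by (simp add: fst_F sum.reindex[OF inj])
  finally have "\<phi> x u = \<phi> x (\<lambda>j. \<Sum>g\<in>{g \<in> G. le x (loc g)}. u (enc g) * unit_vec (enc g) j)"
    by simp
  also have "\<dots> = (\<lambda>j. \<Sum>g\<in>{g \<in> G. le x (loc g)}. u (enc g) * \<phi> x (unit_vec (enc g)) j)"
    by (rule lin_on_sum[OF is_homD(1)[OF \<phi> x]]) (use unit_F x in auto)
  also have "\<dots> = (\<lambda>j. \<Sum>g\<in>{g \<in> G. le x (loc g)}. u (enc g) * act X (loc g) x (\<phi> (loc g) (unit_vec (enc g))) j)"
  proof (intro ext sum.cong refl)
    fix j g assume "g \<in> {g \<in> G. le x (loc g)}"
    then have g: "g \<in> G" "le x (loc g)" by auto
    have "unit_vec (enc g) \<in> sp (F :: ('v, 'i, 'a) rep) (loc g)"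
      by (rule unit_F[OF g(1) locP[OF g(1)] le_refl[OF locP[OF g(1)]]])
    from is_homD(2)[OF \<phi> locP[OF g(1)] x g(2) this]
    show "u (enc g) * \<phi> x (unit_vec (enc g)) j =
        u (enc g) * act X (loc g) x (\<phi> (loc g) (unit_vec (enc g))) j" by simp
  qed
  finally show ?thesis by (simp add: free_hom_def)
qed

text \<open>Generators are lifted one at a time, which works against every \<open>d\<close> whose
  image contains the values of \<open>f\<close>, and for any index types of \<open>X\<close> and
  \<open>Y\<close>.\<close>

lemma free_lift:
  fixes X :: "('v, 'j, 'a::field) rep"
  assumes X: "is_rep P le X" and d: "is_hom P le X Y d" and f: "is_hom P le F Y f"
    and im: "\<And>x u. x \<in> P \<Longrightarrow> u \<in> sp F x \<Longrightarrow> f x u \<in> d x ` sp X x"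
  shows "\<exists>h. is_hom P le F X h \<and> (\<forall>x\<in>P. \<forall>u\<in>sp F x. d x (h x u) = f x u)"
proof -
  have "\<exists>c. \<forall>g\<in>G. c g \<in> sp X (loc g) \<and> d (loc g) (c g) = f (loc g) (unit_vec (enc g))"
  proof (rule bchoice, rule ballI)
    fix g assume g: "g \<in> G"
    have "f (loc g) (unit_vec (enc g)) \<in> d (loc g) ` sp X (loc g)"
      using g by (intro im unit_F locP le_refl)
    then show "\<exists>c. c \<in> sp X (loc g) \<and> d (loc g) c = f (loc g) (unit_vec (enc g))" by force
  qed
  then obtain c where c: "\<And>g. g \<in> G \<Longrightarrow> c g \<in> sp X (loc g)"
    "\<And>g. g \<in> G \<Longrightarrow> d (loc g) (c g) = f (loc g) (unit_vec (enc g))" by blast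
  have "d x (free_hom le G loc enc X c x u) = f x u" if "x \<in> P" "u \<in> sp F x" for x u
  proof -
    have "d x (free_hom le G loc enc X c x u) = free_hom le G loc enc Y (\<lambda>g. d (loc g) (c g)) x u"
      by (rule free_hom_comp[OF X d that(1) c(1)])
    also have "\<dots> = free_hom le G loc enc Y (\<lambda>g. f (loc g) (unit_vec (enc g))) x u"
      unfolding free_hom_def by (intro ext sum.cong refl) (simp add: c(2))
    finally show ?thesis using hom_from_free[OF f that] by simp
  qed
  then show ?thesis using free_hom_hom[OF X c(1)] by blast
qed

lemma free_projective: "projective P le (F :: ('v, 'i, 'a::field) rep)"
  unfolding projective_def
proof (intro conjI allI impI free_rep, elim conjE)
  fix X Y :: "('v, 'i, 'a) rep" and g f
  assume *: "is_rep P le X" "is_hom P le X Y g" "surj_hom P X Y g" "is_hom P le F Y f"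
  have "\<exists>h. is_hom P le F X h \<and> (\<forall>x\<in>P. \<forall>u\<in>sp F x. g x (h x u) = f x u)"
    using *(3) is_homD(3)[OF *(4)] by (intro free_lift[OF *(1,2,4)]) (auto simp: surj_hom_def)
  then show "\<exists>h. is_hom P le F X h \<and> hom_eq P F (hcomp g h) f"
    by (simp add: hom_eq_def hcomp_def)
qed

end

context fin_preorder
begin

text \<open>A projective module is a direct summand of a free one, so the lifting property extends to maps
  that are not surjective, and to modules with arbitrary index types.\<close>

lemma projective_lift:
  fixes Q :: "('v, 'i, 'a::field) rep" and X :: "('v, 'j, 'a) rep"
  assumes inf: "infinite (UNIV :: 'i set)" and Q: "projective P le Q"
    and X: "is_rep P le X" and d: "is_hom P le X Y d" and f: "is_hom P le Q Y f"
    and im: "\<And>x u. x \<in> P \<Longrightarrow> u \<in> sp Q x \<Longrightarrow> f x u \<in> d x ` sp X x"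
  shows "\<exists>h. is_hom P le Q X h \<and> (\<forall>x\<in>P. \<forall>u\<in>sp Q x. d x (h x u) = f x u)"
proof -
  have QR: "is_rep P le Q" using Q by (simp add: projective_def)
  define G where "G = (SIGMA y:P. fst Q y)"
  have finG: "finite G" using finP is_repD(1)[OF QR] by (simp add: G_def)
  \<comment> \<open>The lifting property of \<open>Q\<close> is only tested on modules with index
    type \<open>'i\<close>, so the free cover must be encoded there; an infinite type has room for
    one index per basis vector of \<open>Q\<close> at each vertex.\<close>
  obtain B :: "'i set" where "finite B" "card B = card G"
    using infinite_arbitrarily_large[OF inf] by blast
  then obtain enc :: "'v \<times> 'i \<Rightarrow> 'i" where "inj_on enc G"
    using finG card_le_inj[of G B] by auto
  then interpret free_module P le G fst enc
  proof unfold_locales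
    show "finite G" by (rule finG)
    show "fst g \<in> P" if "g \<in> G" for g using that by (cases g) (simp add: G_def)
  qed
  define \<pi> where "\<pi> = free_hom le G fst enc Q (\<lambda>g. unit_vec (snd g))"
  have c: "unit_vec (snd g) \<in> sp Q (fst g)" if "g \<in> G" for g
    using that by (auto simp: G_def intro: sp_unit)
  have \<pi>: "is_hom P le F Q \<pi>" unfolding \<pi>_def by (rule free_hom_hom[OF QR c])
  have "surj_hom P F Q \<pi>" unfolding surj_hom_def
  proof (intro ballI equalityI subsetI)
    fix x u assume x: "x \<in> P" and "u \<in> \<pi> x ` sp F x"
    then show "u \<in> sp Q x" using is_homD(3)[OF \<pi> x] by auto
  next
    fix x u assume x: "x \<in> P" and u: "u \<in> sp Q x"
    define w where "w = (\<lambda>j. \<Sum>i\<in>fst Q x. u i * unit_vec (enc (x, i)) j)"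
    have unitF: "unit_vec (enc (x, i)) \<in> sp F x" if "i \<in> fst Q x" for i
      using that unit_F[of "(x, i)" x] x le_refl by (simp add: G_def)
    have "\<pi> x w = (\<lambda>j. \<Sum>i\<in>fst Q x. u i * \<pi> x (unit_vec (enc (x, i))) j)"
      unfolding w_def by (rule lin_on_sum[OF is_homD(1)[OF \<pi> x]]) (rule unitF)
    also have "\<dots> = (\<lambda>j. \<Sum>i\<in>fst Q x. u i * unit_vec i j)"
    proof (intro ext sum.cong refl)
      fix j i assume "i \<in> fst Q x"
      then have "(x, i) \<in> G" using x by (simp add: G_def)
      from free_hom_unit[OF QR this, of "\<lambda>g. unit_vec (snd g)"] c[OF this]
      show "u i * \<pi> x (unit_vec (enc (x, i))) j = u i * unit_vec i j"
        by (simp add: \<pi>_def)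
    qed
    also have "\<dots> = u" using sp_expand[OF is_repD(1)[OF QR x] u] by simp
    finally have "\<pi> x w = u" .
    moreover have "w \<in> sp F x" unfolding w_def by (rule sp_sum) (rule unitF)
    ultimately show "u \<in> \<pi> x ` sp F x" by blast
  qed
  \<comment> \<open>The lifting property of \<open>Q\<close> is used once, to split the free cover;
    the remaining lifting happens on the free module.\<close>
  then have "\<exists>s. is_hom P le Q F s \<and> hom_eq P Q (hcomp \<pi> s) (\<lambda>x u. u)"
    using Q free_rep QR \<pi> is_hom_id[OF QR] unfolding projective_def by blast
  then obtain s where s: "is_hom P le Q F s" "\<And>x u. x \<in> P \<Longrightarrow> u \<in> sp Q x \<Longrightarrow> \<pi> x (s x u) = u"
    by (auto simp: hom_eq_def hcomp_def)
  have "\<exists>h. is_hom P le F X h \<and> (\<forall>x\<in>P. \<forall>u\<in>sp F x. d x (h x u) = f x (\<pi> x u))"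
    using im is_homD(3)[OF \<pi>] by (intro free_lift[OF X d] is_hom_comp[OF \<pi> f]) auto
  then obtain h where h: "is_hom P le F X h" "\<And>x u. x \<in> P \<Longrightarrow> u \<in> sp F x \<Longrightarrow> d x (h x u) = f x (\<pi> x u)"
    by blast
  have "is_hom P le Q X (\<lambda>x u. h x (s x u))" by (rule is_hom_comp[OF s(1) h(1)])
  moreover have "d x (h x (s x u)) = f x u" if "x \<in> P" "u \<in> sp Q x" for x u
    using h(2)[OF that(1) is_homD(3)[OF s(1) that]] s(2)[OF that] by simp
  ultimately show ?thesis by (intro exI[of _ "\<lambda>x u. h x (s x u)"]) auto
qed

section \<open>Comparison of projective resolutions\<close>

definition aug_res :: "(nat \<Rightarrow> ('v, 'i, 'a::field) rep) \<Rightarrow> (nat \<Rightarrow> ('v, 'i, 'a) hom) \<Rightarrow> bool" where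
  "aug_res E D \<longleftrightarrow> is_rep P le (E 0) \<and> (\<forall>n. projective P le (E (Suc n))) \<and>
     (\<forall>n. is_hom P le (E (Suc n)) (E n) (D n)) \<and> surj_hom P (E (Suc 0)) (E 0) (D 0) \<and>
     (\<forall>n. \<forall>x\<in>P. {u \<in> sp (E (Suc n)) x. D n x u = (\<lambda>_. 0)} = D (Suc n) x ` sp (E (Suc (Suc n))) x)"

text \<open>With \<open>M\<close> itself as term 0, the augmentation and the differentials are
  treated alike, and the comparison of two resolutions starts from the identity in degree 0.\<close>

lemma aug_res_of_proj_res:
  assumes "proj_res P le M Pr d eps" "is_rep P le M"
  shows "aug_res (case_nat M Pr) (case_nat eps d)"
  unfolding aug_res_def
proof (intro conjI allI ballI)
  fix n
  show "projective P le (case_nat M Pr (Suc n))"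
    "is_hom P le (case_nat M Pr (Suc n)) (case_nat M Pr n) (case_nat eps d n)"
    using assms unfolding proj_res_def by (cases n; simp)+
  fix x assume x: "x \<in> P"
  show "{u \<in> sp (case_nat M Pr (Suc n)) x. case_nat eps d n x u = (\<lambda>_. 0)} =
       case_nat eps d (Suc n) x ` sp (case_nat M Pr (Suc (Suc n))) x"
    using assms x unfolding proj_res_def by (cases n; simp)
qed (use assms in \<open>simp_all add: proj_res_def\<close>)

lemma aug_resD:
  assumes "aug_res E D"
  shows "is_rep P le (E n)" "projective P le (E (Suc n))" "is_hom P le (E (Suc n)) (E n) (D n)"
    and "x \<in> P \<Longrightarrow> u \<in> sp (E (Suc n)) x \<Longrightarrow> D n x u = (\<lambda>_. 0) \<Longrightarrow> u \<in> D (Suc n) x ` sp (E (Suc (Suc n))) x"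
    and "x \<in> P \<Longrightarrow> w \<in> sp (E (Suc (Suc n))) x \<Longrightarrow> D n x (D (Suc n) x w) = (\<lambda>_. 0)"
    and "x \<in> P \<Longrightarrow> D 0 x ` sp (E (Suc 0)) x = sp (E 0) x"
proof -
  show "is_rep P le (E n)" using assms by (cases n) (auto simp: aug_res_def projective_def)
  assume "x \<in> P" "w \<in> sp (E (Suc (Suc n))) x"
  then have "D (Suc n) x w \<in> {u \<in> sp (E (Suc n)) x. D n x u = (\<lambda>_. 0)}"
    using assms unfolding aug_res_def by blast
  then show "D n x (D (Suc n) x w) = (\<lambda>_. 0)" by simp
next
  show "projective P le (E (Suc n))" "is_hom P le (E (Suc n)) (E n) (D n)"
    using assms by (simp_all add: aug_res_def)
next
  assume "x \<in> P"
  then show "D 0 x ` sp (E (Suc 0)) x = sp (E 0) x"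
    using assms by (simp add: aug_res_def surj_hom_def)
next
  assume "x \<in> P" "u \<in> sp (E (Suc n)) x" "D n x u = (\<lambda>_. 0)"
  then have "u \<in> {u \<in> sp (E (Suc n)) x. D n x u = (\<lambda>_. 0)}" by simp
  then show "u \<in> D (Suc n) x ` sp (E (Suc (Suc n))) x"
    using assms \<open>x \<in> P\<close> unfolding aug_res_def by (elim conjE) (simp only: simp_thms)
qed

lemma chain_map_exists:
  fixes E E' :: "nat \<Rightarrow> ('v, 'i, 'a::field) rep"
  assumes inf: "infinite (UNIV :: 'i set)" and R: "aug_res E D" and R': "aug_res E' D'" and E0: "E 0 = E' 0"
  shows "\<exists>F. (\<forall>n. is_hom P le (E n) (E' n) (F n)) \<and> F 0 = (\<lambda>x u. u) \<and>
     (\<forall>n. \<forall>x\<in>P. \<forall>u\<in>sp (E (Suc n)) x. D' n x (F (Suc n) x u) = F n x (D n x u))"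
proof -
  \<comment> \<open>The invariant also records that \<open>f\<close> after \<open>D n\<close> takes
    values in the image of \<open>D' n\<close>, which is what the next lift needs.\<close>
  define Pp where "Pp n f \<longleftrightarrow> is_hom P le (E n) (E' n) f \<and> (n = 0 \<longrightarrow> f = (\<lambda>x u. u)) \<and>
    (\<forall>x\<in>P. \<forall>u\<in>sp (E (Suc n)) x. f x (D n x u) \<in> D' n x ` sp (E' (Suc n)) x)" for n f
  have "\<exists>F. \<forall>n. Pp n (F n) \<and> (\<forall>x\<in>P. \<forall>u\<in>sp (E (Suc n)) x. D' n x (F (Suc n) x u) = F n x (D n x u))"
  proof (rule dependent_nat_choice)
    have "D 0 x u \<in> sp (E' 0) x" if "x \<in> P" "u \<in> sp (E (Suc 0)) x" for x u
      using is_homD(3)[OF aug_resD(3)[OF R] that] unfolding E0 .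
    then have "Pp 0 (\<lambda>x u. u)"
      using E0 aug_resD(6)[OF R'] is_hom_id[OF aug_resD(1)[OF R, of 0]]
      by (auto simp: Pp_def)
    then show "\<exists>f. Pp 0 f" by blast
  next
    fix f n assume f: "Pp n f"
    have "\<exists>h. is_hom P le (E (Suc n)) (E' (Suc n)) h \<and>
        (\<forall>x\<in>P. \<forall>u\<in>sp (E (Suc n)) x. D' n x (h x u) = f x (D n x u))"
      using f by (intro projective_lift[OF inf aug_resD(2)[OF R] aug_resD(1)[OF R'] aug_resD(3)[OF R']]
         is_hom_comp[OF aug_resD(3)[OF R]]) (auto simp: Pp_def)
    then obtain h where h: "is_hom P le (E (Suc n)) (E' (Suc n)) h"
      "\<And>x u. x \<in> P \<Longrightarrow> u \<in> sp (E (Suc n)) x \<Longrightarrow> D' n x (h x u) = f x (D n x u)" by blast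
    have "h x (D (Suc n) x w) \<in> D' (Suc n) x ` sp (E' (Suc (Suc n))) x"
      if x: "x \<in> P" and w: "w \<in> sp (E (Suc (Suc n))) x" for x w
    proof (rule aug_resD(4)[OF R' x])
      have Dw: "D (Suc n) x w \<in> sp (E (Suc n)) x" by (rule is_homD(3)[OF aug_resD(3)[OF R] x w])
      then show "h x (D (Suc n) x w) \<in> sp (E' (Suc n)) x" by (rule is_homD(3)[OF h(1) x])
      have "f x (\<lambda>_. 0) = (\<lambda>_. 0)" 
        using f by (intro lin_on_zero[OF is_homD(1)[of P le "E n" "E' n" f, OF _ x]]) (auto simp: Pp_def)
      then show "D' n x (h x (D (Suc n) x w)) = (\<lambda>_. 0)"
        using h(2)[OF x Dw] aug_resD(5)[OF R x w] by simp
    qed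
    then show "\<exists>h. Pp (Suc n) h \<and> (\<forall>x\<in>P. \<forall>u\<in>sp (E (Suc n)) x. D' n x (h x u) = f x (D n x u))"
      using h by (auto simp: Pp_def)
  qed
  then obtain F where F: "\<forall>n. Pp n (F n) \<and> (\<forall>x\<in>P. \<forall>u\<in>sp (E (Suc n)) x. D' n x (F (Suc n) x u) = F n x (D n x u))" ..
  show ?thesis
    by (rule exI[of _ F]) (use F Pp_def in simp)
qed

text \<open>\<open>K\<close> is a chain map over the identity of term 0, hence homotopic to the
  identity; starting with \<open>H 0 = 0\<close> makes the homotopy formula uniform over the
  augmented complex.\<close>

lemma homotopy_exists:
  fixes E :: "nat \<Rightarrow> ('v, 'i, 'a::field) rep"
  assumes inf: "infinite (UNIV :: 'i set)" and R: "aug_res E D"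
    and K: "\<And>n. is_hom P le (E n) (E n) (K n)" and K0: "K 0 = (\<lambda>x u. u)"
    and KD: "\<And>n x u. x \<in> P \<Longrightarrow> u \<in> sp (E (Suc n)) x \<Longrightarrow> D n x (K (Suc n) x u) = K n x (D n x u)"
  shows "\<exists>H. (\<forall>n. is_hom P le (E n) (E (Suc n)) (H n)) \<and> H 0 = (\<lambda>x u _. 0) \<and>
    (\<forall>n. \<forall>x\<in>P. \<forall>u\<in>sp (E (Suc n)) x.
        D (Suc n) x (H (Suc n) x u) = (\<lambda>j. u j - K (Suc n) x u j - H n x (D n x u) j))"
proof -
  note D = aug_resD(3)[OF R] and E = aug_resD(1)[OF R]
  define T where "T n h = (\<lambda>x u j. u j - K (Suc n) x u j - h x (D n x u) j)" for n h
  have T: "is_hom P le (E (Suc n)) (E (Suc n)) (T n h)" if "is_hom P le (E n) (E (Suc n)) h" for n h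
    unfolding T_def
    by (rule is_hom_diff[OF is_hom_diff[OF is_hom_id[OF E] K E] is_hom_comp[OF D that] E])
  have DT: "D n x (T n h x u) = (\<lambda>j. D n x u j - K n x (D n x u) j - D n x (h x (D n x u)) j)"
    if h: "is_hom P le (E n) (E (Suc n)) h" and x: "x \<in> P" and u: "u \<in> sp (E (Suc n)) x" for n h x u
  proof -
    note l = lin_on_diff[OF is_homD(1)[OF D x]]
    have "K (Suc n) x u \<in> sp (E (Suc n)) x" "h x (D n x u) \<in> sp (E (Suc n)) x"
      using is_homD(3)[OF K x u] is_homD(3)[OF h x is_homD(3)[OF D x u]] .
    then show ?thesis unfolding T_def
      using l[OF sp_diff[OF u]] l[OF u] KD[OF x u] by simp
  qed
  define Pp where "Pp n h \<longleftrightarrow> is_hom P le (E n) (E (Suc n)) h \<and> (n = 0 \<longrightarrow> h = (\<lambda>x u _. 0)) \<and>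
    (\<forall>x\<in>P. \<forall>u\<in>sp (E (Suc n)) x. T n h x u \<in> D (Suc n) x ` sp (E (Suc (Suc n))) x)" for n h
  have "\<exists>H. \<forall>n. Pp n (H n) \<and> (\<forall>x\<in>P. \<forall>u\<in>sp (E (Suc n)) x. D (Suc n) x (H (Suc n) x u) = T n (H n) x u)"
  proof (rule dependent_nat_choice)
    have z: "is_hom P le (E 0) (E (Suc 0)) (\<lambda>x u _. 0)" by (rule is_hom_zero[OF E])
    have "T 0 (\<lambda>x u _. 0) x u \<in> D (Suc 0) x ` sp (E (Suc (Suc 0))) x"
      if x: "x \<in> P" and u: "u \<in> sp (E (Suc 0)) x" for x u
      using DT[OF z x u] lin_on_zero[OF is_homD(1)[OF D x]] K0
      by (intro aug_resD(4)[OF R x is_homD(3)[OF T[OF z] x u]]) simp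
    then have "Pp 0 (\<lambda>x u _. 0)" using z by (auto simp: Pp_def)
    then show "\<exists>h. Pp 0 h" by blast
  next
    fix h n assume h: "Pp n h"
    then have hh: "is_hom P le (E n) (E (Suc n)) h" by (simp add: Pp_def)
    have "\<exists>g. is_hom P le (E (Suc n)) (E (Suc (Suc n))) g \<and>
        (\<forall>x\<in>P. \<forall>u\<in>sp (E (Suc n)) x. D (Suc n) x (g x u) = T n h x u)"
      using h by (intro projective_lift[OF inf aug_resD(2)[OF R] E D T[OF hh]]) (auto simp: Pp_def)
    then obtain g where g: "is_hom P le (E (Suc n)) (E (Suc (Suc n))) g"
      "\<And>x u. x \<in> P \<Longrightarrow> u \<in> sp (E (Suc n)) x \<Longrightarrow> D (Suc n) x (g x u) = T n h x u" by blast
    have "T (Suc n) g x w \<in> D (Suc (Suc n)) x ` sp (E (Suc (Suc (Suc n)))) x"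
      if x: "x \<in> P" and w: "w \<in> sp (E (Suc (Suc n))) x" for x w
    proof (rule aug_resD(4)[OF R x is_homD(3)[OF T[OF g(1)] x w]])
      have Dw: "D (Suc n) x w \<in> sp (E (Suc n)) x" by (rule is_homD(3)[OF D x w])
      have "D (Suc n) x (g x (D (Suc n) x w)) = T n h x (D (Suc n) x w)" by (rule g(2)[OF x Dw])
      also have "\<dots> = (\<lambda>j. D (Suc n) x w j - K (Suc n) x (D (Suc n) x w) j)"
        using lin_on_zero[OF is_homD(1)[OF hh x]] by (simp add: T_def aug_resD(5)[OF R x w])
      finally show "D (Suc n) x (T (Suc n) g x w) = (\<lambda>_. 0)"
        using DT[OF g(1) x w] by simp
    qed
    then show "\<exists>g. Pp (Suc n) g \<and> (\<forall>x\<in>P. \<forall>u\<in>sp (E (Suc n)) x. D (Suc n) x (g x u) = T n h x u)"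
      using g by (auto simp: Pp_def)
  qed
  then obtain H where H: "\<forall>n. Pp n (H n) \<and> (\<forall>x\<in>P. \<forall>u\<in>sp (E (Suc n)) x. D (Suc n) x (H (Suc n) x u) = T n (H n) x u)" ..
  show ?thesis
    by (rule exI[of _ H]) (use H Pp_def T_def in simp)
qed

text \<open>The negation of \<open>Ext_nonzero\<close> concerns all resolutions, so a nonzero class
  must be carried from one to another. A cocycle \<open>\<phi>\<close> is pulled back along the
  comparison map \<open>G\<close>; if the result were trivial, the homotopy between the composite of
  \<open>F\<close> and \<open>G\<close> and the identity would make \<open>\<phi>\<close> trivial
  too.\<close>

lemma hom_cohom_nz_unique:
  fixes M :: "('v, 'i, 'a::field) rep" and N :: "('v, 'j, 'a) rep"
  assumes inf: "infinite (UNIV :: 'i set)" and M: "is_rep P le M" and N: "is_rep P le N"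
    and R: "proj_res P le M Pr d eps" and R': "proj_res P le M Pr' d' eps'"
    and nz: "hom_cohom_nz P le Pr d N i"
  shows "hom_cohom_nz P le Pr' d' N i"
proof (rule ccontr)
  assume z: "\<not> hom_cohom_nz P le Pr' d' N i"
  define E where "E = case_nat M Pr"
  define D where "D = case_nat eps d"
  define E' where "E' = case_nat M Pr'"
  define D' where "D' = case_nat eps' d'"
  have [simp]: "E 0 = M" "\<And>n. E (Suc n) = Pr n" "\<And>n. D (Suc n) = d n"
      "E' 0 = M" "\<And>n. E' (Suc n) = Pr' n" "\<And>n. D' (Suc n) = d' n"
    by (simp_all add: E_def D_def E'_def D'_def)
  have A: "aug_res E D" unfolding E_def D_def by (rule aug_res_of_proj_res[OF R M])
  have A': "aug_res E' D'" unfolding E'_def D'_def by (rule aug_res_of_proj_res[OF R' M])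
  obtain F where F: "\<And>n. is_hom P le (E n) (E' n) (F n)" "F 0 = (\<lambda>x u. u)"
     "\<And>n x u. x \<in> P \<Longrightarrow> u \<in> sp (E (Suc n)) x \<Longrightarrow> D' n x (F (Suc n) x u) = F n x (D n x u)"
    using chain_map_exists[OF inf A A'] \<open>E 0 = M\<close> \<open>E' 0 = M\<close> by metis
  obtain G where G: "\<And>n. is_hom P le (E' n) (E n) (G n)" "G 0 = (\<lambda>x u. u)"
     "\<And>n x u. x \<in> P \<Longrightarrow> u \<in> sp (E' (Suc n)) x \<Longrightarrow> D n x (G (Suc n) x u) = G n x (D' n x u)"
    using chain_map_exists[OF inf A' A] \<open>E 0 = M\<close> \<open>E' 0 = M\<close> by metis
  have "\<exists>H. (\<forall>n. is_hom P le (E n) (E (Suc n)) (H n)) \<and> H 0 = (\<lambda>x u _. 0) \<and>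
    (\<forall>n. \<forall>x\<in>P. \<forall>u\<in>sp (E (Suc n)) x.
        D (Suc n) x (H (Suc n) x u) = (\<lambda>j. u j - G (Suc n) x (F (Suc n) x u) j - H n x (D n x u) j))"
  proof (rule homotopy_exists[OF inf A])
    show "is_hom P le (E n) (E n) (\<lambda>x u. G n x (F n x u))" for n
      by (rule is_hom_comp[OF F(1) G(1)])
    show "(\<lambda>x u. G 0 x (F 0 x u)) = (\<lambda>x u. u)" using F(2) G(2) by simp
    show "D n x (G (Suc n) x (F (Suc n) x u)) = G n x (F n x (D n x u))"
      if "x \<in> P" "u \<in> sp (E (Suc n)) x" for n x u
      using G(3)[OF that(1) is_homD(3)[OF F(1) that]] F(3)[OF that] by simp
  qed
  then obtain H where H: "\<And>n. is_hom P le (E n) (E (Suc n)) (H n)" "H 0 = (\<lambda>x u _. 0)"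
    "\<And>n x u. x \<in> P \<Longrightarrow> u \<in> sp (E (Suc n)) x \<Longrightarrow>
        D (Suc n) x (H (Suc n) x u) = (\<lambda>j. u j - G (Suc n) x (F (Suc n) x u) j - H n x (D n x u) j)"
    by blast
  from nz obtain \<phi> where \<phi>: "is_hom P le (Pr i) N \<phi>" "is_zero_hom P (Pr (Suc i)) (hcomp \<phi> (d i))"
    "case i of 0 \<Rightarrow> \<not> is_zero_hom P (Pr 0) \<phi>
         | Suc j \<Rightarrow> \<not> (\<exists>\<psi>. is_hom P le (Pr j) N \<psi> \<and> hom_eq P (Pr (Suc j)) \<phi> (hcomp \<psi> (d j)))"
    by (auto simp: hom_cohom_nz_def)
  have \<phi>d: "\<phi> x (d i x u) = (\<lambda>_. 0)" if "x \<in> P" "u \<in> sp (Pr (Suc i)) x" for x u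
    using \<phi>(2) that by (simp add: is_zero_hom_def hcomp_def)
  have G': "is_hom P le (Pr' n) (Pr n) (G (Suc n))" and F': "is_hom P le (Pr n) (Pr' n) (F (Suc n))"
    and H': "is_hom P le (E n) (Pr n) (H n)" for n
    using G(1)[of "Suc n"] F(1)[of "Suc n"] H(1)[of n] by simp_all
  have DD: "is_hom P le (Pr i) (E i) (D i)" using aug_resD(3)[OF A, of i] by simp
  have \<phi>G: "is_hom P le (Pr' i) N (\<lambda>x u. \<phi> x (G (Suc i) x u))" by (rule is_hom_comp[OF G' \<phi>(1)])
  have \<phi>Gz: "is_zero_hom P (Pr' (Suc i)) (hcomp (\<lambda>x u. \<phi> x (G (Suc i) x u)) (d' i))"
    unfolding is_zero_hom_def hcomp_def
  proof (intro ballI)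
    fix x u assume x: "x \<in> P" and u: "u \<in> sp (Pr' (Suc i)) x"
    have "G (Suc i) x (d' i x u) = d i x (G (Suc (Suc i)) x u)" using G(3)[OF x, of u "Suc i"] u by simp
    then show "\<phi> x (G (Suc i) x (d' i x u)) = (\<lambda>_. 0)" using \<phi>d[OF x is_homD(3)[OF G' x u]] by simp
  qed
  \<comment> \<open>\<open>\<phi>\<close> is applied to the homotopy formula; the term through
    \<open>d i\<close> vanishes because \<open>\<phi>\<close> is a cocycle.\<close>
  have decomp: "\<phi> x u = (\<lambda>j. \<phi> x (G (Suc i) x (F (Suc i) x u)) j + \<phi> x (H i x (D i x u)) j)"
    if x: "x \<in> P" and u: "u \<in> sp (Pr i) x" for x u
  proof -
    have m: "G (Suc i) x (F (Suc i) x u) \<in> sp (Pr i) x" "H i x (D i x u) \<in> sp (Pr i) x"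
      using is_homD(3)[OF G' x is_homD(3)[OF F' x u]] is_homD(3)[OF H' x is_homD(3)[OF DD x u]] .
    have e: "d i x (H (Suc i) x u) = (\<lambda>j. u j - G (Suc i) x (F (Suc i) x u) j - H i x (D i x u) j)"
      using H(3)[OF x, of u i] u by simp
    have "H (Suc i) x u \<in> sp (Pr (Suc i)) x" using is_homD(3)[OF H'[of "Suc i"] x] u by simp
    from \<phi>d[OF x this] have "\<phi> x (\<lambda>j. u j - G (Suc i) x (F (Suc i) x u) j - H i x (D i x u) j) = (\<lambda>_. 0)"
      unfolding e .
    note z0 = this
    note l = lin_on_diff[OF is_homD(1)[OF \<phi>(1) x]]
    have e2: "\<phi> x (\<lambda>j. u j - G (Suc i) x (F (Suc i) x u) j - H i x (D i x u) j) =
       (\<lambda>j. \<phi> x u j - \<phi> x (G (Suc i) x (F (Suc i) x u)) j - \<phi> x (H i x (D i x u)) j)"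
      using l[OF sp_diff[OF u m(1)] m(2)] l[OF u m(1)] by simp
    show ?thesis
    proof
      fix j
      from fun_cong[OF trans[OF sym[OF e2] z0], of j]
      show "\<phi> x u j = \<phi> x (G (Suc i) x (F (Suc i) x u)) j + \<phi> x (H i x (D i x u)) j"
        by (simp add: algebra_simps)
    qed
  qed
  have zz: "\<not> (case i of 0 \<Rightarrow> \<not> is_zero_hom P (Pr' 0) (\<lambda>x u. \<phi> x (G (Suc i) x u))
         | Suc j \<Rightarrow> \<not> (\<exists>\<psi>. is_hom P le (Pr' j) N \<psi> \<and>
             hom_eq P (Pr' (Suc j)) (\<lambda>x u. \<phi> x (G (Suc i) x u)) (hcomp \<psi> (d' j))))"
    using z \<phi>G \<phi>Gz unfolding hom_cohom_nz_def by blast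
  show False
  proof (cases i)
    \<comment> \<open>In degree 0 the second summand of \<open>decomp\<close> contains
      \<open>H 0 = 0\<close>, so \<open>\<phi>\<close> vanishes with its pullback.\<close>
    case 0
    have "is_zero_hom P (Pr' 0) (\<lambda>x u. \<phi> x (G (Suc i) x u))"
      using zz unfolding 0 by simp
    then have "\<phi> x (G (Suc 0) x (F (Suc 0) x u)) = (\<lambda>_. 0)" if "x \<in> P" "u \<in> sp (Pr 0) x" for x u
      using is_homD(3)[OF F' that] that(1) 0 by (simp add: is_zero_hom_def)
    moreover have "\<phi> x (\<lambda>_. 0) = (\<lambda>_. 0)" if "x \<in> P" for x
      using lin_on_zero[OF is_homD(1)[OF \<phi>(1) that]] .
    ultimately have "\<phi> x u = (\<lambda>_. 0)" if "x \<in> P" "u \<in> sp (Pr 0) x" for x u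
      by (subst decomp) (use that 0 H(2) in simp_all)
    then have "is_zero_hom P (Pr 0) \<phi>" unfolding is_zero_hom_def by blast
    then show False using \<phi>(3) 0 by simp
  next
    case (Suc k)
    obtain \<psi> where \<psi>: "is_hom P le (Pr' k) N \<psi>"
       "hom_eq P (Pr' (Suc k)) (\<lambda>x u. \<phi> x (G (Suc i) x u)) (hcomp \<psi> (d' k))"
      using zz[unfolded Suc nat.case not_not] by (elim exE conjE) (rule that, simp_all add: Suc)
    have Hi: "is_hom P le (Pr k) (Pr i) (H i)" using H'[of i] Suc by simp
    \<comment> \<open>The primitive of \<open>\<phi>\<close>: the primitive \<open>\<psi>\<close> of
      the pullback carried back along \<open>F\<close>, corrected by the homotopy.\<close>
    have "is_hom P le (Pr k) N (\<lambda>x u j. \<psi> x (F i x u) j + \<phi> x (H i x u) j)"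
      using F'[of k] Suc by (intro is_hom_add[OF is_hom_comp[OF _ \<psi>(1)] is_hom_comp[OF Hi \<phi>(1)] N]) simp
    moreover have "hom_eq P (Pr (Suc k)) \<phi> (hcomp (\<lambda>x u j. \<psi> x (F i x u) j + \<phi> x (H i x u) j) (d k))"
      unfolding hom_eq_def hcomp_def
    proof (intro ballI)
      fix x u assume x: "x \<in> P" and u: "u \<in> sp (Pr (Suc k)) x"
      have "\<phi> x (G (Suc i) x (F (Suc i) x u)) = \<psi> x (d' k x (F (Suc i) x u))"
        using \<psi>(2) is_homD(3)[OF F' x u] x Suc by (simp add: hom_eq_def hcomp_def)
      also have "d' k x (F (Suc i) x u) = F i x (d k x u)"
        using F(3)[OF x, of u "Suc k"] u Suc by simp
      finally have "\<phi> x (G (Suc i) x (F (Suc i) x u)) = \<psi> x (F i x (d k x u))" .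
      then show "\<phi> x u = (\<lambda>j. \<psi> x (F i x (d k x u)) j + \<phi> x (H i x (d k x u)) j)"
        by (subst decomp) (use x u Suc in simp_all)
    qed
    ultimately show False using \<phi>(3) Suc by auto
  qed
qed

end

section \<open>The Koszul resolution over a boolean interval\<close>


text \<open>Both sides sum over pairs of a set and one of its points, matched by deleting the point.
  Through this identity, precomposition with the Koszul differential acts as \<open>bdry\<close> on
  the coefficients of a map into \<open>A\<close>.\<close>

lemma cobdry_bdry_adjoint:
  fixes w z :: "nat set \<Rightarrow> 'a::comm_ring_1"
  assumes S: "finite S"
  shows "(\<Sum>T | T \<subseteq> S \<and> card (S - T) = k. cobdry {} w T * z T) =
         (\<Sum>U | U \<subseteq> S \<and> card (S - U) = Suc k. w U * bdry S z U)"
proof -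
  let ?G = "\<lambda>k. {T. T \<subseteq> S \<and> card (S - T) = k}"
  have fG: "finite (?G k)" for k using S by (intro finite_subset[of "?G k" "Pow S"]) auto
  have "(\<Sum>T\<in>?G k. cobdry {} w T * z T) = (\<Sum>T\<in>?G k. \<Sum>t\<in>T. elem_sign t (T - {t}) * w (T - {t}) * z T)"
    by (simp add: cobdry_def sum_distrib_right)
  also have "\<dots> = (\<Sum>(T,t)\<in>Sigma (?G k) (\<lambda>T. T). elem_sign t (T - {t}) * w (T - {t}) * z T)"
    by (rule sum.Sigma) (use fG S finite_subset in auto)
  also have "\<dots> = (\<Sum>(U,s)\<in>Sigma (?G (Suc k)) (\<lambda>U. S - U). w U * (elem_sign s U * z (insert s U)))"
  proof (rule sum.reindex_bij_witness[where i = "\<lambda>(U,s). (insert s U, s)" and j = "\<lambda>(T,t). (T - {t}, t)"])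
    fix a assume "a \<in> Sigma (?G k) (\<lambda>T. T)"
    then obtain T t where a: "a = (T, t)" "T \<subseteq> S" "card (S - T) = k" "t \<in> T" by auto
    have "S - (T - {t}) = insert t (S - T)" using a by auto
    then have "card (S - (T - {t})) = Suc k" using a S by simp
    then show "(case a of (T, t) \<Rightarrow> (T - {t}, t)) \<in> Sigma (?G (Suc k)) (\<lambda>U. S - U)"
      using a by auto
    show "(case (case a of (T, t) \<Rightarrow> (T - {t}, t)) of (U, s) \<Rightarrow> (insert s U, s)) = a"
      using a by auto
    show "(case (case a of (T, t) \<Rightarrow> (T - {t}, t)) of (U, s) \<Rightarrow> w U * (elem_sign s U * z (insert s U))) =
        (case a of (T, t) \<Rightarrow> elem_sign t (T - {t}) * w (T - {t}) * z T)"
      using a by (simp add: insert_absorb mult_ac)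
  next
    fix b assume "b \<in> Sigma (?G (Suc k)) (\<lambda>U. S - U)"
    then obtain U s where b: "b = (U, s)" "U \<subseteq> S" "card (S - U) = Suc k" "s \<in> S" "s \<notin> U" by auto
    have "S - U = insert s (S - insert s U)" using b by auto
    then have "card (S - U) = Suc (card (S - insert s U))" using S
      by (metis Diff_iff card_insert_disjoint finite_Diff insertI1)
    then show "(case b of (U, s) \<Rightarrow> (insert s U, s)) \<in> Sigma (?G k) (\<lambda>T. T)"
      using b by auto
    show "(case (case b of (U, s) \<Rightarrow> (insert s U, s)) of (T, t) \<Rightarrow> (T - {t}, t)) = b"
      using b by auto
  qed
  also have "\<dots> = (\<Sum>U\<in>?G (Suc k). \<Sum>s\<in>S - U. w U * (elem_sign s U * z (insert s U)))"
    by (rule sum.Sigma[symmetric]) (use fG S in auto)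
  also have "\<dots> = (\<Sum>U\<in>?G (Suc k). w U * bdry S z U)"
    by (simp add: bdry_def sum_distrib_left)
  finally show ?thesis .
qed

locale boolean_interval = fin_preorder P le for P :: "'v set" and le +
  fixes S :: "nat set" and Fm :: "nat set \<Rightarrow> 'v"
  assumes finS: "finite S" and inf: "infinite (UNIV :: 'v set)"
    and FmP: "T \<subseteq> S \<Longrightarrow> Fm T \<in> P"
    and Fm_le: "T \<subseteq> S \<Longrightarrow> U \<subseteq> S \<Longrightarrow> le (Fm T) (Fm U) \<longleftrightarrow> T \<subseteq> U"
    and Fm_surj: "x \<in> P \<Longrightarrow> le x (Fm S) \<Longrightarrow> \<exists>T\<subseteq>S. x = Fm T"
begin

definition codim_sets :: "nat \<Rightarrow> nat set set" where
  "codim_sets k = {T. T \<subseteq> S \<and> card (S - T) = k}"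

lemma codim_sets_iff: "T \<in> codim_sets k \<longleftrightarrow> T \<subseteq> S \<and> card (S - T) = k"
  by (simp add: codim_sets_def)

lemma Fm_inj: "T \<subseteq> S \<Longrightarrow> U \<subseteq> S \<Longrightarrow> Fm T = Fm U \<longleftrightarrow> T = U"
  by (metis Fm_le subset_antisym order_refl)

sublocale K: free_module P le "codim_sets k" Fm Fm for k
proof
  show "finite (codim_sets k)"
    using finS by (intro finite_subset[of "codim_sets k" "Pow S"]) (auto simp: codim_sets_def)
  show "Fm g \<in> P" if "g \<in> codim_sets k" for g using that FmP by (simp add: codim_sets_iff)
  show "inj_on Fm (codim_sets k)" using Fm_inj by (simp add: inj_on_def codim_sets_iff)
qed

text \<open>Each generator is named by its own vertex, so the complex has the index type of
  \<open>simple_rep\<close>, as \<open>Ext_nonzero\<close> requires of a resolution.\<close>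

abbreviation Kos :: "nat \<Rightarrow> ('v, 'v, 'a) rep" where
  "Kos k \<equiv> free le (codim_sets k) Fm Fm"

lemma sp_Kos: "sp (Kos k) x = {u. \<forall>p. u p \<noteq> 0 \<longrightarrow> (\<exists>T\<in>codim_sets k. p = Fm T \<and> le x (Fm T))}"
  unfolding sp_def vsp_def K.fst_F by blast

lemma Kos_supp:
  assumes "u \<in> sp (Kos k) x" "T \<subseteq> S" "u (Fm T) \<noteq> 0"
  shows "T \<in> codim_sets k" "le x (Fm T)"
proof -
  obtain U where "U \<in> codim_sets k" "le x (Fm U)" "Fm T = Fm U" 
    using assms unfolding sp_Kos by blast
  then show "T \<in> codim_sets k" "le x (Fm T)" using Fm_inj assms(2) by (auto simp: codim_sets_iff)
qed

lemma Kos_memI: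
  assumes "\<And>p. u p \<noteq> 0 \<Longrightarrow> \<exists>T\<in>codim_sets k. p = Fm T \<and> le x (Fm T)"
  shows "u \<in> sp (Kos k) x"
  using assms unfolding sp_Kos by blast

definition idx :: "'v \<Rightarrow> nat set" where "idx p = inv_into (Pow S) Fm p"

lemma idx [simp]: "T \<subseteq> S \<Longrightarrow> idx (Fm T) = T"
  unfolding idx_def by (rule inv_into_f_f) (auto simp: inj_on_def Fm_inj)

definition dK :: "nat \<Rightarrow> ('v, 'v, 'a::field_char_0) hom" where
  "dK k x u = (\<lambda>p. if p \<in> Fm ` codim_sets k then cobdry {} (\<lambda>U. u (Fm U)) (idx p) else 0)"

lemma dK_Fm: "T \<in> codim_sets k \<Longrightarrow> dK k x u (Fm T) = cobdry {} (\<lambda>U. u (Fm U)) T"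
  by (simp add: dK_def codim_sets_iff)

lemma dK_sp:
  assumes "x \<in> P" "u \<in> sp (Kos (Suc k)) x"
  shows "dK k x u \<in> sp (Kos k) x"
proof (rule Kos_memI)
  fix p assume "dK k x u p \<noteq> 0"
  then obtain T where T: "T \<in> codim_sets k" "p = Fm T" "cobdry {} (\<lambda>U. u (Fm U)) T \<noteq> 0"
    by (auto simp: dK_def codim_sets_iff split: if_splits)
  then obtain t where t: "t \<in> T" "u (Fm (T - {t})) \<noteq> 0"
    unfolding cobdry_def by (metis (no_types, lifting) mult_zero_right sum.neutral Diff_empty)
  have TS: "T - {t} \<subseteq> S" "T \<subseteq> S" using T by (auto simp: codim_sets_iff)
  from Kos_supp(2)[OF assms(2) TS(1) t(2)] have "le x (Fm (T - {t}))" .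
  moreover have "le (Fm (T - {t})) (Fm T)" using Fm_le TS by auto
  ultimately have "le x (Fm T)" using le_trans[of x "Fm (T - {t})" "Fm T"] assms(1) FmP TS by blast
  then show "\<exists>T\<in>codim_sets k. p = Fm T \<and> le x (Fm T)" using T by blast
qed

lemma dK_hom: "is_hom P le (Kos (Suc k)) (Kos k) (dK k)"
  unfolding is_hom_def
proof (intro conjI ballI impI)
  fix x assume "x \<in> P"
  show "lin_on (sp (Kos (Suc k)) x) (sp (Kos k) x) (dK k x)"
    unfolding lin_on_def using dK_sp[OF \<open>x \<in> P\<close>]
    by (auto simp: dK_def cobdry_def distrib_left sum.distrib sum_distrib_left mult_ac intro!: ext sum.cong)
next
  fix x y u
  show "dK k y (act (Kos (Suc k)) x y u) = act (Kos k) x y (dK k x u)"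
    by (simp add: dK_def)
qed

lemma card_Diff_remove:
  assumes "T \<subseteq> S" "t \<in> T"
  shows "card (S - (T - {t})) = Suc (card (S - T))"
proof -
  have "S - (T - {t}) = insert t (S - T)" using assms by auto
  then show ?thesis using assms finS by simp
qed

lemma dK_dK: "dK k x (dK (Suc k) x u) = (\<lambda>_. 0 :: 'a::field_char_0)"
proof
  fix p
  show "dK k x (dK (Suc k) x u) p = 0"
  proof (cases "p \<in> Fm ` codim_sets k")
    case True
    then obtain T where T: "T \<in> codim_sets k" "p = Fm T" by auto
    have fT: "finite T" using T finS by (auto simp: codim_sets_iff finite_subset)
    have "dK k x (dK (Suc k) x u) p = cobdry {} (\<lambda>U. dK (Suc k) x u (Fm U)) T"
      using T dK_Fm by simp
    also have "\<dots> = cobdry {} (cobdry {} (\<lambda>U. u (Fm U))) T"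
      unfolding cobdry_def[of "{}" _ T]
    proof (rule sum.cong[OF refl])
      fix t assume "t \<in> T - {}"
      then have "T - {t} \<in> codim_sets (Suc k)" using T card_Diff_remove by (auto simp: codim_sets_iff)
      then show "elem_sign t (T - {t}) * dK (Suc k) x u (Fm (T - {t})) = elem_sign t (T - {t}) * cobdry {} (\<lambda>U. u (Fm U)) (T - {t})"
        by (simp add: dK_Fm)
    qed
    also have "\<dots> = 0" using cobdry_cobdry[OF fT] .
    finally show ?thesis .
  qed (simp add: dK_def)
qed

text \<open>At a vertex not below \<open>Fm S\<close> all terms vanish. At \<open>x = Fm X\<close>
  the complex is the cochain complex of the simplex on \<open>S - X\<close>, contractible through
  any \<open>s0 \<in> S - X\<close>; at the top vertex only the generator of degree 0 lives, which
  \<open>nt\<close> excludes.\<close>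

lemma Kos_exact:
  fixes u :: "'v \<Rightarrow> 'a::field_char_0"
  assumes x: "x \<in> P" and u: "u \<in> sp (Kos k) x" and nt: "x \<noteq> Fm S \<or> k > 0"
    and cyc: "\<And>T. T \<subseteq> S \<Longrightarrow> Suc (card (S - T)) = k \<Longrightarrow> cobdry {} (\<lambda>U. u (Fm U)) T = 0"
  shows "u \<in> dK k x ` sp (Kos (Suc k)) x"
proof (cases "u = (\<lambda>_. 0)")
  case True
  have "dK k x (\<lambda>_. 0) = (\<lambda>_. 0 :: 'a)" by (auto simp: dK_def cobdry_def)
  with True have "u = dK k x (\<lambda>_. 0)" by simp
  then show ?thesis by (intro image_eqI[of _ _ "\<lambda>_. 0"]) simp_all
next
  case False
  then obtain p where "u p \<noteq> 0" by auto
  then obtain T0 where T0: "T0 \<in> codim_sets k" "le x (Fm T0)" using u unfolding sp_Kos by blast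
  have "le (Fm T0) (Fm S)" using Fm_le T0 by (auto simp: codim_sets_iff)
  then have "le x (Fm S)" using le_trans[OF x FmP FmP T0(2)] T0(1) by (simp add: codim_sets_iff)
  then obtain X where X: "X \<subseteq> S" "x = Fm X" using Fm_surj[OF x] by auto
  have supp: "T \<in> codim_sets k \<and> X \<subseteq> T" if "u (Fm T) \<noteq> 0" "T \<subseteq> S" for T
    using Kos_supp[OF u that(2,1)] Fm_le that X by simp
  have "X \<noteq> S"
  proof
    assume "X = S"
    then have "T0 = S" using T0 Fm_le X by (auto simp: codim_sets_iff)
    then show False using nt X \<open>X = S\<close> T0 by (auto simp: codim_sets_iff)
  qed
  then obtain s0 where s0: "s0 \<in> S" "s0 \<notin> X" using X by auto
  define h where "h T = (if s0 \<in> T then 0 else elem_sign s0 T * u (Fm (insert s0 T)))" for T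
  define y where "y p = (if p \<in> Fm ` codim_sets (Suc k) then h (idx p) else 0)" for p
  have yF: "y (Fm T) = h T" if "T \<in> codim_sets (Suc k)" for T
    using that by (simp add: y_def codim_sets_iff)
  have y: "y \<in> sp (Kos (Suc k)) x"
  proof (rule Kos_memI)
    fix p assume "y p \<noteq> 0"
    then obtain T where T: "T \<in> codim_sets (Suc k)" "p = Fm T" "h T \<noteq> 0"
      by (auto simp: y_def codim_sets_iff split: if_splits)
    then have TS: "T \<subseteq> S" by (simp add: codim_sets_iff)
    have "u (Fm (insert s0 T)) \<noteq> 0" using T(3) by (auto simp: h_def split: if_splits)
    then have "X \<subseteq> insert s0 T" using supp TS s0 by blast
    then have "X \<subseteq> T" using s0 by auto
    then show "\<exists>T\<in>codim_sets (Suc k). p = Fm T \<and> le x (Fm T)" using T X Fm_le TS by auto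
  qed
  \<comment> \<open>As \<open>u\<close> is supported on sets containing \<open>X\<close>, deleting a
    point of \<open>X\<close> contributes nothing.\<close>
  have cobdX: "cobdry X (\<lambda>U. u (Fm U)) T = cobdry {} (\<lambda>U. u (Fm U)) T" if "T \<subseteq> S" for T
  proof -
    have "finite T" using that finS finite_subset by auto
    then show ?thesis unfolding cobdry_def
      by (intro sum.mono_neutral_left) (use supp that in \<open>fastforce+\<close>)
  qed
  have cyc': "cobdry X (\<lambda>U. u (Fm U)) T = 0" if "T \<subseteq> S" for T
  proof (cases "Suc (card (S - T)) = k")
    case True
    then show ?thesis using cyc that cobdX by simp
  next
    case False
    have "u (Fm (T - {t})) = 0" if "t \<in> T" for t
      using supp[of "T - {t}"] card_Diff_remove[OF \<open>T \<subseteq> S\<close> that] False \<open>T \<subseteq> S\<close>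
      by (auto simp: codim_sets_iff)
    then show ?thesis unfolding cobdry_def by simp
  qed
  have "dK k x y = u"
  proof
    fix p
    show "dK k x y p = u p"
    proof (cases "p \<in> Fm ` {T \<in> codim_sets k. X \<subseteq> T}")
      case True
      then obtain T where T: "T \<in> codim_sets k" "X \<subseteq> T" "p = Fm T" by auto
      have TS: "T \<subseteq> S" using T by (simp add: codim_sets_iff)
      have fT: "finite T" using TS finS finite_subset by auto
      have "dK k x y p = cobdry {} (\<lambda>U. y (Fm U)) T" using T by (simp add: dK_Fm)
      also have "\<dots> = cobdry {} h T" unfolding cobdry_def
      proof (rule sum.cong[OF refl])
        fix t assume "t \<in> T - {}"
        then have "T - {t} \<in> codim_sets (Suc k)" using T card_Diff_remove by (auto simp: codim_sets_iff)
        then show "elem_sign t (T - {t}) * y (Fm (T - {t})) = elem_sign t (T - {t}) * h (T - {t})"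
          by (simp add: yF)
      qed
      also have "\<dots> = cobdry X h T" unfolding cobdry_def
      proof (rule sum.mono_neutral_right)
        show "\<forall>i\<in>T - {} - (T - X). elem_sign i (T - {i}) * h (T - {i}) = 0"
        proof
          fix i assume i: "i \<in> T - {} - (T - X)"
          have "u (Fm (insert s0 (T - {i}))) = 0"
            using supp[of "insert s0 (T - {i})"] i s0 TS by blast
          then show "elem_sign i (T - {i}) * h (T - {i}) = 0" by (simp add: h_def)
        qed
      qed (use fT in auto)
      also have "\<dots> = u (Fm T)"
        unfolding h_def by (rule cobdry_exact[OF finS s0 cyc' T(2) TS])
      finally show ?thesis using T by simp
    next
      case False
      have *: "w p = 0" if "w \<in> sp (Kos k) x" for w :: "'v \<Rightarrow> 'a"
        using that False X Fm_le unfolding sp_Kos by (force simp: codim_sets_iff)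
      show ?thesis using *[OF u] *[OF dK_sp[OF x y]] by simp
    qed
  qed
  then show ?thesis using y by (intro image_eqI[of _ _ y]) simp_all
qed

definition epsK :: "('v, 'v, 'a::field_char_0) hom" where
  "epsK x u = (if x = Fm S then u else (\<lambda>_. 0))"

lemma sp_simple: "sp (simple_rep v) x = (if x = v then {u. \<forall>i. i \<noteq> v \<longrightarrow> u i = 0} else {\<lambda>_. 0})"
  by (auto simp: sp_def vsp_def simple_rep_def)

lemma act_simple: "act (simple_rep v) x y u = (if x = y then u else (\<lambda>_. 0))"
  by (simp add: act_def simple_rep_def)

lemma simple_rep_is_rep: "is_rep P le (simple_rep (Fm S) :: ('v, 'v, 'a::field) rep)"
proof -
  \<comment> \<open>A path from \<open>Fm S\<close> back to \<open>Fm S\<close> never leaves it,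
    since inside the interval the order is antisymmetric. Otherwise the structure maps, zero between
    different vertices, would not compose.\<close>
  have eq: "y = Fm S" if y: "y \<in> P" "le y (Fm S)" "le (Fm S) y" for y
  proof -
    obtain T where T: "T \<subseteq> S" "y = Fm T" using Fm_surj[OF y(1,2)] by blast
    then have "S \<subseteq> T" using Fm_le[OF order_refl T(1)] y(3) by simp
    then show ?thesis using T by auto
  qed
  have "finite (fst (simple_rep (Fm S) :: ('v, 'v, 'a) rep) x)" for x by (simp add: simple_rep_def)
  moreover have "act (simple_rep (Fm S)) x x u = u" for x and u :: "'v \<Rightarrow> 'a" by (simp add: act_simple)
  moreover have "lin_on (sp (simple_rep (Fm S)) x) (sp (simple_rep (Fm S)) y)
     (act (simple_rep (Fm S)) x y :: ('v \<Rightarrow> 'a) \<Rightarrow> _)" for x y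
    by (auto simp: lin_on_def sp_simple act_simple)
  moreover have "act (simple_rep (Fm S)) y z (act (simple_rep (Fm S)) x y u) = (act (simple_rep (Fm S)) x z u :: 'v \<Rightarrow> 'a)"
    if "x \<in> P" "y \<in> P" "z \<in> P" "le y x" "le z y" "u \<in> sp (simple_rep (Fm S)) x" for x y z u
    using that eq by (auto simp: sp_simple act_simple split: if_splits)
  ultimately show ?thesis unfolding is_rep_def by (intro conjI ballI impI) assumption+
qed

lemma codim0: "codim_sets 0 = {S}"
  using finS by (auto simp: codim_sets_def)

lemma sp_Kos_0: "sp (Kos 0) x = {u. \<forall>p. u p \<noteq> 0 \<longrightarrow> p = Fm S \<and> le x (Fm S)}"
  by (subst sp_Kos) (simp add: codim0)

lemma sp_Kos0: "sp (Kos 0) (Fm S) = sp (simple_rep (Fm S)) (Fm S)"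
  using le_refl[OF FmP[OF order_refl]] unfolding sp_Kos_0 sp_simple by auto

lemma epsK_hom: "is_hom P le (Kos 0) (simple_rep (Fm S)) (epsK :: ('v, 'v, 'a::field_char_0) hom)"
  unfolding is_hom_def
proof (intro conjI ballI impI)
  fix x
  show "lin_on (sp (Kos 0) x) (sp (simple_rep (Fm S)) x) (epsK x :: ('v \<Rightarrow> 'a) \<Rightarrow> _)"
    using sp_Kos0 by (auto simp: lin_on_def epsK_def)
next
  fix x y and u :: "'v \<Rightarrow> 'a"
  assume xy: "x \<in> P" "y \<in> P" "le y x" and u: "u \<in> sp (Kos 0) x"
  have "u = (\<lambda>_. 0)" if "y = Fm S" "x \<noteq> y"
  proof (rule ccontr)
    assume "u \<noteq> (\<lambda>_. 0)"
    then obtain p where "u p \<noteq> 0" by auto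
    then have "le x (Fm S)" using u unfolding sp_Kos_0 by blast
    then obtain T where "T \<subseteq> S" "x = Fm T" using Fm_surj xy by auto
    then show False using xy that Fm_le by auto
  qed
  then show "epsK y (act (Kos 0) x y u) = act (simple_rep (Fm S)) x y (epsK x u)"
    unfolding K.act_F by (auto simp: epsK_def act_simple)
qed

lemma Kos_proj_res:
  "proj_res P le (simple_rep (Fm S)) Kos (dK :: nat \<Rightarrow> ('v, 'v, 'a::field_char_0) hom) epsK"
  unfolding proj_res_def
proof (intro conjI allI ballI)
  show "projective P le (Kos i :: ('v, 'v, 'a) rep)" for i by (rule K.free_projective)
  show "is_hom P le (Kos 0) (simple_rep (Fm S)) (epsK :: ('v, 'v, 'a) hom)" by (rule epsK_hom)
  show "is_hom P le (Kos (Suc i)) (Kos i) (dK i :: ('v, 'v, 'a) hom)" for i by (rule dK_hom)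
  show "surj_hom P (Kos 0) (simple_rep (Fm S)) (epsK :: ('v, 'v, 'a) hom)"
    unfolding surj_hom_def
  proof
    fix x
    show "epsK x ` sp (Kos 0) x = (sp (simple_rep (Fm S)) x :: ('v \<Rightarrow> 'a) set)"
    proof (cases "x = Fm S")
      case True
      then have "epsK x = (\<lambda>u :: 'v \<Rightarrow> 'a. u)" by (auto simp: epsK_def)
      then show ?thesis using sp_Kos0 True by simp
    next
      case False
      then have "epsK x = (\<lambda>(u :: 'v \<Rightarrow> 'a) i. 0)" by (auto simp: epsK_def)
      moreover have "(\<lambda>_. 0) \<in> (sp (Kos 0) x :: ('v \<Rightarrow> 'a) set)" by (rule sp_zero)
      note image_constant[OF this]
      ultimately show ?thesis using False by (simp add: sp_simple)
    qed
  qed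
next
  fix x assume x: "x \<in> P"
  show "{u \<in> sp (Kos 0) x. epsK x u = (\<lambda>_. 0)} = (dK 0 x ` sp (Kos 1) x :: ('v \<Rightarrow> 'a) set)"
  proof (intro equalityI subsetI)
    fix u :: "'v \<Rightarrow> 'a" assume "u \<in> {u \<in> sp (Kos 0) x. epsK x u = (\<lambda>_. 0)}"
    then have u: "u \<in> sp (Kos 0) x" "epsK x u = (\<lambda>_. 0)" by auto
    show "u \<in> dK 0 x ` sp (Kos 1) x"
    proof (cases "x = Fm S")
      case True
      then have "u = (\<lambda>_. 0)" using u by (simp add: epsK_def)
      moreover have "dK 0 x (\<lambda>_. 0) = (\<lambda>_. 0 :: 'a)" by (auto simp: dK_def cobdry_def)
      ultimately show ?thesis by (intro image_eqI[of _ _ "\<lambda>_. 0"]) simp_all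
    next
      case False
      then show ?thesis using Kos_exact[OF x u(1)] by simp
    qed
  next
    fix u :: "'v \<Rightarrow> 'a" assume "u \<in> dK 0 x ` sp (Kos 1) x"
    then obtain w where w: "w \<in> sp (Kos (Suc 0)) x" "u = dK 0 x w" by auto
    have "u = (\<lambda>_. 0)" if "x = Fm S"
    proof -
      have "w (Fm T) = 0" if "T \<subseteq> S" for T
      proof (rule ccontr)
        assume "w (Fm T) \<noteq> 0"
        from Kos_supp[OF w(1) that this] show False using Fm_le that \<open>x = Fm S\<close>
          by (auto simp: codim_sets_iff)
      qed
      moreover have "w (Fm (S - {t})) = 0" for t using calculation[of "S - {t}"] by auto
      ultimately show ?thesis using w(2) by (auto simp: dK_def cobdry_def codim0)
    qed
    then show "u \<in> {u \<in> sp (Kos 0) x. epsK x u = (\<lambda>_. 0)}"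
      using dK_sp[OF x w(1)] w(2) by (auto simp: epsK_def)
  qed
next
  fix i x assume x: "x \<in> P"
  show "{u \<in> sp (Kos (Suc i)) x. dK i x u = (\<lambda>_. 0)} = (dK (Suc i) x ` sp (Kos (Suc (Suc i))) x :: ('v \<Rightarrow> 'a) set)"
  proof (intro equalityI subsetI)
    fix u :: "'v \<Rightarrow> 'a" assume "u \<in> {u \<in> sp (Kos (Suc i)) x. dK i x u = (\<lambda>_. 0)}"
    then have u: "u \<in> sp (Kos (Suc i)) x" "dK i x u = (\<lambda>_. 0)" by auto
    show "u \<in> dK (Suc i) x ` sp (Kos (Suc (Suc i))) x"
    proof (rule Kos_exact[OF x u(1)])
      fix T assume "T \<subseteq> S" "Suc (card (S - T)) = Suc i"
      then have "T \<in> codim_sets i" by (simp add: codim_sets_iff)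
      from dK_Fm[OF this, of x u] show "cobdry {} (\<lambda>U. u (Fm U)) T = 0" using u(2) by simp
    qed simp
  qed (use dK_sp[OF x] dK_dK in auto)
qed

text \<open>A homomorphism into the regular module is a family of chains \<open>z q\<close>: the
  coefficient \<open>z q T\<close> is the coordinate along \<open>q\<close> of the image of the
  generator \<open>T\<close>. It can be nonzero only for \<open>Fm T\<close> below \<open>q\<close>,
  so \<open>z q\<close> is a chain on the simplicial complex belonging to \<open>q\<close>.\<close>

definition pair_hom :: "nat \<Rightarrow> ('v \<Rightarrow> nat set \<Rightarrow> 'a::field_char_0) \<Rightarrow> ('v, 'v, 'a) hom" where
  "pair_hom k z x u = (\<lambda>q. \<Sum>T\<in>codim_sets k. u (Fm T) * z q T)"

lemma sp_reg: "sp (regular_rep P le) x = {u. \<forall>q. u q \<noteq> 0 \<longrightarrow> q \<in> P \<and> le x q}"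
  by (auto simp: sp_def vsp_def regular_rep_def)

lemma act_reg: "act (regular_rep P le) x y u = (\<lambda>p. if p \<in> P \<and> le y p then u p else 0)"
  by (simp add: act_def regular_rep_def)

lemma regular_rep_is_rep: "is_rep P le (regular_rep P le :: ('v, 'v, 'a::field) rep)"
  unfolding is_rep_def
proof (intro conjI ballI impI allI)
  show "finite (fst (regular_rep P le) x)" for x using finP by (simp add: regular_rep_def)
  fix x y assume xy: "x \<in> P" "y \<in> P" "le y x"
  show "lin_on (sp (regular_rep P le) x) (sp (regular_rep P le) y) (act (regular_rep P le) x y :: ('v \<Rightarrow> 'a) \<Rightarrow> _)"
    by (auto simp: lin_on_def act_reg sp_reg)
next
  fix x and u :: "'v \<Rightarrow> 'a" assume "x \<in> P" "u \<in> sp (regular_rep P le) x"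
  then show "act (regular_rep P le) x x u = u" by (intro ext) (auto simp: act_reg sp_reg)
next
  fix x y z and u :: "'v \<Rightarrow> 'a" assume xyz: "x \<in> P" "y \<in> P" "z \<in> P" "le y x" "le z y"
   and u: "u \<in> sp (regular_rep P le) x"
  have "le y q" if "u q \<noteq> 0" for q using u that le_trans[OF xyz(2,1) _ xyz(4)] by (simp add: sp_reg)
  then show "act (regular_rep P le) y z (act (regular_rep P le) x y u) = act (regular_rep P le) x z u"
    by (intro ext) (auto simp: act_reg)
qed

lemma pair_hom_hom:
  assumes z: "\<And>q T. z q T \<noteq> 0 \<Longrightarrow> q \<in> P \<and> le (Fm T) q"
  shows "is_hom P le (Kos k) (regular_rep P le) (pair_hom k z :: ('v, 'v, 'a::field_char_0) hom)"
proof -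
  have mem: "pair_hom k z x u \<in> sp (regular_rep P le) x" if x: "x \<in> P" and u: "u \<in> sp (Kos k) x" for x and u :: "'v \<Rightarrow> 'a"
    unfolding sp_reg
  proof (intro CollectI allI impI)
    fix q assume "pair_hom k z x u q \<noteq> 0"
    then obtain T where T: "T \<in> codim_sets k" "u (Fm T) * z q T \<noteq> 0"
      unfolding pair_hom_def by (metis (no_types, lifting) sum.neutral)
    then have T': "T \<subseteq> S" "u (Fm T) \<noteq> 0" "z q T \<noteq> 0" by (auto simp: codim_sets_iff)
    show "q \<in> P \<and> le x q"
      using z[OF T'(3)] Kos_supp(2)[OF u T'(1,2)] le_trans[OF x FmP[OF T'(1)]] by blast
  qed
  show ?thesis unfolding is_hom_def
  proof (intro conjI ballI impI)
    fix x assume x: "x \<in> P"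
    show "lin_on (sp (Kos k) x) (sp (regular_rep P le) x) (pair_hom k z x)"
      unfolding lin_on_def using mem[OF x]
      by (auto simp: pair_hom_def distrib_right sum.distrib sum_distrib_left mult.assoc)
    fix y and u :: "'v \<Rightarrow> 'a" assume y: "y \<in> P" "le y x" and u: "u \<in> sp (Kos k) x"
    have "q \<in> P \<and> le y q" if "pair_hom k z x u q \<noteq> 0" for q
      using mem[OF x u] that le_trans[OF y(1) x _ y(2)] by (simp add: sp_reg)
    then show "pair_hom k z y (act (Kos k) x y u) = act (regular_rep P le) x y (pair_hom k z x u)"
      by (intro ext) (auto simp: act_reg pair_hom_def)
  qed
qed

definition coeffs :: "nat \<Rightarrow> ('v, 'v, 'a::field_char_0) hom \<Rightarrow> 'v \<Rightarrow> nat set \<Rightarrow> 'a" where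
  "coeffs k \<phi> q T = (if T \<in> codim_sets k then \<phi> (Fm T) (unit_vec (Fm T)) q else 0)"

lemma unit_Kos: "T \<in> codim_sets k \<Longrightarrow> unit_vec (Fm T) \<in> sp (Kos k) (Fm T)"
  by (rule K.unit_F) (auto simp: codim_sets_iff intro: FmP le_refl)

context
  fixes k :: nat and \<phi> :: "('v, 'v, 'a::field_char_0) hom"
  assumes \<phi>: "is_hom P le (Kos k) (regular_rep P le) \<phi>"
begin

lemma coeffs_supp: "coeffs k \<phi> q T \<noteq> 0 \<Longrightarrow> T \<in> codim_sets k \<and> q \<in> P \<and> le (Fm T) q"
  using is_homD(3)[OF \<phi> FmP unit_Kos, of T]
  by (auto simp: coeffs_def sp_reg codim_sets_iff split: if_splits)

lemma hom_eq_pair: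
  assumes x: "x \<in> P" and u: "u \<in> sp (Kos k) x"
  shows "\<phi> x u = pair_hom k (coeffs k \<phi>) x u"
proof
  fix q
  have "\<phi> x u q = (\<Sum>T | T \<in> codim_sets k \<and> le x (Fm T).
      u (Fm T) * act (regular_rep P le) (Fm T) x (\<phi> (Fm T) (unit_vec (Fm T))) q)"
    unfolding K.hom_from_free[OF \<phi> x u] by (simp add: free_hom_def)
  also have "\<dots> = (\<Sum>T | T \<in> codim_sets k \<and> le x (Fm T). u (Fm T) * coeffs k \<phi> q T)"
  proof (rule sum.cong[OF refl])
    fix T assume "T \<in> {T. T \<in> codim_sets k \<and> le x (Fm T)}"
    then have T: "T \<in> codim_sets k" "le x (Fm T)" by auto
    have "coeffs k \<phi> q T \<noteq> 0 \<Longrightarrow> q \<in> P \<and> le x q"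
      using coeffs_supp[of q T] le_trans[OF x FmP _ T(2)] T(1) by (auto simp: codim_sets_iff)
    then show "u (Fm T) * act (regular_rep P le) (Fm T) x (\<phi> (Fm T) (unit_vec (Fm T))) q = u (Fm T) * coeffs k \<phi> q T"
      using T by (auto simp: act_reg coeffs_def)
  qed
  also have "\<dots> = (\<Sum>T\<in>codim_sets k. u (Fm T) * coeffs k \<phi> q T)"
    using K.F_zero[OF u] K.finG by (intro sum.mono_neutral_left) auto
  finally show "\<phi> x u q = pair_hom k (coeffs k \<phi>) x u q" by (simp add: pair_hom_def)
qed

end

lemma pair_hom_dK:
  "pair_hom k z x (dK k x u) q = (\<Sum>U\<in>codim_sets (Suc k). u (Fm U) * bdry S (z q) U)"
proof -
  have "pair_hom k z x (dK k x u) q = (\<Sum>T\<in>codim_sets k. cobdry {} (\<lambda>U. u (Fm U)) T * z q T)"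
    by (simp add: pair_hom_def dK_Fm)
  also have "\<dots> = (\<Sum>U\<in>codim_sets (Suc k). u (Fm U) * bdry S (z q) U)"
    unfolding codim_sets_def by (rule cobdry_bdry_adjoint[OF finS])
  finally show ?thesis .
qed

lemma sum_unit:
  assumes "U \<in> codim_sets k"
  shows "(\<Sum>T\<in>codim_sets k. unit_vec (Fm U) (Fm T) * c T) = (c U :: 'a::field)"
proof -
  have "(\<Sum>T\<in>codim_sets k. unit_vec (Fm U) (Fm T) * c T) = (\<Sum>T\<in>{U}. unit_vec (Fm U) (Fm T) * c T)"
    using assms K.finG Fm_inj
    by (intro sum.mono_neutral_right) (auto simp: unit_vec_def codim_sets_iff)
  then show ?thesis by (simp add: unit_vec_def)
qed

text \<open>A cocycle is a family of cycles, one for each \<open>q\<close>;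
  \<open>chain_vanish\<close> with empty base fills each of them, and the fillings together form the
  primitive.\<close>

lemma Kos_cohom_vanish:
  assumes fin: "\<And>p. p \<in> P \<Longrightarrow> finite (\<C> p)"
    and nf': "\<And>p T. p \<in> P \<Longrightarrow> T \<subseteq> S \<Longrightarrow> le (Fm T) p \<longleftrightarrow> (\<forall>C\<in>\<C> p. \<not> C \<subseteq> T)"
    and cov: "\<And>p \<D>. p \<in> P \<Longrightarrow> \<D> \<subseteq> \<C> p \<Longrightarrow> S \<subseteq> \<Union>\<D> \<Longrightarrow> k < card \<D>"
  shows "\<not> hom_cohom_nz P le Kos (dK :: nat \<Rightarrow> ('v, 'v, 'a::field_char_0) hom) (regular_rep P le :: ('v, 'v, 'a) rep) k"
proof
  assume "hom_cohom_nz P le Kos (dK :: nat \<Rightarrow> ('v, 'v, 'a) hom) (regular_rep P le :: ('v, 'v, 'a) rep) k"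
  then obtain \<phi> :: "('v, 'v, 'a) hom" where \<phi>: "is_hom P le (Kos k) (regular_rep P le) \<phi>"
    "is_zero_hom P (Kos (Suc k)) (hcomp \<phi> (dK k))"
    "case k of 0 \<Rightarrow> \<not> is_zero_hom P (Kos 0) \<phi>
         | Suc j \<Rightarrow> \<not> (\<exists>\<psi> :: ('v, 'v, 'a) hom. is_hom P le (Kos j) (regular_rep P le) \<psi> \<and> hom_eq P (Kos (Suc j)) \<phi> (hcomp \<psi> (dK j)))"
    by (auto simp: hom_cohom_nz_def)
  define z where "z = coeffs k \<phi>"
  note zs = coeffs_supp[OF \<phi>(1), folded z_def]
  note \<phi>z = hom_eq_pair[OF \<phi>(1), folded z_def]
  have cyc: "bdry S (z q) U = 0" if U: "U \<subseteq> S" for q U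
  proof (cases "U \<in> codim_sets (Suc k)")
    case True
    have "unit_vec (Fm U) \<in> (sp (Kos (Suc k)) (Fm U) :: ('v \<Rightarrow> 'a) set)" by (rule unit_Kos[OF True])
    then have "0 = \<phi> (Fm U) (dK k (Fm U) (unit_vec (Fm U))) q"
      using \<phi>(2) FmP[OF U] by (simp add: is_zero_hom_def hcomp_def)
    also have "\<dots> = pair_hom k z (Fm U) (dK k (Fm U) (unit_vec (Fm U))) q"
      using \<phi>z[OF FmP[OF U] dK_sp[OF FmP[OF U] unit_Kos[OF True]]] by simp
    also have "\<dots> = bdry S (z q) U" unfolding pair_hom_dK by (rule sum_unit[OF True])
    finally show ?thesis by simp
  next
    case False
    have "z q (insert s U) = 0" if s: "s \<in> S - U" for s
    proof (rule ccontr)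
      assume "z q (insert s U) \<noteq> 0"
      then have "insert s U \<in> codim_sets k" using zs by blast
      then show False using card_Diff_remove[of "insert s U" s] s U False
        by (simp add: codim_sets_iff)
    qed
    then show ?thesis by (simp add: bdry_def)
  qed
  have "\<exists>y. (\<forall>T. y T \<noteq> 0 \<longrightarrow> {} \<subseteq> T \<and> T \<subseteq> S \<and> Suc (card (S - T)) = k \<and> (\<forall>C\<in>\<C> q. \<not> C \<subseteq> T)) \<and>
             (\<forall>U. {} \<subseteq> U \<longrightarrow> U \<subseteq> S \<longrightarrow> bdry S y U = z q U)" if q: "q \<in> P" for q
  proof (rule chain_vanish[OF fin[OF q] finS])
    show "k < card \<D>" if "\<D> \<subseteq> \<C> q" "S - {} \<subseteq> \<Union>\<D>" for \<D> using cov[OF q that(1)] that(2) by simp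
    show "{} \<subseteq> T \<and> T \<subseteq> S \<and> card (S - T) = k \<and> (\<forall>C\<in>\<C> q. \<not> C \<subseteq> T)" if "z q T \<noteq> 0" for T
      using zs[OF that] nf'[OF q, of T] by (auto simp: codim_sets_iff)
    show "bdry S (z q) U = 0" if "U \<subseteq> S" for U using cyc[OF that] .
  qed simp
  then have "\<exists>Y. \<forall>q\<in>P. (\<forall>T. Y q T \<noteq> 0 \<longrightarrow> {} \<subseteq> T \<and> T \<subseteq> S \<and> Suc (card (S - T)) = k \<and> (\<forall>C\<in>\<C> q. \<not> C \<subseteq> T)) \<and>
             (\<forall>U. {} \<subseteq> U \<longrightarrow> U \<subseteq> S \<longrightarrow> bdry S (Y q) U = z q U)"
    by (intro bchoice ballI)
  then obtain Y where Y0: "\<forall>q\<in>P. (\<forall>T. Y q T \<noteq> 0 \<longrightarrow> {} \<subseteq> T \<and> T \<subseteq> S \<and> Suc (card (S - T)) = k \<and> (\<forall>C\<in>\<C> q. \<not> C \<subseteq> T)) \<and>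
             (\<forall>U. {} \<subseteq> U \<longrightarrow> U \<subseteq> S \<longrightarrow> bdry S (Y q) U = z q U)" ..
  have Y: "\<And>q T. q \<in> P \<Longrightarrow> Y q T \<noteq> 0 \<Longrightarrow> T \<subseteq> S \<and> Suc (card (S - T)) = k \<and> (\<forall>C\<in>\<C> q. \<not> C \<subseteq> T)"
    "\<And>q U. q \<in> P \<Longrightarrow> U \<subseteq> S \<Longrightarrow> bdry S (Y q) U = z q U" using Y0 by simp_all
  define y where "y q T = (if q \<in> P then Y q T else 0)" for q T
  have zq: "z q T = 0" if "q \<notin> P" for q T using zs that by blast
  have y: "q \<in> P \<and> T \<subseteq> S \<and> Suc (card (S - T)) = k \<and> le (Fm T) q" if "y q T \<noteq> 0" for q T
    using that Y(1) nf' by (auto simp: y_def split: if_splits)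
  have bdy: "bdry S (y q) U = z q U" if "U \<subseteq> S" for q U
    using that Y(2) zq by (cases "q \<in> P") (auto simp: y_def bdry_def)
  show False
  proof (cases k)
    case 0
    \<comment> \<open>In degree 0 there are no coboundaries; a filling would have codimension -1, so
      it is zero, and the cocycle with it.\<close>
    then have "y q T = 0" for q T using y by blast
    then have "z q T = 0" if "T \<subseteq> S" for q T using bdy[OF that, of q] by (simp add: bdry_def)
    then have "is_zero_hom P (Kos 0) \<phi>" unfolding is_zero_hom_def
      using \<phi>z 0 by (auto simp: pair_hom_def codim_sets_iff)
    then show False using \<phi>(3) 0 by simp
  next
    case (Suc j)
    have "is_hom P le (Kos j) (regular_rep P le) (pair_hom j y)"
      by (rule pair_hom_hom) (use y in blast)
    moreover have "hom_eq P (Kos (Suc j)) \<phi> (hcomp (pair_hom j y) (dK j))"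
      unfolding hom_eq_def hcomp_def
    proof (intro ballI ext)
      fix x q and u :: "'v \<Rightarrow> 'a" assume "x \<in> P" "u \<in> sp (Kos (Suc j)) x"
      then have "\<phi> x u q = pair_hom k z x u q" using \<phi>z Suc by simp
      also have "\<dots> = (\<Sum>U\<in>codim_sets (Suc j). u (Fm U) * bdry S (y q) U)"
        unfolding pair_hom_def Suc by (intro sum.cong refl) (simp add: bdy codim_sets_iff)
      finally show "\<phi> x u q = pair_hom j y x (dK j x u) q" unfolding pair_hom_dK .
    qed
    ultimately show False using \<phi>(3) Suc by auto
  qed
qed

text \<open>The cycle of \<open>chain_nonvanish\<close>, placed at the single element
  \<open>p\<close>, is a cocycle. It is not a coboundary because the complex of \<open>p\<close> has
  no chains one codimension lower.\<close>

lemma Kos_cohom_nonvanish: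
  assumes p: "p \<in> P" and fin: "finite \<C>" and dis: "disjoint \<C>" "{} \<notin> \<C>" "\<Union>\<C> = S"
    and nf: "\<And>T. T \<subseteq> S \<Longrightarrow> le (Fm T) p \<longleftrightarrow> (\<forall>C\<in>\<C>. \<not> C \<subseteq> T)"
  shows "hom_cohom_nz P le Kos (dK :: nat \<Rightarrow> ('v, 'v, 'a::field_char_0) hom) (regular_rep P le :: ('v, 'v, 'a) rep) (card \<C>)"
proof -
  define a where "a = card \<C>"
  have "\<exists>z :: nat set \<Rightarrow> 'a. (\<exists>T. z T \<noteq> 0) \<and>
      (\<forall>T. z T \<noteq> 0 \<longrightarrow> {} \<subseteq> T \<and> T \<subseteq> S \<and> card (S - T) = card \<C> \<and> (\<forall>C\<in>\<C>. \<not> C \<subseteq> T)) \<and>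
      (\<forall>U. {} \<subseteq> U \<longrightarrow> U \<subseteq> S \<longrightarrow> bdry S z U = 0)"
    by (rule chain_nonvanish[OF fin finS _ dis(1,2)]) (use dis(3) in auto)
  then obtain z :: "nat set \<Rightarrow> 'a" where z0: "\<exists>T. z T \<noteq> 0" and
    z: "\<forall>T. z T \<noteq> 0 \<longrightarrow> {} \<subseteq> T \<and> T \<subseteq> S \<and> card (S - T) = card \<C> \<and> (\<forall>C\<in>\<C>. \<not> C \<subseteq> T)"
    and cyc: "\<forall>U. {} \<subseteq> U \<longrightarrow> U \<subseteq> S \<longrightarrow> bdry S z U = 0"
    by (elim exE conjE) (rule that[OF exI])
  obtain T0 where T0: "z T0 \<noteq> 0" using z0 by blast
  have T0': "T0 \<in> codim_sets a" "T0 \<subseteq> S" using z T0 by (auto simp: codim_sets_iff a_def)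
  define Z where "Z q T = (if q = p then z T else 0)" for q T
  have Zh: "is_hom P le (Kos a) (regular_rep P le) (pair_hom a Z)"
    by (rule pair_hom_hom) (use z nf p in \<open>auto simp: Z_def split: if_splits\<close>)
  have "bdry S (Z q) U = 0" if "U \<subseteq> S" for q U
    using cyc that by (cases "q = p") (auto simp: Z_def bdry_def)
  then have Zz: "is_zero_hom P (Kos (Suc a)) (hcomp (pair_hom a Z) (dK a))"
    unfolding is_zero_hom_def hcomp_def by (intro ballI ext) (simp add: pair_hom_dK codim_sets_iff)
  have val: "pair_hom a Z (Fm T0) (unit_vec (Fm T0)) p = z T0"
    unfolding pair_hom_def using sum_unit[OF T0'(1)] by (simp add: Z_def)
  have "case a of 0 \<Rightarrow> \<not> is_zero_hom P (Kos 0) (pair_hom a Z)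
         | Suc j \<Rightarrow> \<not> (\<exists>\<psi> :: ('v, 'v, 'a) hom. is_hom P le (Kos j) (regular_rep P le) \<psi> \<and>
               hom_eq P (Kos (Suc j)) (pair_hom a Z) (hcomp \<psi> (dK j)))"
  proof (cases a)
    case 0
    have "\<not> is_zero_hom P (Kos a) (pair_hom a Z)"
    proof
      assume "is_zero_hom P (Kos a) (pair_hom a Z)"
      moreover have "unit_vec (Fm T0) \<in> (sp (Kos a) (Fm T0) :: ('v \<Rightarrow> 'a) set)" by (rule unit_Kos[OF T0'(1)])
      ultimately have "pair_hom a Z (Fm T0) (unit_vec (Fm T0)) = (\<lambda>_. 0)"
        using FmP[OF T0'(2)] by (simp add: is_zero_hom_def)
      then show False using val T0 by simp
    qed
    then show ?thesis using 0 by simp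
  next
    case (Suc j)
    have False if \<psi>: "is_hom P le (Kos j) (regular_rep P le) \<psi>" 
      "hom_eq P (Kos (Suc j)) (pair_hom a Z) (hcomp \<psi> (dK j))" for \<psi> :: "('v, 'v, 'a) hom"
    proof -
      \<comment> \<open>A set containing no member of \<open>\<C>\<close> omits a point of each; the
        members are disjoint, so its codimension is at least \<open>card \<C>\<close>, which exceeds
        \<open>j\<close>.\<close>
      have nz: "coeffs j \<psi> p T = 0" for T
      proof (rule ccontr)
        assume "coeffs j \<psi> p T \<noteq> 0"
        from coeffs_supp[OF \<psi>(1) this] have T: "T \<subseteq> S" "card (S - T) = j" "le (Fm T) p"
          by (auto simp: codim_sets_iff)
        then have "\<forall>C\<in>\<C>. \<exists>c. c \<in> C - T" using nf by blast
        then obtain c where c: "\<And>C. C \<in> \<C> \<Longrightarrow> c C \<in> C - T" by metis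
        have "inj_on c \<C>"
        proof (rule inj_onI)
          fix C C' assume "C \<in> \<C>" "C' \<in> \<C>" "c C = c C'"
          then have "C \<inter> C' \<noteq> {}" using c[of C] c[of C'] by (metis DiffD1 disjoint_iff)
          then show "C = C'" using disjointD[OF dis(1) \<open>C \<in> \<C>\<close> \<open>C' \<in> \<C>\<close>] by blast
        qed
        moreover have "c ` \<C> \<subseteq> S - T" using c dis(3) by blast
        ultimately have "card \<C> \<le> card (S - T)" using finS by (metis card_inj_on_le finite_Diff)
        then show False using T Suc by (simp add: a_def)
      qed
      have T0s: "unit_vec (Fm T0) \<in> (sp (Kos (Suc j)) (Fm T0) :: ('v \<Rightarrow> 'a) set)" using unit_Kos T0'(1) Suc by simp
      have "z T0 = \<psi> (Fm T0) (dK j (Fm T0) (unit_vec (Fm T0))) p"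
        using \<psi>(2) FmP[OF T0'(2)] T0s val by (simp add: hom_eq_def hcomp_def)
      also have "\<dots> = pair_hom j (coeffs j \<psi>) (Fm T0) (dK j (Fm T0) (unit_vec (Fm T0))) p"
        using hom_eq_pair[OF \<psi>(1) FmP[OF T0'(2)] dK_sp[OF FmP[OF T0'(2)] T0s]] by simp
      also have "\<dots> = 0" using nz by (simp add: pair_hom_def)
      finally show False using T0 by simp
    qed
    then show ?thesis using Suc by auto
  qed
  then show ?thesis unfolding hom_cohom_nz_def a_def[symmetric] using Zh Zz by blast
qed

theorem grade_boolean_interval:
  assumes fin: "\<And>p. p \<in> P \<Longrightarrow> finite (\<C> p)"
    and nf: "\<And>p T. p \<in> P \<Longrightarrow> T \<subseteq> S \<Longrightarrow> le (Fm T) p \<longleftrightarrow> (\<forall>C\<in>\<C> p. \<not> C \<subseteq> T)"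
    and cov: "\<And>p \<D>. p \<in> P \<Longrightarrow> \<D> \<subseteq> \<C> p \<Longrightarrow> S \<subseteq> \<Union>\<D> \<Longrightarrow> a \<le> card \<D>"
    and p: "p \<in> P" and C0: "finite \<K>" "disjoint \<K>" "{} \<notin> \<K>" "\<Union>\<K> = S" "card \<K> = a"
    and nf0: "\<And>T. T \<subseteq> S \<Longrightarrow> le (Fm T) p \<longleftrightarrow> (\<forall>C\<in>\<K>. \<not> C \<subseteq> T)"
  shows "has_grade P le (simple_rep (Fm S) :: ('v, 'v, 'a::field_char_0) rep) (regular_rep P le :: ('v, 'v, 'a) rep) a"
  unfolding has_grade_def
proof (intro conjI allI impI)
  show "Ext_nonzero P le (simple_rep (Fm S) :: ('v, 'v, 'a) rep) (regular_rep P le :: ('v, 'v, 'a) rep) a"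
    unfolding Ext_nonzero_def
    using Kos_proj_res Kos_cohom_nonvanish[OF p C0(1-4) nf0] C0(5) by blast
next
  fix i assume i: "i < a"
  show "\<not> Ext_nonzero P le (simple_rep (Fm S) :: ('v, 'v, 'a) rep) (regular_rep P le :: ('v, 'v, 'a) rep) i"
  proof
    assume "Ext_nonzero P le (simple_rep (Fm S) :: ('v, 'v, 'a) rep) (regular_rep P le :: ('v, 'v, 'a) rep) i"
    then obtain Pr :: "nat \<Rightarrow> ('v, 'v, 'a) rep" and d eps where
      R: "proj_res P le (simple_rep (Fm S)) Pr d eps" and "hom_cohom_nz P le Pr d (regular_rep P le :: ('v, 'v, 'a) rep) i"
      unfolding Ext_nonzero_def by blast
    then have "hom_cohom_nz P le Kos dK (regular_rep P le :: ('v, 'v, 'a) rep) i"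
      by (intro hom_cohom_nz_unique[OF inf simple_rep_is_rep regular_rep_is_rep R Kos_proj_res])
    moreover have "i < card \<D>" if "p \<in> P" "\<D> \<subseteq> \<C> p" "S \<subseteq> \<Union>\<D>" for p \<D>
      using cov[OF that] i by simp
    ultimately show False using Kos_cohom_vanish[OF fin nf] by blast
  qed
qed

end

section \<open>Length and Bruhat order\<close>


definition invs :: "nat \<Rightarrow> (nat \<Rightarrow> nat) \<Rightarrow> (nat \<times> nat) set" where
  "invs n p = {(i, j). 1 \<le> i \<and> i < j \<and> j \<le> n \<and> p j < p i}"

lemma finite_invs: "finite (invs n p)"
  by (rule finite_subset[of _ "{1..n} \<times> {1..n}"]) (auto simp: invs_def)

lemma card_invs_le: "card (invs n p) \<le> n * n"
proof -
  have "card (invs n p) \<le> card ({1..n} \<times> {1..n})"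
    by (rule card_mono) (auto simp: invs_def)
  then show ?thesis by simp
qed

lemma sref_simps: "sref i i = Suc i" "sref i (Suc i) = i" "k \<noteq> i \<Longrightarrow> k \<noteq> Suc i \<Longrightarrow> sref i k = k"
  "sref i (sref i k) = k"
  by (auto simp: sref_def transpose_def)

text \<open>Takes inversions of \<open>u\<close> to inversions of
  \<open>u \<circ> transpose i j\<close> when \<open>u i < u j\<close>: in a pair with a point
  outside the interval from \<open>i\<close> to \<open>j\<close> the other point is transposed, a
  pair inside it stays. The map is its own inverse on pairs \<open>a < b\<close>.\<close>

definition invs_swap :: "nat \<Rightarrow> nat \<Rightarrow> nat \<times> nat \<Rightarrow> nat \<times> nat" where
  "invs_swap i j = (\<lambda>(a, b). if a < i then (a, transpose i j b) else if j < b then (transpose i j a, b) else (a, b))"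

lemma invs_swap_inj: "i < j \<Longrightarrow> inj_on (invs_swap i j) {(a, b). a < b}"
proof (rule inj_on_inverseI[of _ "invs_swap i j"])
  fix x :: "nat \<times> nat" assume "i < j" "x \<in> {(a, b). a < b}"
  then show "invs_swap i j (invs_swap i j x) = x"
    by (auto simp: invs_swap_def transpose_def split: prod.splits)
qed

lemma invs_swap_into:
  assumes ij: "1 \<le> i" "i < j" "j \<le> n" and u: "u i < u j"
  shows "invs_swap i j ` invs n u \<subseteq> invs n (u \<circ> transpose i j) - {(i, j)}"
  using assms by (auto simp: invs_def invs_swap_def transpose_def split: if_splits)

lemma invs_less:
  assumes ij: "1 \<le> i" "i < j" "j \<le> n" and u: "u i < u j"
  shows "card (invs n u) < card (invs n (u \<circ> transpose i j))"
proof -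
  have inj: "inj_on (invs_swap i j) (invs n u)"
    by (rule inj_on_subset[OF invs_swap_inj[OF ij(2)]]) (auto simp: invs_def)
  have m: "(i, j) \<in> invs n (u \<circ> transpose i j)" using assms by (auto simp: invs_def)
  have "card (invs n u) \<le> card (invs n (u \<circ> transpose i j) - {(i, j)})"
    by (rule card_inj_on_le[OF inj invs_swap_into[of i j n u, OF assms]]) (simp add: finite_invs)
  also have "\<dots> < card (invs n (u \<circ> transpose i j))"
    by (rule card_Diff1_less[OF finite_invs m])
  finally show ?thesis .
qed

text \<open>For adjacent positions \<open>invs_swap\<close> also maps back, apart from the new
  inversion \<open>(i, Suc i)\<close>.\<close>

lemma invs_sref:
  assumes i: "1 \<le> i" "i < n" and u: "u i < u (Suc i)"
  shows "card (invs n (u \<circ> sref i)) = Suc (card (invs n u))"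
proof -
  let ?w = "u \<circ> transpose i (Suc i)"
  have lt: "card (invs n u) < card (invs n ?w)" using invs_less[of i "Suc i" n u] assms by auto
  have inj: "inj_on (invs_swap i (Suc i)) (invs n ?w - {(i, Suc i)})"
    by (rule inj_on_subset[OF invs_swap_inj]) (auto simp: invs_def)
  have "invs_swap i (Suc i) ` (invs n ?w - {(i, Suc i)}) \<subseteq> invs n u"
    using assms by (auto simp: invs_def invs_swap_def transpose_def split: if_splits)
  then have "card (invs n ?w - {(i, Suc i)}) \<le> card (invs n u)"
    using card_inj_on_le[OF inj _ finite_invs] by blast
  then have "card (invs n ?w) \<le> Suc (card (invs n u))"
    by (simp add: card_Diff_singleton_if split: if_splits)
  then show ?thesis using lt by (simp add: sref_def)
qed

lemma wprod_append: "wprod (xs @ ys) = wprod xs \<circ> wprod ys"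
  by (induction xs) (auto simp: comp_assoc)

lemma id_Sn: "id \<in> Sn n" by (simp add: Sn_def permutes_id)

lemma Sn_comp: "p \<in> Sn n \<Longrightarrow> q \<in> Sn n \<Longrightarrow> p \<circ> q \<in> Sn n"
  by (simp add: Sn_def permutes_compose)

lemma transpose_Sn: "1 \<le> i \<Longrightarrow> i \<le> n \<Longrightarrow> 1 \<le> j \<Longrightarrow> j \<le> n \<Longrightarrow> transpose i j \<in> Sn n"
  by (simp add: Sn_def permutes_swap_id)

lemma sref_Sn: "1 \<le> i \<Longrightarrow> i < n \<Longrightarrow> sref i \<in> Sn n"
  unfolding sref_def by (rule transpose_Sn) auto

lemma Sn_outside: "p \<in> Sn n \<Longrightarrow> k = 0 \<or> k > n \<Longrightarrow> p k = k"
  unfolding Sn_def by (auto simp: permutes_not_in)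

lemma Sn_range: "p \<in> Sn n \<Longrightarrow> 1 \<le> k \<Longrightarrow> k \<le> n \<Longrightarrow> 1 \<le> p k \<and> p k \<le> n"
  unfolding Sn_def using permutes_in_image[of p "{1..n}" k] by auto

lemma Sn_inj: "p \<in> Sn n \<Longrightarrow> p a = p b \<longleftrightarrow> a = b"
  unfolding Sn_def using permutes_inj[of p] by (auto dest: injD)

lemma finite_Sn: "finite (Sn n)"
  unfolding Sn_def by (rule finite_permutations) simp

lemma wprod_Sn: "valid_word n w \<Longrightarrow> wprod w \<in> Sn n"
  by (induction w) (auto simp: valid_word_def id_Sn intro!: Sn_comp sref_Sn)

lemma comp_sref_sref: "(p \<circ> sref i) \<circ> sref i = p"
  by (auto simp: sref_simps)

lemma invs_wprod_le: "valid_word n w \<Longrightarrow> card (invs n (wprod w)) \<le> length w"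
proof (induction w rule: rev_induct)
  case Nil
  have "invs n (wprod []) = {}" by (auto simp: invs_def)
  then show ?case by (simp only: card.empty)
next
  case (snoc i xs)
  then have i: "1 \<le> i" "i < n" and xs: "valid_word n xs" by (auto simp: valid_word_def)
  let ?u = "wprod xs"
  have e: "wprod (xs @ [i]) = ?u \<circ> sref i" by (simp add: wprod_append)
  have l: "length (xs @ [i]) = Suc (length xs)" by simp
  consider "?u i < ?u (Suc i)" | "?u (Suc i) < ?u i"
    using Sn_inj[OF wprod_Sn[OF xs], of i "Suc i"] by linarith
  then show ?case
  proof cases
    case 1
    then show ?thesis using snoc.IH[OF xs] invs_sref[OF i 1] unfolding e l by linarith
  next
    case 2
    then have "card (invs n ((?u \<circ> sref i) \<circ> sref i)) = Suc (card (invs n (?u \<circ> sref i)))"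
      by (intro invs_sref[OF i]) (simp add: sref_simps)
    then show ?thesis using snoc.IH[OF xs] unfolding e l comp_sref_sref by linarith
  qed
qed

lemma Sn_no_descent:
  assumes p: "p \<in> Sn n" and asc: "\<And>i. 1 \<le> i \<Longrightarrow> i < n \<Longrightarrow> p i < p (Suc i)"
  shows "p = id"
proof -
  have ge: "k \<le> p k" if "k \<le> n" for k
    using that
  proof (induction k)
    case (Suc k)
    show ?case
    proof (cases "k = 0")
      case True
      then show ?thesis using Sn_range[OF p, of 1] Suc.prems by simp
    next
      case False
      then show ?thesis using Suc asc[of k] by simp
    qed
  qed simp
  have "p (n - m) \<le> n - m" for m
  proof (induction m)
    case 0
    then show ?case using Sn_range[OF p, of n] Sn_outside[OF p, of n] by (cases "n = 0") auto
  next
    case (Suc m)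
    show ?case
    proof (cases "Suc m < n")
      case True
      then have "p (n - Suc m) < p (Suc (n - Suc m))" by (intro asc) auto
      then show ?thesis using Suc True by (simp add: Suc_diff_Suc)
    next
      case False
      then show ?thesis using Sn_outside[OF p, of 0] by simp
    qed
  qed
  then have le: "p k \<le> k" if "k \<le> n" for k
    using that by (metis diff_diff_cancel)
  show ?thesis
  proof
    fix k show "p k = id k"
      using ge[of k] le[of k] Sn_outside[OF p, of k] by (cases "k \<le> n") auto
  qed
qed

lemma ex_reduced_word:
  assumes "p \<in> Sn n"
  shows "\<exists>w. valid_word n w \<and> wprod w = p \<and> length w = card (invs n p)"
  using assms
proof (induction "card (invs n p)" arbitrary: p rule: less_induct)
  case less
  show ?case
  proof (cases "p = id")
    case True
    have "invs n id = {}" by (auto simp: invs_def)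
    then show ?thesis using True by (intro exI[of _ "[]"]) (simp add: valid_word_def)
  next
    case False
    then obtain i where i: "1 \<le> i" "i < n" "\<not> p i < p (Suc i)"
      using Sn_no_descent[OF less.prems] by blast
    then have d: "p (Suc i) < p i" using Sn_inj[OF less.prems, of i "Suc i"] by linarith
    let ?q = "p \<circ> sref i"
    have q: "?q \<in> Sn n" by (rule Sn_comp[OF less.prems sref_Sn[OF i(1,2)]])
    have c: "card (invs n (?q \<circ> sref i)) = Suc (card (invs n ?q))"
      using d by (intro invs_sref[OF i(1,2)]) (simp add: sref_simps)
    then obtain w where w: "valid_word n w" "wprod w = ?q" "length w = card (invs n ?q)"
      using less.hyps[OF _ q] unfolding comp_sref_sref by auto
    have "wprod (w @ [i]) = p" using w(2) comp_sref_sref[of p i] by (simp add: wprod_append)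
    then show ?thesis using w i c unfolding comp_sref_sref
      by (intro exI[of _ "w @ [i]"]) (auto simp: valid_word_def)
  qed
qed

lemma clen_le: "valid_word n w \<Longrightarrow> clen n (wprod w) \<le> length w"
  unfolding clen_def by (rule Least_le) blast

lemma ex_clen_word:
  assumes "p \<in> Sn n"
  shows "\<exists>w. length w = clen n p \<and> valid_word n w \<and> wprod w = p"
  unfolding clen_def by (rule LeastI_ex) (use ex_reduced_word[OF assms] in blast)

lemma clen_eq_invs: "p \<in> Sn n \<Longrightarrow> clen n p = card (invs n p)"
  using ex_clen_word[of p n] ex_reduced_word[of p n] clen_le[of n] invs_wprod_le[of n]
  by (metis order_antisym)

section \<open>Rank functions and the Bruhat order\<close>

definition rk :: "(nat \<Rightarrow> nat) \<Rightarrow> nat \<Rightarrow> nat \<Rightarrow> nat" where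
  "rk u i j = card {k. k \<le> i \<and> j < u k}"

lemma rk_swap:
  assumes ij: "i < j" and u: "u i < u j"
  shows "rk (u \<circ> transpose i j) a b = rk u a b + (if i \<le> a \<and> a < j \<and> u i \<le> b \<and> b < u j then 1 else 0)"
proof -
  let ?w = "u \<circ> transpose i j"
  consider "a < i" | "j \<le> a" | "i \<le> a" "a < j" by linarith
  then show ?thesis
  proof cases
    case 1
    then have "{k. k \<le> a \<and> b < ?w k} = {k. k \<le> a \<and> b < u k}" using ij by (auto simp: transpose_def)
    then show ?thesis using 1 by (simp add: rk_def)
  next
    case 2
    have "{k. k \<le> a \<and> b < ?w k} = transpose i j ` {k. k \<le> a \<and> b < u k}"
    proof (intro equalityI subsetI)
      fix k assume "k \<in> {k. k \<le> a \<and> b < ?w k}"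
      then show "k \<in> transpose i j ` {k. k \<le> a \<and> b < u k}" using 2 ij
        by (intro image_eqI[of _ _ "transpose i j k"]) (auto simp: transpose_def split: if_splits)
    qed (use 2 ij in \<open>auto simp: transpose_def\<close>)
    then have "rk ?w a b = rk u a b" unfolding rk_def by (simp add: card_image)
    then show ?thesis using 2 by simp
  next
    case 3
    let ?A = "{k. k \<le> a \<and> k \<noteq> i \<and> b < u k}"
    have e: "{k. k \<le> a \<and> b < u k} = (if b < u i then insert i ?A else ?A)"
      "{k. k \<le> a \<and> b < ?w k} = (if b < u j then insert i ?A else ?A)"
      using 3 by (auto simp: transpose_def)
    have "finite ?A" "i \<notin> ?A" by auto
    then show ?thesis using 3 u unfolding rk_def e by auto
  qed
qed

lemma rk_split: "b \<le> c \<Longrightarrow> rk u a b = rk u a c + card {k. k \<le> a \<and> b < u k \<and> u k \<le> c}"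
proof -
  assume "b \<le> c"
  then have "{k. k \<le> a \<and> b < u k} = {k. k \<le> a \<and> c < u k} \<union> {k. k \<le> a \<and> b < u k \<and> u k \<le> c}" by auto
  then show ?thesis unfolding rk_def by (simp add: card_Un_disjoint disjoint_iff)
qed

lemma bruhat_step_iff:
  assumes u: "u \<in> Sn n"
  shows "bruhat_step n u w \<longleftrightarrow> (\<exists>i j. 1 \<le> i \<and> i < j \<and> j \<le> n \<and> w = u \<circ> transpose i j \<and> u i < u j)"
proof -
  have "clen n u < clen n (u \<circ> transpose i j) \<longleftrightarrow> u i < u j" if ij: "1 \<le> i" "i < j" "j \<le> n" for i j
  proof -
    let ?w = "u \<circ> transpose i j"
    have w: "?w \<in> Sn n" using ij by (intro Sn_comp[OF u] transpose_Sn) auto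
    have "?w i < ?w j \<Longrightarrow> card (invs n ?w) < card (invs n (?w \<circ> transpose i j))"
      by (rule invs_less[OF ij])
    moreover have "?w \<circ> transpose i j = u" by (auto simp: comp_def)
    moreover have "u i < u j \<or> ?w i < ?w j" using Sn_inj[OF u, of i j] ij by auto
    ultimately show ?thesis using invs_less[OF ij] clen_eq_invs[OF u] clen_eq_invs[OF w]
      by (metis not_less_iff_gr_or_eq)
  qed
  then show ?thesis unfolding bruhat_step_def using u by blast
qed

lemma bruhat_Sn: "bruhat n u w \<Longrightarrow> u \<in> Sn n \<Longrightarrow> w \<in> Sn n"
  unfolding bruhat_def
proof (induction rule: rtranclp_induct)
  case (step y z)
  then have "y \<in> Sn n" by simp
  with step.hyps(2) show ?case by (auto simp: bruhat_step_def intro!: Sn_comp transpose_Sn)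
qed simp

lemma bruhat_rk: "bruhat n u w \<Longrightarrow> u \<in> Sn n \<Longrightarrow> rk u a b \<le> rk w a b"
  unfolding bruhat_def
proof (induction rule: rtranclp_induct)
  case (step y z)
  then have "y \<in> Sn n" using bruhat_Sn[of n u y] by (simp add: bruhat_def)
  with step.hyps(2) obtain i j where "i < j" "y i < y j" "z = y \<circ> transpose i j"
    using bruhat_step_iff by blast
  then have "rk y a b \<le> rk z a b" using rk_swap[of i j y] by simp
  then show ?case using step by simp
qed simp

lemma first_difference:
  assumes "u \<in> Sn n" "w \<in> Sn n" "u \<noteq> w"
  obtains i where "1 \<le> i" "i \<le> n" "u i \<noteq> w i" "\<And>k. k < i \<Longrightarrow> u k = w k"
proof -
  define i where "i = (LEAST i. u i \<noteq> w i)"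
  have ex: "\<exists>i. u i \<noteq> w i" using assms(3) by auto
  have i: "u i \<noteq> w i" unfolding i_def by (rule LeastI_ex[OF ex])
  moreover have "u k = w k" if "k < i" for k using not_less_Least that unfolding i_def by blast
  moreover have "1 \<le> i \<and> i \<le> n"
    using i Sn_outside[OF assms(1), of i] Sn_outside[OF assms(2), of i] by (metis le_less_linear less_one)
  ultimately show ?thesis using that by blast
qed

lemma rk_first_difference:
  assumes "\<And>k. k < i \<Longrightarrow> u k = w k" and "\<And>a b. rk u a b \<le> rk w a b"
  shows "u i \<le> w i"
proof (rule ccontr)
  assume "\<not> u i \<le> w i"
  then have "{k. k \<le> i \<and> w i < u k} = insert i {k. k \<le> i \<and> w i < w k}"
    using assms(1) by (auto simp: le_less)
  then have "rk u i (w i) = Suc (rk w i (w i))" by (simp add: rk_def)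
  then show False using assms(2)[of i "w i"] by simp
qed

text \<open>At the first position \<open>i\<close> where they differ, \<open>u\<close> has the
  smaller value. Let \<open>j\<close> be the first later position with a value above
  \<open>u i\<close> and at most \<open>w i\<close>; exchanging the two positions raises the rank by
  one on a rectangle, and the choice of \<open>j\<close> leaves room there below the rank of
  \<open>w\<close>.\<close>

lemma rk_le_step:
  assumes u: "u \<in> Sn n" and w: "w \<in> Sn n" and ne: "u \<noteq> w" and le: "\<And>a b. rk u a b \<le> rk w a b"
  obtains i j where "1 \<le> i" "i < j" "j \<le> n" "u i < u j" "\<And>a b. rk (u \<circ> transpose i j) a b \<le> rk w a b"
proof -
  obtain i where i: "1 \<le> i" "i \<le> n" "u i \<noteq> w i" "\<And>k. k < i \<Longrightarrow> u k = w k"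
    using first_difference[OF u w ne] by metis
  have "u i \<le> w i" by (rule rk_first_difference[OF i(4) le])
  then have lt: "u i < w i" using i(3) by simp
  let ?c = "w i"
  have wi: "1 \<le> ?c" "?c \<le> n" using Sn_range[OF w i(1,2)] by auto
  then have "?c \<in> u ` {1..n}" using u permutes_image[of u "{1..n}"] by (simp add: Sn_def)
  then obtain j0 where j0: "1 \<le> j0" "j0 \<le> n" "u j0 = ?c" by auto
  have "i < j0"
  proof (rule ccontr)
    assume "\<not> i < j0"
    then consider "j0 < i" | "j0 = i" by linarith
    then show False
    proof cases
      case 1
      then have "w j0 = w i" using i(4) j0(3) by simp
      then show False using Sn_inj[OF w] 1 by auto
    qed (use j0 i in simp)
  qed
  define j where "j = (LEAST j. i < j \<and> u i < u j \<and> u j \<le> ?c)"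
  have j: "i < j \<and> u i < u j \<and> u j \<le> ?c" unfolding j_def
    by (rule LeastI[of _ j0]) (use \<open>i < j0\<close> j0 lt in simp)
  have jle: "j \<le> j0" unfolding j_def by (rule Least_le) (use \<open>i < j0\<close> j0 lt in simp)
  have min: "\<not> (u i < u k \<and> u k \<le> ?c)" if "i < k" "k < j" for k
    using not_less_Least[of k "\<lambda>j. i < j \<and> u i < u j \<and> u j \<le> ?c"] that unfolding j_def by blast
  have "rk (u \<circ> transpose i j) a b \<le> rk w a b" for a b
  proof (cases "i \<le> a \<and> a < j \<and> u i \<le> b \<and> b < u j")
    case True
    then have bc: "b \<le> ?c" using j by simp
    \<comment> \<open>On the rectangle, the values above \<open>b\<close> and up to
      \<open>w i\<close> occur in \<open>u\<close>, among the positions up to \<open>a\<close>, only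
      before \<open>i\<close>, where \<open>u\<close> and \<open>w\<close> agree; \<open>w\<close>
      has in addition \<open>w i\<close> itself.\<close>
    have "{k. k \<le> a \<and> b < u k \<and> u k \<le> ?c} = {k. k < i \<and> b < w k \<and> w k \<le> ?c}" (is "?X = ?Y")
    proof (intro equalityI subsetI)
      fix k assume k: "k \<in> ?X"
      then have "u i < u k" "u k \<le> ?c" using True by auto
      then have "k < i" using min[of k] True k by (metis (mono_tags, lifting) le_less_trans linorder_neqE_nat mem_Collect_eq order_less_irrefl)
      then show "k \<in> ?Y" using k i(4) by auto
    qed (use i(4) True in auto)
    moreover have "Suc (card ?Y) \<le> card {k. k \<le> a \<and> b < w k \<and> w k \<le> ?c}"
    proof -
      have "insert i ?Y \<subseteq> {k. k \<le> a \<and> b < w k \<and> w k \<le> ?c}" using True j by auto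
      then have "card (insert i ?Y) \<le> card {k. k \<le> a \<and> b < w k \<and> w k \<le> ?c}"
        by (intro card_mono) auto
      then show ?thesis by simp
    qed
    ultimately have "Suc (rk u a b) \<le> rk w a b"
      using rk_split[OF bc, of u a] rk_split[OF bc, of w a] le[of a ?c] by simp
    then show ?thesis using rk_swap[of i j u a b] j True by simp
  next
    case False
    have "rk (u \<circ> transpose i j) a b = rk u a b"
      using rk_swap[of i j u a b] j unfolding if_not_P[OF False] by linarith
    then show ?thesis using le[of a b] by linarith
  qed
  moreover have "j \<le> n" using jle j0 by simp
  ultimately show ?thesis using that i(1) j by blast
qed

lemma rk_bruhat:
  assumes "u \<in> Sn n" "w \<in> Sn n" "\<And>a b. rk u a b \<le> rk w a b"
  shows "bruhat n u w"
  using assms(1,3)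
proof (induction "n * n - card (invs n u)" arbitrary: u rule: less_induct)
  case less
  show ?case
  proof (cases "u = w")
    case True
    then show ?thesis by (simp add: bruhat_def)
  next
    case False
    obtain i j where ij: "1 \<le> i" "i < j" "j \<le> n" "u i < u j" "\<And>a b. rk (u \<circ> transpose i j) a b \<le> rk w a b"
      using rk_le_step[OF less.prems(1) assms(2) False less.prems(2)] by metis
    let ?u = "u \<circ> transpose i j"
    have u': "?u \<in> Sn n" using ij by (intro Sn_comp[OF less.prems(1)] transpose_Sn) auto
    have "card (invs n u) < card (invs n ?u)" by (rule invs_less[OF ij(1-4)])
    then have "n * n - card (invs n ?u) < n * n - card (invs n u)"
      using card_invs_le[of n ?u] by simp
    then have "bruhat n ?u w" using less.hyps[OF _ u' ij(5)] by simp
    moreover have "bruhat_step n u ?u" using bruhat_step_iff[OF less.prems(1)] ij by blast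
    ultimately show ?thesis unfolding bruhat_def by (simp add: converse_rtranclp_into_rtranclp)
  qed
qed

theorem bruhat_iff_rk:
  assumes "u \<in> Sn n" "w \<in> Sn n"
  shows "bruhat n u w \<longleftrightarrow> (\<forall>a b. rk u a b \<le> rk w a b)"
  using bruhat_rk[OF _ assms(1)] rk_bruhat[OF assms] by blast

lemma bruhat_trans: "bruhat n u v \<Longrightarrow> bruhat n v w \<Longrightarrow> bruhat n u w"
  unfolding bruhat_def by (rule rtranclp_trans)

lemma bruhat_refl: "bruhat n u u"
  by (simp add: bruhat_def)

lemma rk_sref_other: "j \<noteq> a \<Longrightarrow> rk (sref a \<circ> u) i j = rk u i j"
proof -
  assume "j \<noteq> a"
  then have "{k. k \<le> i \<and> j < sref a (u k)} = {k. k \<le> i \<and> j < u k}"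
    by (auto simp: sref_def transpose_def split: if_splits)
  then show ?thesis by (simp add: rk_def)
qed

text \<open>After the exchange of the values \<open>a\<close> and \<open>Suc a\<close>, the values
  above \<open>a\<close> come from those above \<open>Suc a\<close> and from \<open>a\<close>
  itself.\<close>

lemma rk_sref:
  assumes "1 \<le> a"
  shows "rk (sref a \<circ> u) i a + rk u i a = rk u i (Suc a) + rk u i (a - 1)"
proof -
  have "{k. k \<le> i \<and> a < sref a (u k)} = {k. k \<le> i \<and> Suc a < u k} \<union> {k. k \<le> i \<and> a - 1 < u k \<and> u k \<le> a}"
    using assms by (auto simp: sref_def transpose_def split: if_splits)
  then have "rk (sref a \<circ> u) i a = rk u i (Suc a) + card {k. k \<le> i \<and> a - 1 < u k \<and> u k \<le> a}"
    unfolding rk_def by (simp add: card_Un_disjoint disjoint_iff)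
  then show ?thesis using rk_split[of "a - 1" a u i] by simp
qed

lemma subseq_mem: "subseq xs ys \<Longrightarrow> x \<in> set xs \<Longrightarrow> x \<in> set ys"
  by (erule list_emb_set) auto

text \<open>\<open>i - j\<close> is the rank of the identity. A word without repeated letters
  exceeds it by at most one, exactly when the letters between \<open>i\<close> and \<open>j\<close>
  occur in one particular monotone order. Prepending \<open>a\<close> changes only the column
  \<open>j = a\<close>, by the recursion \<open>rk_sref\<close>, and since \<open>a\<close> is not
  in \<open>w\<close>, runs through \<open>a\<close> do not contribute to the old ranks.\<close>

lemma rk_wprod:
  assumes "distinct w" "0 \<notin> set w"
  shows "rk (wprod w) i j = (if i \<le> j then of_bool (subseq (rev [i..<Suc j]) w)
     else (i - j) + of_bool (subseq [j..<Suc i] w))"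
  using assms
proof (induction w arbitrary: i j)
  case Nil
  have "{k. k \<le> i \<and> j < k} = {j<..i}" by auto
  then show ?case by (auto simp: rk_def)
next
  case (Cons a w)
  have a: "1 \<le> a" "a \<notin> set w" using Cons.prems by (auto simp: Suc_le_eq intro: gr0I)
  have IH: "rk (wprod w) i j = (if i \<le> j then of_bool (subseq (rev [i..<Suc j]) w)
     else (i - j) + of_bool (subseq [j..<Suc i] w))" for i j
    using Cons by simp
  have no: "\<not> subseq xs w" if "a \<in> set xs" for xs using subseq_mem[of xs w a] a that by blast
  have rv: "rev [i..<Suc j] = j # rev [i..<j]" if "i \<le> j" for i j using that by simp
  have l: "[j..<Suc i] = j # [Suc j..<Suc i]" if "j \<le> i" for i j using that by (simp add: upt_conv_Cons)
  define r where "r = rk (wprod (a # w)) i j"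
  have "r = (if i \<le> j then of_bool (subseq (rev [i..<Suc j]) (a # w))
     else (i - j) + of_bool (subseq [j..<Suc i] (a # w)))"
  proof (cases "j = a")
    case False
    have "r = rk (wprod w) i j" using rk_sref_other[OF False] by (simp add: r_def)
    moreover have "subseq (rev [i..<Suc j]) (a # w) \<longleftrightarrow> subseq (rev [i..<Suc j]) w" if "i \<le> j"
      using that False rv by (simp add: subseq_Cons2_iff del: upt_Suc)
    moreover have "subseq [j..<Suc i] (a # w) \<longleftrightarrow> subseq [j..<Suc i] w" if "\<not> i \<le> j"
      using that False l[of j i] by (simp add: subseq_Cons2_iff del: upt_Suc)
    ultimately show ?thesis unfolding IH by (cases "i \<le> j") (simp_all only: if_True if_False simp_thms)
  next
    case True
    have eq: "r + rk (wprod w) i a = rk (wprod w) i (Suc a) + rk (wprod w) i (a - 1)"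
      using rk_sref[OF a(1), of "wprod w" i] by (simp add: r_def True)
    \<comment> \<open>The surviving old term comes from the run that stops next to \<open>a\<close>:
      at \<open>a - 1\<close> if \<open>i < a\<close>, at \<open>Suc a\<close> if
      \<open>a < i\<close>.\<close>
    consider "i < a" | "i = a" | "i = Suc a" | "Suc a < i" by linarith
    then show ?thesis
    proof cases
      case 1
      have e: "Suc (a - 1) = a" using a by simp
      have "\<not> subseq (rev [i..<Suc a]) w" "\<not> subseq (rev [i..<Suc (Suc a)]) w"
        using 1 by (auto intro!: no)
      then have "rk (wprod w) i a = 0" "rk (wprod w) i (Suc a) = 0" using IH 1 by (simp_all del: upt_Suc)
      moreover have "rk (wprod w) i (a - 1) = of_bool (subseq (rev [i..<a]) w)" using IH[of i "a - 1"] 1 e by (simp del: upt_Suc)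
      ultimately show ?thesis using eq True 1 rv[of i a] by (simp del: upt_Suc)
    next
      case 2
      have "\<not> subseq [a] w" "\<not> subseq (rev [a..<Suc (Suc a)]) w" "\<not> subseq [a - 1..<Suc a] w"
        using a by (auto intro!: no)
      then have "rk (wprod w) a a = 0" "rk (wprod w) a (Suc a) = 0" "rk (wprod w) a (a - 1) = 1"
        using IH[of a a] IH[of a "Suc a"] IH[of a "a - 1"] a by (simp_all del: upt_Suc add: upt_rec[of a "Suc a"])
      then show ?thesis using eq True 2 rv[of a a] by (simp del: upt_Suc)
    next
      case 3
      have "\<not> subseq [a..<Suc i] w" "\<not> subseq [a - 1..<Suc i] w"
        using a 3 by (auto intro!: no)
      then have "rk (wprod w) i a = 1" "rk (wprod w) i (a - 1) = 2" "rk (wprod w) i (Suc a) = of_bool (subseq [i] w)"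
      proof -
        have "\<not> i \<le> a" "\<not> i \<le> a - 1" "i \<le> Suc a" "i - a = 1" "i - (a - 1) = 2" using a 3 by auto
        moreover have "rev [i..<Suc i] = [i]" by simp
        ultimately show "rk (wprod w) i a = 1" "rk (wprod w) i (a - 1) = 2" "rk (wprod w) i (Suc a) = of_bool (subseq [i] w)"
          using IH[of i a] IH[of i "a - 1"] IH[of i "Suc a"] \<open>\<not> subseq [a..<Suc i] w\<close> \<open>\<not> subseq [a - 1..<Suc i] w\<close> 3
          by (simp_all only: if_True if_False of_bool_eq add_0_right)
      qed
      moreover have "[Suc a..<Suc i] = [i]" using 3 by simp
      ultimately show ?thesis using eq True 3 l[of a i] by (simp del: upt_Suc)
    next
      case 4
      have "\<not> subseq [a..<Suc i] w" "\<not> subseq [a - 1..<Suc i] w"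
        using a 4 by (auto intro!: no)
      then have "rk (wprod w) i a = i - a" "rk (wprod w) i (a - 1) = i - (a - 1)" 
         "rk (wprod w) i (Suc a) = (i - Suc a) + of_bool (subseq [Suc a..<Suc i] w)"
        using IH[of i a] IH[of i "a - 1"] IH[of i "Suc a"] a 4 by (simp_all del: upt_Suc)
      then show ?thesis using eq True 4 l[of a i] a by (simp del: upt_Suc)
    qed
  qed
then show ?case unfolding r_def .
qed

section \<open>Boolean permutations\<close>


lemma subseq_filter_iff: "subseq xs (filter (\<lambda>x. x \<in> T) w) \<longleftrightarrow> set xs \<subseteq> T \<and> subseq xs w"
proof (induction w arbitrary: xs)
  case (Cons a w)
  show ?case
  proof (cases xs)
    case (Cons x ys)
    then show ?thesis using Cons.IH[of xs] Cons.IH[of ys] by (auto simp: subseq_Cons2_iff dest: subseq_mem)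
  qed simp
next
  case Nil
  show ?case by (cases xs) auto
qed

abbreviation subword :: "nat list \<Rightarrow> nat set \<Rightarrow> nat \<Rightarrow> nat" where
  "subword w T \<equiv> wprod (filter (\<lambda>x. x \<in> T) w)"

lemma rk_lower:
  assumes "p \<in> Sn n"
  shows "i - j \<le> rk p i j"
proof -
  have inj: "inj_on p {k. k \<le> i \<and> p k \<le> j}" using Sn_inj[OF assms] by (auto intro: inj_onI)
  have "card {k. k \<le> i \<and> p k \<le> j} \<le> card {..j}"
    by (rule card_inj_on_le[OF inj]) auto
  moreover have "card {..i} = rk p i j + card {k. k \<le> i \<and> p k \<le> j}"
  proof -
    have "{..i} = {k. k \<le> i \<and> j < p k} \<union> {k. k \<le> i \<and> p k \<le> j}" by auto
    then show ?thesis unfolding rk_def by (simp only: card_Un_disjoint) (subst card_Un_disjoint, auto)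
  qed
  ultimately show ?thesis by simp
qed

lemma bruhat_id_le: "p \<in> Sn n \<Longrightarrow> bruhat n id p"
proof (rule rk_bruhat[OF id_Sn])
  fix a b :: nat assume p: "p \<in> Sn n"
  have "{k. k \<le> a \<and> b < k} = {b<..a}" by auto
  then have "rk id a b = a - b" by (simp add: rk_def)
  then show "rk id a b \<le> rk p a b" using rk_lower[OF p] by simp
qed

lemma valid_word_zero: "valid_word n w \<Longrightarrow> 0 \<notin> set w"
  by (auto simp: valid_word_def)

lemma valid_word_filter: "valid_word n w \<Longrightarrow> valid_word n (filter P w)"
  by (auto simp: valid_word_def)

lemma rk_subword:
  assumes "distinct w" "valid_word n w"
  shows "rk (subword w T) i j = (if i \<le> j then of_bool ({i..j} \<subseteq> T \<and> subseq (rev [i..<Suc j]) w)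
     else (i - j) + of_bool ({j..i} \<subseteq> T \<and> subseq [j..<Suc i] w))"
proof -
  have "set (rev [i..<Suc j]) = {i..j}" "set [j..<Suc i] = {j..i}" by auto
  moreover have d: "distinct (filter (\<lambda>x. x \<in> T) w)" "0 \<notin> set (filter (\<lambda>x. x \<in> T) w)"
    using assms valid_word_zero[OF assms(2)] by auto
  ultimately show ?thesis using rk_wprod[OF d, of i j]
    unfolding subseq_filter_iff by (simp only:)
qed

text \<open>
  By \<open>rk_wprod\<close>, lying above the cycle of a run of letters \<open>{i..j}\<close> is a single rank condition, at
  \<open>(i, j)\<close> or at \<open>(j, i)\<close> depending on the direction of the run.
\<close>

definition missing_runs :: "nat list \<Rightarrow> (nat \<Rightarrow> nat) \<Rightarrow> nat set set" where
  "missing_runs w p = {{i..j} | i j. i \<le> j \<and> subseq (rev [i..<Suc j]) w \<and> rk p i j = 0} \<union>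
     {{j..i} | i j. j \<le> i \<and> subseq [j..<Suc i] w \<and> rk p i j = i - j}"

lemma missing_runs_cases:
  assumes "C \<in> missing_runs w p"
  obtains i j where "i \<le> j" "C = {i..j}" "subseq (rev [i..<Suc j]) w" "rk p i j = 0"
   | i j where "i \<le> j" "C = {i..j}" "subseq [i..<Suc j] w" "rk p j i = j - i"
  using assms unfolding missing_runs_def by blast

lemma missing_runs_ascI:
  "i \<le> j \<Longrightarrow> subseq (rev [i..<Suc j]) w \<Longrightarrow> rk p i j = 0 \<Longrightarrow> {i..j} \<in> missing_runs w p"
  unfolding missing_runs_def 
  by (rule UnI1, rule CollectI, rule exI[of _ i], rule exI[of _ j]) (simp del: upt_Suc)

lemma missing_runs_descI:
  "j \<le> i \<Longrightarrow> subseq [j..<Suc i] w \<Longrightarrow> rk p i j = i - j \<Longrightarrow> {j..i} \<in> missing_runs w p"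
  unfolding missing_runs_def 
  by (rule UnI2, rule CollectI, rule exI[of _ i], rule exI[of _ j]) (simp del: upt_Suc)

lemma subseq_run_set:
  assumes "i \<le> j" "subseq (rev [i..<Suc j]) w \<or> subseq [i..<Suc j] w"
  shows "{i..j} \<subseteq> set w"
proof
  fix x assume "x \<in> {i..j}"
  then have "x \<in> set [i..<Suc j]" "x \<in> set (rev [i..<Suc j])" by auto
  then show "x \<in> set w"
    using assms(2) subseq_mem[of "[i..<Suc j]" w x] subseq_mem[of "rev [i..<Suc j]" w x] by argo
qed

lemma missing_runs_subset: "C \<in> missing_runs w p \<Longrightarrow> C \<subseteq> set w \<and> C \<noteq> {}"
  by (erule missing_runs_cases) (simp_all only: subseq_run_set simp_thms atLeastatMost_empty_iff not_le linorder_not_less)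

lemma finite_missing_runs: "finite (missing_runs w p)"
proof (rule finite_subset)
  show "missing_runs w p \<subseteq> Pow (set w)" by (rule subsetI, rule PowI) (drule missing_runs_subset, simp)
qed simp

text \<open>By \<open>rk_subword\<close> the rank of a subword exceeds the least possible value
  exactly at the runs contained in \<open>T\<close>, and there by one; so \<open>p\<close> lies
  above it unless \<open>p\<close> attains the least value at one of these runs.\<close>

theorem subword_le_iff:
  assumes w: "distinct w" "valid_word n w" and p: "p \<in> Sn n"
  shows "bruhat n (subword w T) p \<longleftrightarrow> (\<forall>C\<in>missing_runs w p. \<not> C \<subseteq> T)"
proof -
  have S: "subword w T \<in> Sn n" by (rule wprod_Sn[OF valid_word_filter[OF w(2)]])
  show ?thesis unfolding bruhat_iff_rk[OF S p]
  proof
    assume le: "\<forall>a b. rk (subword w T) a b \<le> rk p a b"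
    show "\<forall>C\<in>missing_runs w p. \<not> C \<subseteq> T"
    proof (intro ballI notI)
      fix C assume "C \<in> missing_runs w p" and CT: "C \<subseteq> T"
      then show False
      proof (cases rule: missing_runs_cases)
        case (1 i j)
        then have "rk (subword w T) i j = 1" using CT rk_subword[OF w, of T i j] by (simp del: upt_Suc)
        then show False using le[rule_format, of i j] 1 by simp
      next
        case (2 i j)
        \<comment> \<open>On the diagonal \<open>rk_subword\<close> speaks of the reversed run,
          which for a single letter is the same list.\<close>
        have "rk (subword w T) j i = (j - i) + 1"
        proof (cases "i = j")
          case True
          have "subseq (rev [j..<Suc i]) w" using 2 True by simp
          then show ?thesis using CT 2 True rk_subword[OF w, of T j i] by (simp del: upt_Suc)
        next
          case False
          then have "\<not> j \<le> i" using 2 by simp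
          then show ?thesis using CT 2 rk_subword[OF w, of T j i] by (simp del: upt_Suc)
        qed
        then show False using le[rule_format, of j i] 2 by simp
      qed
    qed
  next
    assume no: "\<forall>C\<in>missing_runs w p. \<not> C \<subseteq> T"
    show "\<forall>a b. rk (subword w T) a b \<le> rk p a b"
    proof (intro allI)
      fix a b
      show "rk (subword w T) a b \<le> rk p a b"
      proof (cases "a \<le> b")
        case True
        have "rk p a b \<noteq> 0" if "{a..b} \<subseteq> T" "subseq (rev [a..<Suc b]) w"
          using that no missing_runs_ascI[OF True, of w p] by blast
        then show ?thesis using True rk_subword[OF w, of T a b]
          by (simp del: upt_Suc add: of_bool_def Suc_le_eq)
      next
        case False
        have "rk p a b \<noteq> a - b" if "{b..a} \<subseteq> T" "subseq [b..<Suc a] w"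
          using that no missing_runs_descI[of b a w p] False by (meson nat_le_linear)
        then show ?thesis using False rk_subword[OF w, of T a b] rk_lower[OF p, of a b]
          by (auto simp del: upt_Suc simp: of_bool_def)
      qed
    qed
  qed
qed

text \<open>The diagonal entry of the rank at a letter \<open>t\<close> of \<open>w\<close> is one
  exactly when \<open>t\<close> is used.\<close>

lemma subword_mono_iff:
  assumes w: "distinct w" "valid_word n w" and T: "T \<subseteq> set w"
  shows "bruhat n (subword w T) (subword w U) \<longleftrightarrow> T \<subseteq> U"
proof
  have S: "subword w T \<in> Sn n" for T by (rule wprod_Sn[OF valid_word_filter[OF w(2)]])
  assume le: "bruhat n (subword w T) (subword w U)"
  show "T \<subseteq> U"
  proof
    fix t assume t: "t \<in> T"
    then have s: "subseq (rev [t..<Suc t]) w" using T by (auto simp: subseq_singleton_left)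
    then have "rk (subword w T) t t = 1" using t rk_subword[OF w, of T t t] by (simp del: upt_Suc)
    then have "1 \<le> rk (subword w U) t t" using bruhat_rk[OF le S, of t t] by simp
    then show "t \<in> U" using rk_subword[OF w, of U t t] by (simp del: upt_Suc add: of_bool_def split: if_splits)
  qed
next
  have S: "subword w T \<in> Sn n" for T by (rule wprod_Sn[OF valid_word_filter[OF w(2)]])
  assume "T \<subseteq> U"
  then have "rk (subword w T) a b \<le> rk (subword w U) a b" for a b
    unfolding rk_subword[OF w] by (cases "a \<le> b") (auto simp del: upt_Suc simp: of_bool_def)
  then show "bruhat n (subword w T) (subword w U)" by (rule rk_bruhat[OF S S])
qed

section \<open>Repetition-free words of boolean permutations\<close>

lemma wprod_preserves: "a \<notin> set w \<Longrightarrow> x \<le> a \<Longrightarrow> wprod w x \<le> a"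
proof (induction w)
  case (Cons b w)
  then have "wprod w x \<le> a" "a \<noteq> b" by auto
  then show ?case by (auto simp: sref_def transpose_def)
qed simp

text \<open>The rank of \<open>sref k\<close> exceeds the least possible value only at
  \<open>(k, k)\<close>, and \<open>k < p k\<close> makes the rank of \<open>p\<close> positive
  there.\<close>

lemma rk_sref_le:
  assumes p: "p \<in> Sn n" and k: "1 \<le> k" "k < n" "k < p k"
  shows "bruhat n (sref k) p"
proof (rule rk_bruhat[OF sref_Sn[OF k(1,2)] p])
  fix a b
  have e: "rk (sref k) a b = (if a \<le> b then of_bool (subseq (rev [a..<Suc b]) [k])
     else (a - b) + of_bool (subseq [b..<Suc a] [k]))"
    using rk_wprod[of "[k]" a b] k by (simp del: upt_Suc)
  have one: "length xs = 1 \<and> xs = [k]" if "subseq xs [k]" "xs \<noteq> []" for xs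
    using that by (cases xs) (auto dest: list_emb_length simp: subseq_Cons2_iff split: if_splits)
  have "{m. m \<le> k \<and> k < p m} \<noteq> {}" using k(3) by auto
  then have kk: "1 \<le> rk p k k" unfolding rk_def by (simp add: Suc_le_eq card_gt_0_iff)
  show "rk (sref k) a b \<le> rk p a b"
  proof (cases "a \<le> b")
    case True
    have "a = k \<and> b = k" if "subseq (rev [a..<Suc b]) [k]"
    proof -
      have "length (rev [a..<Suc b]) = 1 \<and> rev [a..<Suc b] = [k]" by (rule one[OF that]) (use True in simp)
      then have "Suc b - a = 1" "rev [a..<Suc b] = [k]" by (simp_all del: upt_Suc)
      moreover from this have "b = a" using True by arith
      ultimately show ?thesis by simp
    qed
    then show ?thesis using e kk True by (auto simp del: upt_Suc simp: of_bool_def)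
  next
    case False
    have "\<not> subseq [b..<Suc a] [k]"
    proof
      assume "subseq [b..<Suc a] [k]"
      then have "length [b..<Suc a] = 1" using one False by fastforce
      then show False using False by simp
    qed
    then show ?thesis using e False rk_lower[OF p, of a b] by (simp del: upt_Suc)
  qed
qed

lemma ex_sref_le:
  assumes p: "p \<in> Sn n" and ne: "p \<noteq> id"
  obtains k where "1 \<le> k" "k < n" "bruhat n (sref k) p"
proof -
  obtain k where k: "1 \<le> k" "k \<le> n" "id k \<noteq> p k" "\<And>m. m < k \<Longrightarrow> id m = p m"
    using first_difference[OF id_Sn p] ne by metis
  have "id k \<le> p k"
    using k(4) bruhat_rk[OF bruhat_id_le[OF p] id_Sn] by (rule rk_first_difference)
  then have "k < p k" using k(3) by simp
  moreover have "p k \<le> n" using Sn_range[OF p k(1,2)] by simp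
  ultimately show ?thesis using that[of k] rk_sref_le[OF p k(1)] k(1) by simp
qed

lemma sref_le_support:
  assumes w: "valid_word n w" and k: "1 \<le> k" "k < n" and le: "bruhat n (sref k) (wprod w)"
  shows "k \<in> set w"
proof (rule ccontr)
  assume "k \<notin> set w"
  then have "{m. m \<le> k \<and> k < wprod w m} = {}" using wprod_preserves[of k w] by (auto simp: not_less)
  then have "rk (wprod w) k k = 0" unfolding rk_def by (simp only: card.empty)
  moreover have "k \<in> {m. m \<le> k \<and> k < sref k m}" by (simp add: sref_simps)
  then have "0 < rk (sref k) k k" unfolding rk_def card_gt_0_iff by auto
  ultimately show False using bruhat_rk[OF le sref_Sn[OF k], of k k] by linarith
qed

lemma prefix_chain:
  assumes w: "valid_word n w" "length w = clen n (wprod w)" and km: "k \<le> m" "m \<le> length w"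
  shows "bruhat n (wprod (take k w)) (wprod (take m w))"
    and "clen n (wprod (take m w)) = m"
proof -
  have val: "valid_word n (take k w)" "valid_word n (drop k w)" for k
    using w(1) by (auto simp: valid_word_def dest: in_set_takeD in_set_dropD)
  have len: "clen n (wprod (take k w)) = k" if k: "k \<le> length w" for k
  proof -
    have "clen n (wprod (take k w)) \<le> k" using clen_le[OF val(1)[of k]] k by simp
    moreover obtain x where x: "length x = clen n (wprod (take k w))" "valid_word n x" "wprod x = wprod (take k w)"
      using ex_clen_word[OF wprod_Sn[OF val(1)]] by blast
    have "wprod (x @ drop k w) = wprod (take k w @ drop k w)" unfolding wprod_append x(3) ..
    then have "clen n (wprod w) \<le> length (x @ drop k w)"
      using clen_le[of n "x @ drop k w"] x(2) val(2)[of k] by (simp add: valid_word_def ball_Un)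
    then have "k \<le> clen n (wprod (take k w))" using x(1) w(2) k by simp
    ultimately show ?thesis by simp
  qed
  show "clen n (wprod (take m w)) = m" by (rule len[OF km(2)])
  show "bruhat n (wprod (take k w)) (wprod (take m w))"
    using km
  proof (induction m rule: dec_induct)
    case base
    then show ?case by (simp add: bruhat_refl)
  next
    case (step m)
    then have m: "m < length w" by simp
    have "w ! m \<in> set w" using m by simp
    then have i: "1 \<le> w ! m" "w ! m < n" using w(1) by (auto simp: valid_word_def)
    have e: "wprod (take (Suc m) w) = wprod (take m w) \<circ> transpose (w ! m) (Suc (w ! m))"
      using m by (simp add: take_Suc_conv_app_nth wprod_append sref_def)
    have "clen n (wprod (take m w)) < clen n (wprod (take (Suc m) w))"
      using len[of m] len[of "Suc m"] m by simp
    then have "bruhat_step n (wprod (take m w)) (wprod (take (Suc m) w))"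
      unfolding bruhat_step_def using e i wprod_Sn[OF val(1)] 
      by (intro conjI exI[of _ "w ! m"] exI[of _ "Suc (w ! m)"]) simp_all
    then show ?case using step unfolding bruhat_def by (simp add: rtranclp.rtrancl_into_rtrancl)
  qed
qed

text \<open>Only an abstract isomorphism of the ideal with \<open>Pow S\<close> is given, so the
  letters are found by counting. The prefixes of a reduced word \<open>w\<close> form a chain,
  whence \<open>length w \<le> card S\<close>; every atom of the ideal is a simple reflection
  occurring in \<open>w\<close>, whence \<open>card S \<le> card (set w)\<close>. Equality forces
  distinct letters, and the subwords then fill the ideal, both having \<open>2 ^ length w\<close>
  elements.\<close>

theorem boolean_perm_word:
  assumes v: "v \<in> Sn n" and b: "boolean_perm n v"
  obtains w where "distinct w" "valid_word n w" "wprod w = v"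
    "{u \<in> Sn n. bruhat n u v} = subword w ` Pow (set w)"
proof -
  define I where "I = {u \<in> Sn n. bruhat n u v}"
  obtain S :: "nat set" and f where S: "finite S" and f: "bij_betw f I (Pow S)"
    and le: "\<And>u u'. u \<in> I \<Longrightarrow> u' \<in> I \<Longrightarrow> bruhat n u u' \<longleftrightarrow> f u \<subseteq> f u'"
    using b unfolding boolean_perm_def I_def by blast
  obtain w where w: "length w = clen n v" "valid_word n w" "wprod w = v"
    using ex_clen_word[OF v] by blast
  have finj: "inj_on f I" and fim: "f ` I = Pow S" using f by (auto simp: bij_betw_def)
  have val: "valid_word n (take k w)" for k
    using w(2) by (auto simp: valid_word_def dest: in_set_takeD)
  note ch = prefix_chain[OF w(2), unfolded w(3), OF w(1)]
  have UI: "wprod (take k w) \<in> I" if "k \<le> length w" for k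
    using ch(1)[of k "length w"] that w(3) wprod_Sn[OF val] by (simp add: I_def)
  have "k \<le> card (f (wprod (take k w)))" if "k \<le> length w" for k
    using that
  proof (induction k)
    case (Suc k)
    let ?A = "f (wprod (take k w))" and ?B = "f (wprod (take (Suc k) w))"
    have I: "wprod (take k w) \<in> I" "wprod (take (Suc k) w) \<in> I" using UI Suc.prems by auto
    have "?A \<subseteq> ?B" using le[OF I] ch(1)[of k "Suc k"] Suc.prems by simp
    moreover have "wprod (take k w) \<noteq> wprod (take (Suc k) w)"
      using ch(2)[of k k] ch(2)[of "Suc k" "Suc k"] Suc.prems by (metis Suc_leD le_refl n_not_Suc_n)
    then have "?A \<noteq> ?B" using finj I by (auto dest: inj_onD)
    moreover have "finite ?B" using fim I S by (metis PowD finite_subset imageI)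
    ultimately have "card ?A < card ?B" by (simp add: psubset_card_mono psubset_eq)
    then show ?case using Suc by simp
  qed simp
  then have "length w \<le> card (f v)" using w(3) by (metis order_refl take_all)
  moreover have vI: "v \<in> I" using v by (simp add: I_def bruhat_refl)
  then have "card (f v) \<le> card S" using fim S by (metis PowD card_mono imageI)
  ultimately have lS: "length w \<le> card S" by simp
  have idI: "id \<in> I" by (simp add: I_def id_Sn bruhat_id_le v)
  have fid: "f id = {}"
  proof -
    have "{} \<in> f ` I" using fim by simp
    then obtain x where "x \<in> I" "f x = {}" by auto
    then show ?thesis using le[OF idI, of x] bruhat_id_le[of x n] by (auto simp: I_def)
  qed
  have "(\<lambda>s. {s}) ` S \<subseteq> (\<lambda>k. f (sref k)) ` set w"
  proof
    fix A assume "A \<in> (\<lambda>s. {s}) ` S"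
    then obtain s where s: "s \<in> S" "A = {s}" by auto
    then have "{s} \<in> f ` I" using fim by simp
    then obtain x where x: "x \<in> I" "f x = {s}" by auto
    then have xS: "x \<in> Sn n" and xne: "x \<noteq> id" using fid by (auto simp: I_def)
    \<comment> \<open>Some simple reflection lies below the element \<open>x\<close> corresponding
      to \<open>{s}\<close>. Its image under \<open>f\<close> is a nonempty subset of
      \<open>{s}\<close>, hence all of it.\<close>
    obtain k where k: "1 \<le> k" "k < n" "bruhat n (sref k) x" using ex_sref_le[OF xS xne] .
    have kv: "bruhat n (sref k) v" using bruhat_trans[OF k(3)] x by (simp add: I_def)
    have kI: "sref k \<in> I" using kv sref_Sn[OF k(1,2)] by (simp add: I_def)
    have "sref k \<noteq> id" by (metis id_apply n_not_Suc_n sref_simps(1))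
    then have "f (sref k) \<noteq> {}" using finj kI idI fid by (auto dest: inj_onD)
    moreover have "f (sref k) \<subseteq> {s}" using le[OF kI x(1)] k(3) x(2) by simp
    ultimately have "f (sref k) = A" using s by auto
    moreover have "k \<in> set w" using sref_le_support[OF w(2) k(1,2)] kv w(3) by simp
    ultimately show "A \<in> (\<lambda>k. f (sref k)) ` set w" by blast
  qed
  then have "card ((\<lambda>s. {s}) ` S) \<le> card (set w)" by (meson surj_card_le List.finite_set)
  then have cS: "card S \<le> card (set w)" by (simp add: card_image)
  then have "card (set w) = length w" using lS card_length[of w] by simp
  then have d: "distinct w" by (rule card_distinct)
  have ws: "filter (\<lambda>x. x \<in> set w) w = w" by (simp add: filter_id_conv)
  have sub: "subword w ` Pow (set w) \<subseteq> I"
  proof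
    fix x assume "x \<in> subword w ` Pow (set w)"
    then obtain T where "T \<subseteq> set w" "x = subword w T" by auto
    then show "x \<in> I" using subword_mono_iff[OF d w(2), of T "set w"] wprod_Sn[OF valid_word_filter[OF w(2)]]
      by (simp add: I_def ws w(3))
  qed
  have "inj_on (subword w) (Pow (set w))"
  proof (rule inj_onI)
    fix T U assume TU: "T \<in> Pow (set w)" "U \<in> Pow (set w)" "subword w T = subword w U"
    then show "T = U" using subword_mono_iff[OF d w(2), of T U] subword_mono_iff[OF d w(2), of U T] 
      by (auto simp: bruhat_refl)
  qed
  then have "card (subword w ` Pow (set w)) = 2 ^ length w"
    by (simp add: card_image card_Pow distinct_card[OF d])
  moreover have "card I = 2 ^ card S" using bij_betw_same_card[OF f] S by (simp add: card_Pow)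
  moreover have "card S = length w" using lS cS card_length[of w] by simp
  moreover have "finite I" using finite_Sn[of n] by (simp add: I_def)
  ultimately have "subword w ` Pow (set w) = I" using sub by (intro card_subset_eq) simp_all
  then show ?thesis using that[OF d w(2,3)] by (simp add: I_def)
qed

section \<open>Robinson--Schensted insertion\<close>


definition row_insert :: "nat \<Rightarrow> nat list \<Rightarrow> nat list" where
  "row_insert x r = (case filter (\<lambda>y. x < y) r of [] \<Rightarrow> r @ [x] | y # _ \<Rightarrow> map (\<lambda>z. if z = y then x else z) r)"

definition row_bump :: "nat \<Rightarrow> nat list \<Rightarrow> nat list" where
  "row_bump x r = (case filter (\<lambda>y. x < y) r of [] \<Rightarrow> [] | y # _ \<Rightarrow> [y])"

definition row_state :: "nat list \<times> nat list \<Rightarrow> nat list \<Rightarrow> nat list \<times> nat list" where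
  "row_state = foldl (\<lambda>(r, b) x. (row_insert x r, b @ row_bump x r))"

definition row1 :: "nat list \<Rightarrow> nat list" where "row1 xs = fst (row_state ([], []) xs)"
definition bumps :: "nat list \<Rightarrow> nat list" where "bumps xs = snd (row_state ([], []) xs)"

lemma row1_Nil [simp]: "row1 [] = []" and bumps_Nil [simp]: "bumps [] = []"
  by (simp_all add: row1_def bumps_def row_state_def)

lemma row1_snoc: "row1 (xs @ [x]) = row_insert x (row1 xs)"
  and bumps_snoc: "bumps (xs @ [x]) = bumps xs @ row_bump x (row1 xs)"
  by (simp_all add: row1_def bumps_def row_state_def split: prod.splits)

lemma row_insert_not_Nil: "row_insert x r \<noteq> []"
  by (auto simp: row_insert_def split: list.splits)

lemma row1_Nil_iff: "row1 xs = [] \<longleftrightarrow> xs = []"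
  by (cases xs rule: rev_cases) (auto simp: row1_snoc row_insert_not_Nil)

definition rs_tableau :: "nat list \<Rightarrow> nat list list" where
  "rs_tableau xs = foldl (\<lambda>T x. rs_insert x T) [] xs"

lemma rs_tableau_Nil [simp]: "rs_tableau [] = []"
  by (simp add: rs_tableau_def)

text \<open>The rows below the first receive exactly the letters bumped out of it, in order; so a
  tableau can be studied row by row by induction along \<open>bumps\<close>.\<close>

lemma rs_tableau_rec: "xs \<noteq> [] \<Longrightarrow> rs_tableau xs = row1 xs # rs_tableau (bumps xs)"
proof (induction xs rule: rev_induct)
  case (snoc x xs)
  have e: "rs_tableau (ys @ [y]) = rs_insert y (rs_tableau ys)" for y ys by (simp add: rs_tableau_def)
  show ?case
  proof (cases "xs = []")
    case True
    then have "rs_tableau (xs @ [x]) = [[x]]" by (simp add: rs_tableau_def)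
    then show ?thesis using True row1_snoc[of "[]" x] bumps_snoc[of "[]" x] 
      by (simp add: row_insert_def row_bump_def)
  next
    case False
    then show ?thesis using snoc.IH
      by (simp add: e row1_snoc bumps_snoc row_insert_def row_bump_def split: list.split)
  qed
qed simp

lemma length_row1_bumps: "length (row1 xs) + length (bumps xs) = length xs"
  by (induction xs rule: rev_induct)
    (auto simp: row1_snoc bumps_snoc row_insert_def row_bump_def split: list.split)

lemma row_insert_cases:
  assumes r: "sorted_wrt (<) r" and x: "x \<notin> set r"
  obtains "\<And>y. y \<in> set r \<Longrightarrow> y < x" "row_bump x r = []" "row_insert x r = r @ [x]"
  | y where "y \<in> set r" "x < y" "\<And>z. z \<in> set r \<Longrightarrow> x < z \<Longrightarrow> y \<le> z" "row_bump x r = [y]"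
     "sorted_wrt (<) (row_insert x r)" "set (row_insert x r) = insert x (set r - {y})"
proof (cases "filter (\<lambda>y. x < y) r")
  case Nil
  then have "\<forall>y\<in>set r. \<not> x < y" by (simp add: filter_empty_conv)
  then have "y < x" if "y \<in> set r" for y using x that by (metis linorder_neqE_nat)
  then show ?thesis using that(1) Nil by (simp add: row_bump_def row_insert_def)
next
  case (Cons y ys)
  then obtain us vs where r': "r = us @ y # vs" "\<forall>u\<in>set us. \<not> x < u" "x < y" "ys = filter (\<lambda>y. x < y) vs"
    unfolding filter_eq_Cons_iff by auto
  have yn: "y \<notin> set us" "y \<notin> set vs" using r r'(1) by (auto simp: sorted_wrt_append)
  then have ins: "row_insert x r = us @ x # vs"
    using Cons r'(1) by (auto simp: row_insert_def map_idI intro!: map_idI)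
  have us: "u < x" if "u \<in> set us" for u using r'(2) x r'(1) that by (metis UnCI linorder_neqE_nat set_append)
  have vs: "y < v" if "v \<in> set vs" for v using r r'(1) that by (simp add: sorted_wrt_append)
  show ?thesis
  proof (rule that(2)[of y])
    show "sorted_wrt (<) (row_insert x r)"
      using r[unfolded r'(1)] us vs r'(3) unfolding ins
      by (auto simp: sorted_wrt_append intro: less_trans[OF r'(3) vs])
    show "set (row_insert x r) = insert x (set r - {y})" unfolding ins using yn r'(1) by auto
    show "row_bump x r = [y]" using Cons by (simp add: row_bump_def)
    show "y \<le> z" if "z \<in> set r" "x < z" for z using that r' vs by (auto intro: less_imp_le)
  qed (use r' in auto)
qed

lemma row_invariant:
  assumes "distinct xs"
  shows "sorted_wrt (<) (row1 xs) \<and> distinct (bumps xs) \<and> set (row1 xs) \<inter> set (bumps xs) = {} \<and>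
     set (row1 xs) \<union> set (bumps xs) = set xs"
  using assms
proof (induction xs rule: rev_induct)
  case (snoc x xs)
  then have IH: "sorted_wrt (<) (row1 xs)" "distinct (bumps xs)" "set (row1 xs) \<inter> set (bumps xs) = {}"
     "set (row1 xs) \<union> set (bumps xs) = set xs" by auto
  have x: "x \<notin> set xs" using snoc.prems by simp
  then have "x \<notin> set (row1 xs)" using IH by auto
  from IH(1) this show ?case
  proof (cases rule: row_insert_cases)
    case 1
    then show ?thesis using IH x by (auto simp: row1_snoc bumps_snoc sorted_wrt_append)
  next
    case (2 y)
    then have "set (row1 (xs @ [x])) = insert x (set (row1 xs) - {y})" "bumps (xs @ [x]) = bumps xs @ [y]"
      by (simp_all add: row1_snoc bumps_snoc)
    moreover have "sorted_wrt (<) (row1 (xs @ [x]))" using 2 by (simp add: row1_snoc)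
    ultimately show ?thesis using IH x 2(1) by auto
  qed
qed simp

lemma distinct_bumps: "distinct xs \<Longrightarrow> distinct (bumps xs)"
  and sorted_row1: "distinct xs \<Longrightarrow> sorted_wrt (<) (row1 xs)"
  and set_row1: "distinct xs \<Longrightarrow> set (row1 xs) \<subseteq> set xs"
  and set_bumps: "distinct xs \<Longrightarrow> set (bumps xs) \<subseteq> set xs"
  using row_invariant by blast+

lemma card_set_row1: "distinct xs \<Longrightarrow> card (set (row1 xs)) = length (row1 xs)"
  using sorted_row1 by (simp add: distinct_card strict_sorted_iff)

text \<open>In a strictly increasing row with entries \<open>R\<close> this is the number of columns
  left of the place of \<open>t\<close>; it allows rows to be compared as sets, without
  indices.\<close>

definition below :: "nat set \<Rightarrow> nat \<Rightarrow> nat" where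
  "below R t = card {r \<in> R. r < t}"

lemma row1_snoc_cases:
  assumes "distinct (xs @ [x])"
  obtains "\<And>y. y \<in> set (row1 xs) \<Longrightarrow> y < x" "bumps (xs @ [x]) = bumps xs" "set (row1 (xs @ [x])) = insert x (set (row1 xs))" "x \<notin> set (row1 xs)"
  | y where "y \<in> set (row1 xs)" "x < y" "\<And>z. z \<in> set (row1 xs) \<Longrightarrow> x < z \<Longrightarrow> y \<le> z" "bumps (xs @ [x]) = bumps xs @ [y]"
     "set (row1 (xs @ [x])) = insert x (set (row1 xs) - {y})" "x \<notin> set (row1 xs)"
proof -
  have r: "sorted_wrt (<) (row1 xs)" "x \<notin> set (row1 xs)" using assms sorted_row1[of xs] set_row1[of xs] by auto
  then show ?thesis
    by (cases rule: row_insert_cases) (use that r(2) in \<open>auto simp: row1_snoc bumps_snoc\<close>)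
qed

lemma below_insert: "finite R \<Longrightarrow> x \<notin> R \<Longrightarrow> below (insert x R) t = below R t + (if x < t then 1 else 0)"
proof -
  assume "finite R" "x \<notin> R"
  moreover have "{r \<in> insert x R. r < t} = (if x < t then insert x {r \<in> R. r < t} else {r \<in> R. r < t})" by auto
  ultimately show ?thesis by (simp add: below_def)
qed

lemma below_remove: "finite R \<Longrightarrow> y \<in> R \<Longrightarrow> below (R - {y}) t + (if y < t then 1 else 0) = below R t"
  using below_insert[of "R - {y}" y t] by (simp add: insert_absorb)

lemma below_mono: "finite R \<Longrightarrow> s \<le> t \<Longrightarrow> below R s \<le> below R t"
  unfolding below_def by (rule card_mono) auto

lemma below_row1_snoc:
  assumes d: "distinct (xs @ [x])"
  shows "below (set (row1 xs)) t \<le> below (set (row1 (xs @ [x]))) t"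
    and "x < t \<Longrightarrow> below (set (row1 xs)) x + 1 \<le> below (set (row1 (xs @ [x]))) t"
proof -
  let ?R = "set (row1 xs)"
  have "below ?R t \<le> below (set (row1 (xs @ [x]))) t \<and>
     (x < t \<longrightarrow> below ?R x + 1 \<le> below (set (row1 (xs @ [x]))) t)"
    using d
  proof (cases rule: row1_snoc_cases)
    case 1
    then show ?thesis using below_insert[of ?R x t] below_mono[of ?R x t] by auto
  next
    case (2 y)
    have "below ?R x + 1 \<le> below (insert x (?R - {y})) t" if "x < t"
    proof -
      have "below (?R - {y}) x = below ?R x" using below_remove[of ?R y x] 2 by simp
      then show ?thesis using below_insert[of "?R - {y}" x t] below_mono[of "?R - {y}" x t] 2 that by simp
    qed
    moreover have "below ?R t \<le> below (insert x (?R - {y})) t"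
      using below_insert[of "?R - {y}" x t] below_remove[of ?R y t] 2 by (auto split: if_splits)
    ultimately show ?thesis using 2 by simp
  qed
  then show "below ?R t \<le> below (set (row1 (xs @ [x]))) t"
    "x < t \<Longrightarrow> below ?R x + 1 \<le> below (set (row1 (xs @ [x]))) t" by auto
qed

section \<open>Schensted's theorem on increasing subsequences\<close>

definition incr_at :: "nat list \<Rightarrow> nat set \<Rightarrow> bool" where
  "incr_at xs A \<longleftrightarrow> A \<subseteq> {..<length xs} \<and> (\<forall>a\<in>A. \<forall>b\<in>A. a < b \<longrightarrow> xs ! a < xs ! b)"

text \<open>The two inequalities of \<open>below_row1_snoc\<close> are the induction step, according
  to whether the last position belongs to \<open>A\<close>; if it does, the remaining values lie
  below \<open>x\<close>.\<close>

lemma incr_le_below: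
  "distinct xs \<Longrightarrow> incr_at xs A \<Longrightarrow> (\<And>a. a \<in> A \<Longrightarrow> xs ! a < t) \<Longrightarrow> card A \<le> below (set (row1 xs)) t"
proof (induction xs arbitrary: A t rule: rev_induct)
  case Nil
  then show ?case by (simp add: incr_at_def)
next
  case (snoc x xs)
  let ?n = "length xs"
  have d: "distinct xs" using snoc.prems by simp
  have fA: "finite A" using snoc.prems(2) finite_subset unfolding incr_at_def by blast
  define B where "B = A - {?n}"
  have B: "incr_at xs B" using snoc.prems(2) unfolding incr_at_def B_def
    by (fastforce simp: nth_append less_Suc_eq)
  have val: "xs ! a = (xs @ [x]) ! a" if "a \<in> B" for a
    using B that unfolding incr_at_def by (auto simp: nth_append)
  show ?case
  proof (cases "?n \<in> A")
    case False
    then have "A = B" by (simp add: B_def)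
    then have "card A \<le> below (set (row1 xs)) t" using snoc.IH[OF d B, of t] snoc.prems(3) val by auto
    then show ?thesis using below_row1_snoc(1)[OF snoc.prems(1), of t] by simp
  next
    case True
    have xt: "x < t" using snoc.prems(3)[OF True] by simp
    have "xs ! a < x" if a: "a \<in> B" for a
    proof -
      have "a < ?n" "a \<in> A" using B a by (auto simp: incr_at_def B_def)
      then have "(xs @ [x]) ! a < (xs @ [x]) ! ?n" using snoc.prems(2) True unfolding incr_at_def by blast
      then show ?thesis using val[OF a] by simp
    qed
    then have "card B \<le> below (set (row1 xs)) x" using snoc.IH[OF d B] by blast
    then have "card A \<le> below (set (row1 xs)) x + 1" using True fA by (simp add: B_def card_Diff_singleton)
    then show ?thesis using below_row1_snoc(2)[OF snoc.prems(1) xt] by simp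
  qed
qed

text \<open>A newly inserted letter \<open>x\<close> extends the subsequence belonging to
  \<open>m\<close>, the largest entry of the row below \<open>x\<close>; the other surviving entries
  keep their columns and their subsequences.\<close>

lemma ex_incr_below:
  "distinct xs \<Longrightarrow> z \<in> set (row1 xs) \<Longrightarrow>
     \<exists>A. incr_at xs A \<and> card A = below (set (row1 xs)) (Suc z) \<and> (\<forall>a\<in>A. xs ! a \<le> z)"
proof (induction xs arbitrary: z rule: rev_induct)
  case (snoc x xs)
  let ?n = "length xs" and ?R = "set (row1 xs)" and ?R' = "set (row1 (xs @ [x]))"
  have d: "distinct xs" using snoc.prems by simp
  have up: "incr_at (xs @ [x]) A" if "incr_at xs A" for A
    using that unfolding incr_at_def by (auto simp: nth_append)
  have old: ?case if z: "z \<in> ?R" and e: "below ?R (Suc z) = below ?R' (Suc z)"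
  proof -
    obtain A where A: "incr_at xs A" "card A = below ?R (Suc z)" "\<forall>a\<in>A. xs ! a \<le> z"
      using snoc.IH[OF d z] by blast
    have "\<forall>a\<in>A. (xs @ [x]) ! a \<le> z" using A(1,3) by (auto simp: incr_at_def nth_append)
    then show ?thesis using up[OF A(1)] A(2) e by auto
  qed
  have new: "\<exists>A. incr_at (xs @ [x]) A \<and> card A = below ?R x + 1 \<and> (\<forall>a\<in>A. (xs @ [x]) ! a \<le> x)"
  proof -
    have "\<exists>B. incr_at xs B \<and> card B = below ?R x \<and> (\<forall>a\<in>B. xs ! a < x)"
    proof (cases "{r \<in> ?R. r < x} = {}")
      case True
      then show ?thesis by (intro exI[of _ "{}"]) (auto simp: below_def incr_at_def)
    next
      case False
      define m where "m = Max {r \<in> ?R. r < x}"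
      have "m \<in> {r \<in> ?R. r < x}" unfolding m_def using False by (intro Max_in) auto
      then have m: "m \<in> ?R" "m < x" by auto
      obtain B where B: "incr_at xs B" "card B = below ?R (Suc m)" "\<forall>a\<in>B. xs ! a \<le> m"
        using snoc.IH[OF d m(1)] by blast
      have "r \<le> m" if "r \<in> ?R" "r < x" for r unfolding m_def using that by (intro Max_ge) auto
      then have "{r \<in> ?R. r < Suc m} = {r \<in> ?R. r < x}" using m by fastforce
      then have "card B = below ?R x" using B(2) by (simp add: below_def)
      then show ?thesis using B m by (intro exI[of _ B]) auto
    qed
    then obtain B where B: "incr_at xs B" "card B = below ?R x" "\<And>a. a \<in> B \<Longrightarrow> xs ! a < x" by blast
    have n: "a < ?n" if "a \<in> B" for a using B(1) that by (auto simp: incr_at_def)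
    have fB: "finite B" "?n \<notin> B" using n finite_subset[of B "{..<?n}"] by auto
    have "incr_at (xs @ [x]) (insert ?n B)"
      using B(1) B(3) n unfolding incr_at_def by (auto simp: nth_append dest: n)
    moreover have "\<forall>a\<in>insert ?n B. (xs @ [x]) ! a \<le> x" using B(3) n by (auto simp: nth_append intro: less_imp_le)
    ultimately show ?thesis using fB B(2) by (intro exI[of _ "insert ?n B"]) auto
  qed
  from snoc.prems(1) show ?case
  proof (cases rule: row1_snoc_cases)
    case 1
    have e: "below ?R' t = below ?R t + (if x < t then 1 else 0)" for t
      unfolding 1(3) using below_insert[OF _ 1(4)] by simp
    have "z = x \<or> z \<in> ?R \<and> z < x" using snoc.prems(2) 1 by auto
    then show ?thesis
    proof
      assume zx: "z = x"
      have "{r \<in> ?R. r < Suc x} = {r \<in> ?R. r < x}" using 1(1) less_SucI[OF 1(1)] by blast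
      then show ?thesis using new e[of "Suc x"] zx by (simp add: below_def)
    next
      assume "z \<in> ?R \<and> z < x"
      then show ?thesis using old e[of "Suc z"] by simp
    qed
  next
    case (2 y)
    have e: "below ?R' t + (if y < t then 1 else 0) = below ?R t + (if x < t then 1 else 0)" for t
      unfolding 2(5) using below_insert[of "?R - {y}" x t] below_remove[of ?R y t] 2(1,6) by simp
    have "z = x \<or> z \<in> ?R \<and> z \<noteq> y" using snoc.prems(2) unfolding 2(5) by blast
    then have "z = x \<or> z \<in> ?R \<and> z < x \<or> z \<in> ?R \<and> y < z"
      using 2(3)[of z] by (metis le_neq_implies_less linorder_neqE_nat)
    then show ?thesis
    proof (elim disjE)
      assume zx: "z = x"
      have "{r \<in> ?R. r < Suc x} = {r \<in> ?R. r < x}" 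
        by (intro Collect_cong) (use 2(6) in \<open>auto simp: less_Suc_eq\<close>)
      then have "below ?R' (Suc x) = below ?R x + 1" using e[of "Suc x"] 2(2) by (simp add: below_def)
      then show ?thesis using new zx by simp
    next
      assume z: "z \<in> ?R \<and> z < x"
      then show ?thesis using old e[of "Suc z"] 2(2) by simp
    next
      assume z: "z \<in> ?R \<and> y < z"
      then show ?thesis using old e[of "Suc z"] 2(2) by simp
    qed
  qed
qed simp

theorem Schensted_ge: "distinct xs \<Longrightarrow> incr_at xs A \<Longrightarrow> card A \<le> length (row1 xs)"
proof -
  assume d: "distinct xs" and A: "incr_at xs A"
  have "xs ! a < Suc (sum_list xs)" if "a \<in> A" for a
    using A that member_le_sum_list[of "xs ! a" xs] by (auto simp: incr_at_def less_Suc_eq_le subset_iff)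
  then have "card A \<le> below (set (row1 xs)) (Suc (sum_list xs))" using incr_le_below[OF d A] by blast
  also have "\<dots> \<le> card (set (row1 xs))" unfolding below_def by (rule card_mono) auto
  finally show ?thesis using card_set_row1[OF d] by simp
qed

theorem Schensted_ex: "distinct xs \<Longrightarrow> \<exists>A. incr_at xs A \<and> card A = length (row1 xs)"
proof (cases "xs = []")
  case False
  assume d: "distinct xs"
  define z where "z = Max (set (row1 xs))"
  have ne: "set (row1 xs) \<noteq> {}" using False row1_Nil_iff by auto
  then have z: "z \<in> set (row1 xs)" unfolding z_def by (intro Max_in) auto
  have "{r \<in> set (row1 xs). r < Suc z} = set (row1 xs)" unfolding z_def by (auto simp: less_Suc_eq_le)
  then show ?thesis using ex_incr_below[OF d z] card_set_row1[OF d] by (auto simp: below_def)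
qed (auto simp: incr_at_def)

text \<open>Strictness of the columns, stated without reference to column indices.\<close>

lemma below_row2:
  "distinct xs \<Longrightarrow> below (set (row1 (bumps xs))) t \<le> below (set (row1 xs)) t"
proof (induction xs arbitrary: t rule: rev_induct)
  case (snoc x xs)
  let ?R = "set (row1 xs)" and ?R' = "set (row1 (xs @ [x]))" and ?Q = "set (row1 (bumps xs))"
  have IH: "below ?Q t \<le> below ?R t" for t using snoc by simp
  note mono = below_row1_snoc(1)[OF snoc.prems]
  from snoc.prems show ?case
  proof (cases rule: row1_snoc_cases)
    case 1
    then show ?thesis using order_trans[OF IH mono] by simp
  next
    case (2 y)
    have db: "distinct (bumps xs @ [y])" using distinct_bumps[OF snoc.prems] 2(4) by simp
    have e: "below ?R' t + (if y < t then 1 else 0) = below ?R t + (if x < t then 1 else 0)"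
      unfolding 2(5) using below_insert[of "?R - {y}" x t] below_remove[of ?R y t] 2(1,6) by simp
    from db show ?thesis
    proof (cases rule: row1_snoc_cases)
      case b: 1
      have "below (set (row1 (bumps xs @ [y]))) t = below ?Q t + (if y < t then 1 else 0)"
        unfolding b(3) using below_insert[OF _ b(4)] by simp
      moreover have "below ?Q t < below ?R t" if "y < t"
      proof -
        have "{r \<in> ?Q. r < t} = {r \<in> ?Q. r < y}" using b(1) less_trans[OF b(1) that] by blast
        then have "below ?Q t \<le> below ?R y" using IH[of y] by (simp add: below_def)
        also have "\<dots> < below ?R t" using below_remove[of ?R y t] below_remove[of ?R y y] below_mono[of "?R - {y}" y t] 2(1) that by simp
        finally show ?thesis .
      qed
      ultimately show ?thesis using IH[of t] e 2(2) 2(4) by (auto split: if_splits)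
    next
      case b: (2 z)
      have "below (set (row1 (bumps xs @ [y]))) t + (if z < t then 1 else 0) = below ?Q t + (if y < t then 1 else 0)"
        unfolding b(5) using below_insert[of "?Q - {z}" y t] below_remove[of ?Q z t] b(1,6) by simp
      moreover have "below ?Q t < below ?R t" if "y < t" "\<not> z < t"
      proof -
        have "{r \<in> ?Q. r < t} = {r \<in> ?Q. r < y}"
        proof (intro Collect_cong conj_cong refl iffI)
          fix r assume r: "r \<in> ?Q" "r < t"
          then show "r < y" using b(3)[of r] b(6) that by (metis leD le_less_linear le_less_trans linorder_neqE_nat)
        qed (use that in simp)
        then have "below ?Q t \<le> below ?R y" using IH[of y] by (simp add: below_def)
        also have "\<dots> < below ?R t" using below_remove[of ?R y t] below_remove[of ?R y y] below_mono[of "?R - {y}" y t] 2(1) that by simp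
        finally show ?thesis .
      qed
      ultimately show ?thesis using IH[of t] e 2(2) 2(4) b(2) by (auto split: if_splits)
    qed
  qed
qed (simp add: below_def)

lemma length_row2:
  assumes "distinct xs"
  shows "length (row1 (bumps xs)) \<le> length (row1 xs)"
proof -
  define t where "t = Suc (sum_list xs)"
  have t: "{r \<in> R. r < t} = R" if "R \<subseteq> set xs" for R
    using that member_le_sum_list[of _ xs] by (auto simp: t_def less_Suc_eq_le)
  have s: "set (row1 (bumps xs)) \<subseteq> set xs" "set (row1 xs) \<subseteq> set xs"
    using set_row1[OF distinct_bumps[OF assms]] set_bumps[OF assms] set_row1[OF assms] by auto
  show ?thesis using below_row2[OF assms, of t] card_set_row1[OF assms] card_set_row1[OF distinct_bumps[OF assms]]
    by (simp add: below_def t[OF s(1)] t[OF s(2)])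
qed

section \<open>Shapes and their weights\<close>

definition tableau_shape :: "nat list \<Rightarrow> nat list" where
  "tableau_shape xs = map length (rs_tableau xs)"

lemma tableau_shape_Nil [simp]: "tableau_shape [] = []" by (simp add: tableau_shape_def)

lemma tableau_shape_rec: "xs \<noteq> [] \<Longrightarrow> tableau_shape xs = length (row1 xs) # tableau_shape (bumps xs)"
  by (simp add: tableau_shape_def rs_tableau_rec)

lemma length_bumps_less: "xs \<noteq> [] \<Longrightarrow> length (bumps xs) < length xs"
  using length_row1_bumps[of xs] row1_Nil_iff[of xs] by (cases "row1 xs") auto

lemma sum_tableau_shape: "sum_list (tableau_shape xs) = length xs"
proof (induction "length xs" arbitrary: xs rule: less_induct)
  case less
  show ?case
  proof (cases "xs = []")
    case False
    then show ?thesis using less[OF length_bumps_less[OF False]] length_row1_bumps[of xs] by (simp add: tableau_shape_rec)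
  qed simp
qed

lemma tableau_shape_partition: "distinct xs \<Longrightarrow> sorted_wrt (\<ge>) (tableau_shape xs) \<and> (\<forall>l\<in>set (tableau_shape xs). 0 < l)"
proof (induction "length xs" arbitrary: xs rule: less_induct)
  case less
  show ?case
  proof (cases "xs = []")
    case False
    have IH: "sorted_wrt (\<ge>) (tableau_shape (bumps xs))" "\<forall>l\<in>set (tableau_shape (bumps xs)). 0 < l"
      using less.hyps[OF length_bumps_less[OF False] distinct_bumps[OF less.prems]] by auto
    have pos: "0 < length (row1 xs)" using False row1_Nil_iff by simp
    have "l \<le> length (row1 xs)" if "l \<in> set (tableau_shape (bumps xs))" for l
    proof -
      have ne: "bumps xs \<noteq> []" using that by auto
      have "l \<le> length (row1 (bumps xs))" using IH(1) that unfolding tableau_shape_rec[OF ne] by auto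
      then show ?thesis using length_row2[OF less.prems] by simp
    qed
    then show ?thesis using IH pos by (simp add: tableau_shape_rec[OF False])
  qed simp
qed

text \<open>For a partition with parts \<lambda>(1) \<ge> \<lambda>(2) \<ge> ... this is the sum of
  (i - 1) \<lambda>(i), the classical formula for the a-function on the cell of that shape.\<close>

fun shape_weight :: "nat list \<Rightarrow> nat" where
  "shape_weight [] = 0"
| "shape_weight (l # ls) = sum_list ls + shape_weight ls"

lemma shape_weight_rec: "xs \<noteq> [] \<Longrightarrow> shape_weight (tableau_shape xs) = length (bumps xs) + shape_weight (tableau_shape (bumps xs))"
  by (simp add: tableau_shape_rec sum_tableau_shape)

text \<open>The form that the one-line notation of the longest element of a standard parabolic
  subgroup takes when cut into blocks.\<close>

definition dec_blocks :: "nat list list \<Rightarrow> bool" where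
  "dec_blocks bs \<longleftrightarrow> (\<forall>b\<in>set bs. b \<noteq> [] \<and> sorted_wrt (>) b) \<and>
     sorted_wrt (\<lambda>b c. \<forall>x\<in>set b. \<forall>y\<in>set c. x < y) bs"

lemma row_state_append: "row_state s (xs @ ys) = row_state (row_state s xs) ys"
  by (simp add: row_state_def)

lemma row_state_block:
  "b \<noteq> [] \<Longrightarrow> sorted_wrt (>) b \<Longrightarrow> (\<And>x y. x \<in> set r \<Longrightarrow> y \<in> set b \<Longrightarrow> x < y) \<Longrightarrow>
     row_state (r, B) b = (r @ [last b], B @ butlast b)"
proof (induction b rule: rev_induct)
  case (snoc x b)
  have fr: "filter (\<lambda>y. x < y) r = []" using snoc.prems(3)[of _ x] by (force simp: filter_empty_conv)
  show ?case
  proof (cases "b = []")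
    case True
    then show ?thesis using fr by (simp add: row_state_def row_insert_def row_bump_def)
  next
    case False
    have lb: "x < last b" using snoc.prems(2) False by (simp add: sorted_wrt_append)
    have nr: "last b \<notin> set r" using snoc.prems(3)[of "last b" "last b"] False by auto
    have IH: "row_state (r, B) b = (r @ [last b], B @ butlast b)"
      by (rule snoc.IH[OF False]) (use snoc.prems in \<open>auto simp: sorted_wrt_append\<close>)
    have "row_insert x (r @ [last b]) = r @ [x]" "row_bump x (r @ [last b]) = [last b]"
      using fr lb nr by (auto simp: row_insert_def row_bump_def intro!: map_idI)
    then show ?thesis using IH False by (simp add: row_state_append) (simp add: row_state_def)
  qed
qed simp

lemma row_state_blocks:
  "dec_blocks bs \<Longrightarrow> row_state ([], []) (concat bs) = (map last bs, concat (map butlast bs))"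
proof (induction bs rule: rev_induct)
  case Nil
  then show ?case by (simp add: row_state_def)
next
  case (snoc b bs)
  then have db: "dec_blocks bs" and b: "b \<noteq> []" "sorted_wrt (>) b"
    and lt: "\<And>c x y. c \<in> set bs \<Longrightarrow> x \<in> set c \<Longrightarrow> y \<in> set b \<Longrightarrow> x < y"
    by (auto simp: dec_blocks_def sorted_wrt_append)
  have "x < y" if "x \<in> set (map last bs)" "y \<in> set b" for x y
    using that lt db by (auto simp: dec_blocks_def)
  then have "row_state (map last bs, concat (map butlast bs)) b = (map last bs @ [last b], concat (map butlast bs) @ butlast b)"
    by (rule row_state_block[OF b])
  then show ?case using snoc.IH[OF db] by (simp add: row_state_append)
qed

lemma concat_filter_Nil: "concat (filter (\<lambda>b. b \<noteq> []) bs) = concat bs"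
  by (induction bs) auto

text \<open>Within a block each letter bumps its predecessor, so only the last one stays in the
  first row; the bumped letters again form decreasing blocks, each shorter by one. Hence the shape
  is conjugate to the partition given by the block sizes.\<close>

lemma blocks_step:
  assumes "dec_blocks bs"
  defines "bs' \<equiv> filter (\<lambda>b. b \<noteq> []) (map butlast bs)"
  shows "dec_blocks bs'" "row1 (concat bs) = map last bs" "bumps (concat bs) = concat bs'"
proof -
  show "row1 (concat bs) = map last bs" "bumps (concat bs) = concat bs'"
    using row_state_blocks[OF assms(1)] by (simp_all add: row1_def bumps_def bs'_def concat_filter_Nil)
  have dec: "sorted_wrt (>) (butlast b)" if "sorted_wrt (>) b" for b :: "nat list"
    using that by (cases b rule: rev_cases) (auto simp: sorted_wrt_append)
  have "sorted_wrt (\<lambda>b c. \<forall>x\<in>set b. \<forall>y\<in>set c. x < y) (map butlast bs)"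
    unfolding sorted_wrt_map
    by (rule sorted_wrt_mono_rel[of _ "\<lambda>b c. \<forall>x\<in>set b. \<forall>y\<in>set c. x < y"])
      (use assms(1) in \<open>auto simp: dec_blocks_def dest: in_set_butlastD\<close>)
  then show "dec_blocks bs'" using assms(1) dec
    by (auto simp: dec_blocks_def bs'_def sorted_wrt_filter)
qed

lemma butlast_eq_Nil_iff: "butlast b = [] \<longleftrightarrow> length b \<le> 1"
  by (metis One_nat_def diff_is_0_eq length_0_conv length_butlast)

lemma choose2_Suc: "Suc k choose 2 = k + (k choose 2)"
  by (simp add: numeral_2_eq_2)

text \<open>A block of size \<open>k\<close> loses one letter per row and contributes
  \<open>(k - 1) + (k - 2) + ...\<close>, which is \<open>k choose 2\<close>, its number of
  inversions.\<close>

lemma shape_weight_blocks: "dec_blocks bs \<Longrightarrow> shape_weight (tableau_shape (concat bs)) = (\<Sum>k\<leftarrow>map length bs. k choose 2)"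
proof (induction "length (concat bs)" arbitrary: bs rule: less_induct)
  case less
  show ?case
  proof (cases "bs = []")
    case False
    define bs' where "bs' = filter (\<lambda>b. b \<noteq> []) (map butlast bs)"
    note st = blocks_step[OF less.prems, folded bs'_def]
    have ne: "concat bs \<noteq> []" using False less.prems by (cases bs) (auto simp: dec_blocks_def)
    have "shape_weight (tableau_shape (concat bs')) = (\<Sum>k\<leftarrow>map length bs'. k choose 2)"
      using length_bumps_less[OF ne] by (intro less.hyps st(1)) (simp add: st(3))
    moreover have "length (concat bs') + (\<Sum>k\<leftarrow>map length bs'. k choose 2) = (\<Sum>k\<leftarrow>map length bs. k choose 2)"
      using less.prems unfolding bs'_def dec_blocks_def
    proof (induction bs)
      case (Cons b bs)
      have "length b choose 2 = (length b - 1) + ((length b - 1) choose 2)"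
        using Cons.prems choose2_Suc[of "length b - 1"] by (cases b) auto
      moreover have "length (butlast b) choose 2 = 0" if "butlast b = []" using that by simp
      ultimately show ?case using Cons by (auto simp: butlast_eq_Nil_iff)
    qed simp
    ultimately show ?thesis using shape_weight_rec[OF ne] by (simp add: st(3))
  qed simp
qed

text \<open>The sizes form the conjugate partition: a new top row of length \<open>l\<close>
  enlarges each existing block by one and adds blocks of size one. The clause on
  \<open>length ks\<close> keeps the number of existing blocks at most \<open>l\<close>.\<close>

lemma ex_block_sizes:
  "sorted_wrt (\<ge>) \<mu> \<Longrightarrow> \<forall>l\<in>set \<mu>. 0 < l \<Longrightarrow>
    \<exists>ks. (\<forall>k\<in>set ks. 0 < k) \<and> length ks = (case \<mu> of [] \<Rightarrow> 0 | l # _ \<Rightarrow> l) \<and> sum_list ks = sum_list \<mu> \<and>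
      (\<forall>bs. dec_blocks bs \<longrightarrow> map length bs = ks \<longrightarrow> tableau_shape (concat bs) = \<mu>)"
proof (induction \<mu>)
  case (Cons l ls)
  then obtain ks where ks: "\<forall>k\<in>set ks. 0 < k" "length ks = (case ls of [] \<Rightarrow> 0 | l # _ \<Rightarrow> l)" "sum_list ks = sum_list ls"
      "\<And>bs. dec_blocks bs \<Longrightarrow> map length bs = ks \<Longrightarrow> tableau_shape (concat bs) = ls" by auto
  have lk: "length ks \<le> l" using ks(2) Cons.prems by (cases ls) auto
  define ks' where "ks' = map Suc ks @ replicate (l - length ks) 1"
  have "tableau_shape (concat bs) = l # ls" if bs: "dec_blocks bs" "map length bs = ks'" for bs
  proof -
    define bs' where "bs' = filter (\<lambda>b. b \<noteq> []) (map butlast bs)"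
    note st = blocks_step[OF bs(1), folded bs'_def]
    have lbs: "length bs = l" using bs(2) lk by (metis ks'_def length_append length_map length_replicate le_add_diff_inverse)
    then have ne: "concat bs \<noteq> []" using Cons.prems bs(1) by (cases bs) (auto simp: dec_blocks_def)
    have "map length bs' = filter (\<lambda>k. k \<noteq> 0) (map (\<lambda>k. k - 1) (map length bs))"
      unfolding bs'_def by (induction bs) (auto simp: butlast_eq_Nil_iff)
    also have "\<dots> = ks" unfolding bs(2) ks'_def using ks(1)
      by (auto simp: filter_id_conv comp_def filter_empty_conv)
    finally have "tableau_shape (concat bs') = ls" by (rule ks(4)[OF st(1)])
    then show ?thesis using tableau_shape_rec[OF ne] st lbs by simp
  qed
  moreover have "sum_list (map Suc ks) = length ks + sum_list ks" by (induction ks) auto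
  ultimately show ?case using ks lk by (intro exI[of _ ks']) (auto simp: ks'_def sum_list_replicate)
qed (auto simp: dec_blocks_def intro: exI[of _ "[]"])

section \<open>The a-function\<close>


lemma rs_P_eq: "rs_P n w = rs_tableau (map w [1..<Suc n])"
  unfolding rs_P_def rs_tableau_def by (simp only: foldl_map)

lemma rs_shape_eq: "rs_shape n w = tableau_shape (map w [1..<Suc n])"
  by (simp add: rs_shape_def tableau_shape_def rs_P_eq)

lemma distinct_one_line: "w \<in> Sn n \<Longrightarrow> distinct (map w [1..<Suc n])"
  using Sn_inj[of w n] by (auto simp: distinct_map inj_on_def simp del: upt_Suc)

text \<open>The composition belonging to a set \<open>J\<close> of simple reflections:
  \<open>m \<in> J\<close> puts the position \<open>Suc m\<close> into the block of the position
  \<open>m\<close>.\<close>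

fun block_sizes :: "nat set \<Rightarrow> nat \<Rightarrow> nat list" where
  "block_sizes J 0 = []"
| "block_sizes J (Suc m) = (if m \<in> J then butlast (block_sizes J m) @ [Suc (last (block_sizes J m))]
     else block_sizes J m @ [1])"

lemma block_sizes_cong: "J \<inter> {..<m} = K \<inter> {..<m} \<Longrightarrow> block_sizes J m = block_sizes K m"
proof (induction m)
  case (Suc m)
  have "x \<in> J \<longleftrightarrow> x \<in> K" if "x < Suc m" for x using Suc.prems that by blast
  then have "J \<inter> {..<m} = K \<inter> {..<m}" "m \<in> J \<longleftrightarrow> m \<in> K" by auto
  then show ?case using Suc.IH by simp
qed simp

lemma ex_block_sizes_set:
  "(\<forall>k\<in>set ks. 0 < k) \<Longrightarrow> sum_list ks = n \<Longrightarrow> \<exists>J\<subseteq>{1..<n}. block_sizes J n = ks"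
proof (induction n arbitrary: ks)
  case 0
  then have "ks = []" by (cases ks) auto
  then show ?case by auto
next
  case (Suc n)
  then obtain ks0 k where ks: "ks = ks0 @ [k]" by (cases ks rule: rev_cases) auto
  show ?case
  proof (cases "k = 1")
    case True
    then obtain J where J: "J \<subseteq> {1..<n}" "block_sizes J n = ks0" using Suc.IH[of ks0] Suc.prems ks by auto
    then have "n \<notin> J" by auto
    then have "block_sizes J (Suc n) = ks" using J ks True by simp
    moreover have "J \<subseteq> {1..<Suc n}" using J by auto
    ultimately show ?thesis by blast
  next
    case False
    then have k: "1 < k" using Suc.prems(1) ks by (auto simp: nat_neq_iff)
    then have "sum_list (ks0 @ [k - 1]) = n" using Suc.prems(2) ks by simp
    moreover have "\<forall>k\<in>set (ks0 @ [k - 1]). 0 < k" using Suc.prems(1) ks k by auto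
    ultimately obtain J where J: "J \<subseteq> {1..<n}" "block_sizes J n = ks0 @ [k - 1]"
      using Suc.IH by blast
    have "n \<noteq> 0" using J by (cases n) auto
    have "block_sizes (insert n J) n = block_sizes J n" by (rule block_sizes_cong) auto
    then have "block_sizes (insert n J) (Suc n) = ks" using J k ks by simp
    moreover have "insert n J \<subseteq> {1..<Suc n}" using J \<open>n \<noteq> 0\<close> by auto
    ultimately show ?thesis by blast
  qed
qed

lemma parabolic_Sn: "J \<subseteq> {1..<n} \<Longrightarrow> w \<in> parabolic J \<Longrightarrow> w \<in> Sn n"
  unfolding parabolic_def using wprod_Sn[of n] by (force simp: valid_word_def)

lemma ex_longest:
  assumes "J \<subseteq> {1..<n}"
  obtains w where "w \<in> parabolic J" "\<And>u. u \<in> parabolic J \<Longrightarrow> clen n u \<le> clen n w"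
proof -
  have fin: "finite (parabolic J)"
    using parabolic_Sn[OF assms] by (intro finite_subset[OF _ finite_Sn[of n]]) auto
  have "id \<in> parabolic J" unfolding parabolic_def by (intro CollectI exI[of _ "[]"]) simp
  then have "Max (clen n ` parabolic J) \<in> clen n ` parabolic J" using fin by (intro Max_in) auto
  then obtain w where w: "w \<in> parabolic J" "clen n w = Max (clen n ` parabolic J)" by auto
  show ?thesis by (rule that[OF w(1)]) (use w(2) fin in simp)
qed

text \<open>An ascent at \<open>i \<in> J\<close> would let multiplication by \<open>sref i\<close>
  lengthen \<open>w\<close> within the subgroup. For \<open>g \<notin> J\<close> no letter carries a
  point past \<open>g\<close>.\<close>

lemma longest_props:
  assumes J: "J \<subseteq> {1..<n}" and w: "w \<in> parabolic J" and max: "\<And>u. u \<in> parabolic J \<Longrightarrow> clen n u \<le> clen n w"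
  shows "w \<in> Sn n" "i \<in> J \<Longrightarrow> w (Suc i) < w i" "g \<notin> J \<Longrightarrow> k \<le> g \<Longrightarrow> w k \<le> g"
proof -
  show S: "w \<in> Sn n" by (rule parabolic_Sn[OF J w])
  obtain x where x: "set x \<subseteq> J" "w = wprod x" using w by (auto simp: parabolic_def)
  show "w k \<le> g" if "g \<notin> J" "k \<le> g"
    using wprod_preserves[of g x k] that x by auto
  assume i: "i \<in> J"
  then have i1: "1 \<le> i" "i < n" using J by auto
  show "w (Suc i) < w i"
  proof (rule ccontr)
    assume "\<not> w (Suc i) < w i"
    then have "w i < w (Suc i)" using Sn_inj[OF S, of i "Suc i"] by linarith
    then have "card (invs n (w \<circ> sref i)) = Suc (card (invs n w))" by (rule invs_sref[OF i1])
    moreover have ws: "w \<circ> sref i \<in> Sn n" by (rule Sn_comp[OF S sref_Sn[OF i1]])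
    moreover have "w \<circ> sref i = wprod (x @ [i])" by (simp add: wprod_append x(2))
    then have "w \<circ> sref i \<in> parabolic J" unfolding parabolic_def using x(1) i by (intro CollectI exI[of _ "x @ [i]"]) simp
    then have "clen n (w \<circ> sref i) \<le> clen n w" by (rule max)
    ultimately show False using clen_eq_invs[OF S] clen_eq_invs[OF ws] by simp
  qed
qed

lemma dec_blocks_snoc:
  "dec_blocks (bs @ [b]) \<longleftrightarrow> dec_blocks bs \<and> b \<noteq> [] \<and> sorted_wrt (>) b \<and>
     (\<forall>c\<in>set bs. \<forall>x\<in>set c. \<forall>y\<in>set b. x < y)"
  by (auto simp: dec_blocks_def sorted_wrt_append)

text \<open>Descents inside the blocks and invariance of the initial segments at their ends already
  fix the one-line form. The induction reads the positions up to \<open>m\<close>; \<open>g\<close>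
  is the end of the last completed block.\<close>

lemma longest_blocks:
  assumes S: "w \<in> Sn n" and J: "J \<subseteq> {1..<n}" and dec: "\<And>i. i \<in> J \<Longrightarrow> w (Suc i) < w i"
    and pres: "\<And>g k. g \<notin> J \<Longrightarrow> k \<le> g \<Longrightarrow> w k \<le> g"
    and m: "1 \<le> m" "m \<le> n"
  shows "\<exists>bs g. g < m \<and> g \<notin> J \<and> dec_blocks (bs @ [map w [Suc g..<Suc m]]) \<and> concat bs = map w [1..<Suc g] \<and>
     map length bs @ [m - g] = block_sizes J m \<and>
     card {(i, j). (i, j) \<in> invs n w \<and> j \<le> m} = (\<Sum>k\<leftarrow>block_sizes J m. k choose 2)"
  using m
proof (induction m rule: dec_induct)
  case base
  have "0 \<notin> J" using J by auto
  moreover have "{(i, j). (i, j) \<in> invs n w \<and> j \<le> 1} = {}" by (auto simp: invs_def)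
  then have "card {(i, j). (i, j) \<in> invs n w \<and> j \<le> 1} = 0" by (simp only: card.empty)
  ultimately show ?case by (intro exI[of _ "[]"] exI[of _ 0]) (simp add: dec_blocks_def numeral_2_eq_2)
next
  case (step m)
  then obtain bs g where g: "g < m" "g \<notin> J" and blocks: "dec_blocks (bs @ [map w [Suc g..<Suc m]])"
     and cc: "concat bs = map w [1..<Suc g]" and sz: "map length bs @ [m - g] = block_sizes J m"
     and inv: "card {(i, j). (i, j) \<in> invs n w \<and> j \<le> m} = (\<Sum>k\<leftarrow>block_sizes J m. k choose 2)"
    by auto
  let ?b = "map w [Suc g..<Suc m]"
  let ?N = "{k. 1 \<le> k \<and> k \<le> m \<and> w (Suc m) < w k}"
  have finN: "finite ?N" by (rule finite_subset[of _ "{..m}"]) auto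
  have "{(i, j). (i, j) \<in> invs n w \<and> j \<le> Suc m} = {(i, j). (i, j) \<in> invs n w \<and> j \<le> m} \<union> (\<lambda>k. (k, Suc m)) ` ?N"
    using step.prems by (auto simp: invs_def le_Suc_eq)
  moreover have "finite {(i, j). (i, j) \<in> invs n w \<and> j \<le> m}"
    by (rule finite_subset[OF _ finite_invs[of n w]]) auto
  ultimately have cardI: "card {(i, j). (i, j) \<in> invs n w \<and> j \<le> Suc m} = card {(i, j). (i, j) \<in> invs n w \<and> j \<le> m} + card ?N"
    using finN by (simp only:) (subst card_Un_disjoint, auto simp: card_image inj_on_def)
  have sums: "(\<Sum>k\<leftarrow>block_sizes J m. k choose 2) = (\<Sum>b\<leftarrow>bs. length b choose 2) + ((m - g) choose 2)"
    unfolding sz[symmetric] by (simp add: comp_def)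
  show ?case
  proof (cases "m \<in> J")
    case False
    \<comment> \<open>Pigeonhole: \<open>w\<close> maps \<open>{..m}\<close> injectively into
      itself, so the next value lies above \<open>m\<close>.\<close>
    have new: "m < w (Suc m)"
    proof (rule ccontr)
      assume "\<not> m < w (Suc m)"
      then have "w ` {..Suc m} \<subseteq> {..m}" using pres[OF False] by (auto simp: le_Suc_eq)
      then have "card (w ` {..Suc m}) \<le> card {..m}" by (intro card_mono) auto
      moreover have "inj_on w {..Suc m}" using Sn_inj[OF S] by (auto intro: inj_onI)
      ultimately show False by (simp add: card_image)
    qed
    have old: "w k < w (Suc m)" if "k \<le> m" for k using pres[OF False that] new by simp
    have cc': "concat (bs @ [?b]) = map w [1..<Suc m]"
    proof -
      have "[1..<Suc m] = [1..<Suc g] @ [Suc g..<Suc m]" using upt_add_eq_append[of 1 "Suc g" "m - g"] g(1) by simp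
      then show ?thesis using cc by (simp del: upt_Suc)
    qed
    have mem: "x < w (Suc m)" if "b \<in> set (bs @ [?b])" "x \<in> set b" for b x
    proof -
      have "x \<in> set (concat (bs @ [?b]))" using that by auto
      then have "x \<in> w ` {1..<Suc m}" unfolding cc' by (simp del: upt_Suc)
      then show ?thesis using old by auto
    qed
    have "dec_blocks ((bs @ [?b]) @ [[w (Suc m)]])"
      unfolding dec_blocks_snoc[of "bs @ [?b]"]
    proof (intro conjI ballI)
      fix c x y assume "c \<in> set (bs @ [?b])" "x \<in> set c" "y \<in> set [w (Suc m)]"
      then show "x < y" using mem[of c x] by (simp only: list.set insert_iff empty_iff simp_thms)
    qed (use blocks in simp_all)
    moreover have N0: "?N = {}" using old by (auto simp: not_less intro: less_imp_le)
    have "card {(i, j). (i, j) \<in> invs n w \<and> j \<le> Suc m} = (\<Sum>k\<leftarrow>block_sizes J (Suc m). k choose 2)"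
      unfolding cardI N0 inv using False by (simp add: numeral_2_eq_2)
    ultimately show ?thesis using False g sz cc'
      by (intro exI[of _ "bs @ [?b]"] exI[of _ m]) (simp del: upt_Suc add: upt_rec[of "Suc m" "Suc (Suc m)"])
  next
    case True
    let ?b' = "map w [Suc g..<Suc (Suc m)]"
    have b': "?b' = ?b @ [w (Suc m)]" using g(1) by simp
    have gx: "g < w (Suc m)"
    proof (rule ccontr)
      assume "\<not> g < w (Suc m)"
      then have "w ` (insert (Suc m) {..g}) \<subseteq> {..g}" using pres[OF g(2)] by auto
      then have "card (w ` (insert (Suc m) {..g})) \<le> card {..g}" by (intro card_mono) auto
      moreover have "inj_on w (insert (Suc m) {..g})" using Sn_inj[OF S] by (auto intro: inj_onI)
      ultimately show False using g(1) by (simp add: card_image)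
    qed
    have sb: "sorted_wrt (>) ?b" using blocks unfolding dec_blocks_snoc by blast
    have lb: "?b = map w [Suc g..<m] @ [w m]" using g(1) by simp
    have big: "w (Suc m) < x" if "x \<in> set ?b" for x
    proof -
      have "w m \<le> x" using sb that unfolding lb by (auto simp: sorted_wrt_append intro: less_imp_le)
      then show ?thesis using dec[OF True] by simp
    qed
    have small: "x < w (Suc m)" if "b \<in> set bs" "x \<in> set b" for b x
    proof -
      have "x \<in> set (concat bs)" using that by auto
      then have "x \<in> w ` {1..<Suc g}" unfolding cc by (simp del: upt_Suc)
      then obtain k where "k \<in> {1..<Suc g}" "x = w k" by blast
      then show ?thesis using pres[OF g(2), of k] gx by simp
    qed
    have "sorted_wrt (>) ?b'" unfolding b' sorted_wrt_append using sb big by (simp del: upt_Suc)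
    moreover have "?b' \<noteq> []" using g(1) by simp
    moreover have "\<forall>x\<in>set b. \<forall>y\<in>set ?b'. x < y" if b: "b \<in> set bs" for b
    proof (intro ballI)
      fix x y assume x: "x \<in> set b" and "y \<in> set ?b'"
      then have "y \<in> set ?b \<or> y = w (Suc m)" unfolding b' by auto
      then show "x < y"
      proof
        assume "y \<in> set ?b"
        then show ?thesis using blocks b x unfolding dec_blocks_snoc by blast
      qed (use small[OF b x] in simp)
    qed
    ultimately have "dec_blocks (bs @ [?b'])"
      using blocks unfolding dec_blocks_snoc by blast
    moreover have N: "?N = {g<..m}"
    proof (intro equalityI subsetI)
      fix k assume k: "k \<in> ?N"
      have "\<not> k \<le> g"
      proof
        assume "k \<le> g"
        then have "w k < w (Suc m)" using pres[OF g(2), of k] gx by simp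
        then show False using k by simp
      qed
      then show "k \<in> {g<..m}" using k by simp
    next
      fix k assume k: "k \<in> {g<..m}"
      then have "w k \<in> set ?b" by (auto simp del: upt_Suc)
      then show "k \<in> ?N" using big k by simp
    qed
    have bsz: "block_sizes J (Suc m) = map length bs @ [Suc (m - g)]"
      using True unfolding block_sizes.simps sz[symmetric] by simp
    have "card {(i, j). (i, j) \<in> invs n w \<and> j \<le> Suc m} = (\<Sum>k\<leftarrow>block_sizes J (Suc m). k choose 2)"
      unfolding cardI N inv sums bsz using choose2_Suc[of "m - g"] by (simp add: comp_def)
    ultimately show ?thesis using g cc bsz
      by (intro exI[of _ bs] exI[of _ g]) (simp del: upt_Suc block_sizes.simps add: Suc_diff_le)
  qed
qed

lemma longest_shape:
  assumes n: "1 \<le> n" and J: "J \<subseteq> {1..<n}" and w: "w \<in> parabolic J"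
    and max: "\<And>u. u \<in> parabolic J \<Longrightarrow> clen n u \<le> clen n w"
  shows "\<exists>bs. dec_blocks bs \<and> map length bs = block_sizes J n \<and> rs_shape n w = tableau_shape (concat bs) \<and>
     clen n w = shape_weight (rs_shape n w)"
proof -
  note lp = longest_props[OF J w max]
  obtain bs g where bs: "g < n" "dec_blocks (bs @ [map w [Suc g..<Suc n]])" "concat bs = map w [1..<Suc g]"
     "map length bs @ [n - g] = block_sizes J n"
     "card {(i, j). (i, j) \<in> invs n w \<and> j \<le> n} = (\<Sum>k\<leftarrow>block_sizes J n. k choose 2)"
    using longest_blocks[OF lp(1) J lp(2,3) n order_refl] by blast
  let ?bs = "bs @ [map w [Suc g..<Suc n]]"
  have "[1..<Suc n] = [1..<Suc g] @ [Suc g..<Suc n]"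
    using upt_add_eq_append[of 1 "Suc g" "n - g"] bs(1) by simp
  then have cc: "concat ?bs = map w [1..<Suc n]" using bs(3) by (simp del: upt_Suc)
  have len: "map length ?bs = block_sizes J n" using bs(4) by (simp del: upt_Suc)
  have "{(i, j). (i, j) \<in> invs n w \<and> j \<le> n} = invs n w" by (auto simp: invs_def)
  then have "clen n w = (\<Sum>k\<leftarrow>map length ?bs. k choose 2)" using bs(5) clen_eq_invs[OF lp(1)] unfolding len by simp
  also have "\<dots> = shape_weight (tableau_shape (concat ?bs))" by (rule shape_weight_blocks[OF bs(2), symmetric])
  finally show ?thesis using bs(2) len cc unfolding rs_shape_eq by (metis (no_types))
qed

text \<open>Existence in the definite description is \<open>longest_shape\<close>. Uniqueness holds
  because every shape of a permutation is also the shape of a longest element: the conjugate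
  partition gives block sizes, these a set \<open>J\<close>, and \<open>J\<close> a longest element
  of \<open>parabolic J\<close>.\<close>

theorem a_fun_eq:
  assumes n: "1 \<le> n"
  shows "a_fun n = (\<lambda>w. if w \<in> Sn n then shape_weight (rs_shape n w) else 0)"
  unfolding a_fun_def
proof (rule the_equality)
  show "(\<forall>w. w \<notin> Sn n \<longrightarrow> (if w \<in> Sn n then shape_weight (rs_shape n w) else 0) = 0)
       \<and> (\<forall>u\<in>Sn n. \<forall>w\<in>Sn n. rs_shape n u = rs_shape n w \<longrightarrow>
           (if u \<in> Sn n then shape_weight (rs_shape n u) else 0) = (if w \<in> Sn n then shape_weight (rs_shape n w) else 0))
       \<and> (\<forall>J. J \<subseteq> {1..<n} \<longrightarrow> (\<forall>w\<in>parabolic J.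
             (\<forall>u\<in>parabolic J. clen n u \<le> clen n w) \<longrightarrow> (if w \<in> Sn n then shape_weight (rs_shape n w) else 0) = clen n w))"
  proof (intro conjI allI ballI impI)
    fix J w assume J: "J \<subseteq> {1..<n}" and w: "w \<in> parabolic J" and max: "\<forall>u\<in>parabolic J. clen n u \<le> clen n w"
    then show "(if w \<in> Sn n then shape_weight (rs_shape n w) else 0) = clen n w"
      using longest_shape[OF n J w] parabolic_Sn[OF J w] by auto
  qed simp_all
next
  fix f assume f: "(\<forall>w. w \<notin> Sn n \<longrightarrow> f w = 0)
       \<and> (\<forall>u\<in>Sn n. \<forall>w\<in>Sn n. rs_shape n u = rs_shape n w \<longrightarrow> f u = f w)
       \<and> (\<forall>J. J \<subseteq> {1..<n} \<longrightarrow> (\<forall>w\<in>parabolic J.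
             (\<forall>u\<in>parabolic J. clen n u \<le> clen n w) \<longrightarrow> f w = clen n w))"
  show "f = (\<lambda>w. if w \<in> Sn n then shape_weight (rs_shape n w) else 0)"
  proof
    fix w
    show "f w = (if w \<in> Sn n then shape_weight (rs_shape n w) else 0)"
    proof (cases "w \<in> Sn n")
      case True
      let ?xs = "map w [1..<Suc n]"
      have part: "sorted_wrt (\<ge>) (tableau_shape ?xs)" "\<forall>l\<in>set (tableau_shape ?xs). 0 < l"
        using tableau_shape_partition[OF distinct_one_line[OF True]] by auto
      obtain ks where ks: "\<forall>k\<in>set ks. 0 < k" "sum_list ks = sum_list (tableau_shape ?xs)"
        "\<And>bs. dec_blocks bs \<Longrightarrow> map length bs = ks \<Longrightarrow> tableau_shape (concat bs) = tableau_shape ?xs"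
        using ex_block_sizes[OF part] by blast
      have "sum_list ks = n" unfolding ks(2) sum_tableau_shape by simp
      then obtain J where J: "J \<subseteq> {1..<n}" "block_sizes J n = ks" using ex_block_sizes_set[OF ks(1)] by blast
      obtain u where u: "u \<in> parabolic J" "\<And>x. x \<in> parabolic J \<Longrightarrow> clen n x \<le> clen n u" using ex_longest[OF J(1)] by blast
      obtain bs where bs: "dec_blocks bs" "map length bs = ks" "rs_shape n u = tableau_shape (concat bs)" "clen n u = shape_weight (rs_shape n u)"
        using longest_shape[OF n J(1) u] J(2) by auto
      have sh: "rs_shape n u = rs_shape n w" unfolding bs(3) rs_shape_eq[of n w] by (rule ks(3)[OF bs(1,2)])
      have "f u = clen n u" using f J(1) u by blast
      moreover have "f w = f u" using f sh True parabolic_Sn[OF J(1) u(1)] by metis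
      ultimately show ?thesis using True bs(4) sh by simp
    qed (use f in simp)
  qed
qed

section \<open>Words without decreasing subsequences of length three\<close>

lemma row1_increasing: "sorted_wrt (<) ys \<Longrightarrow> row1 ys = ys \<and> bumps ys = []"
proof (induction ys rule: rev_induct)
  case (snoc y ys)
  then have IH: "row1 ys = ys" "bumps ys = []" and lt: "\<forall>x\<in>set ys. x < y" by (auto simp: sorted_wrt_append)
  have "filter (\<lambda>z. y < z) ys = []" using lt by (force simp: filter_empty_conv)
  then show ?case using IH by (simp add: row1_snoc bumps_snoc row_insert_def row_bump_def)
qed simp

text \<open>The second conjunct carries the induction: a bumped \<open>z\<close> above a row entry
  \<open>y\<close> is witnessed by an inversion whose lower value is at least \<open>y\<close>. If a
  letter later bumped such a \<open>y\<close>, that inversion followed by this letter would be a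
  decreasing triple, so the bumped letters come in increasing order.\<close>

lemma bumps_increasing:
  assumes "distinct xs" and "\<And>i j k. i < j \<Longrightarrow> j < k \<Longrightarrow> k < length xs \<Longrightarrow> \<not> (xs ! k < xs ! j \<and> xs ! j < xs ! i)"
  shows "sorted_wrt (<) (bumps xs) \<and>
     (\<forall>z\<in>set (bumps xs). \<forall>y\<in>set (row1 xs). y < z \<longrightarrow> (\<exists>i j. i < j \<and> j < length xs \<and> xs ! j < xs ! i \<and> y \<le> xs ! j))"
  using assms
proof (induction xs rule: rev_induct)
  case (snoc x xs)
  let ?xs = "xs @ [x]"
  have d: "distinct xs" using snoc.prems by simp
  have no: "\<not> (xs ! k < xs ! j \<and> xs ! j < xs ! i)" if "i < j" "j < k" "k < length xs" for i j k
    using snoc.prems(2)[of i j k] that by (simp add: nth_append)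
  have IH1: "sorted_wrt (<) (bumps xs)" using snoc.IH[OF d no] by simp
  have IH2: "\<exists>i j. i < j \<and> j < length xs \<and> xs ! j < xs ! i \<and> y \<le> xs ! j"
    if "z \<in> set (bumps xs)" "y \<in> set (row1 xs)" "y < z" for z y
    using snoc.IH[OF d no] that by blast
  have lift: "\<exists>i j. i < j \<and> j < length ?xs \<and> ?xs ! j < ?xs ! i \<and> y \<le> ?xs ! j"
    if ex: "\<exists>i j. i < j \<and> j < length xs \<and> xs ! j < xs ! i \<and> y \<le> xs ! j" for y
  proof -
    obtain i j where "i < j" "j < length xs" "xs ! j < xs ! i" "y \<le> xs ! j" using ex by blast
    then show ?thesis by (intro exI[of _ i] exI[of _ j]) (simp add: nth_append)
  qed
  have last: "\<exists>i j. i < j \<and> j < length ?xs \<and> ?xs ! j < ?xs ! i \<and> y \<le> ?xs ! j"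
    if z: "z \<in> set xs" "x < z" and y: "y \<le> x" for z y
  proof -
    obtain i where "i < length xs" "xs ! i = z" using z(1) by (auto simp: in_set_conv_nth)
    then show ?thesis using z y by (intro exI[of _ i] exI[of _ "length xs"]) (simp add: nth_append)
  qed
  have bx: "z \<in> set xs" if "z \<in> set (bumps xs)" for z using set_bumps[OF d] that by auto
  have dis: "set (row1 xs) \<inter> set (bumps xs) = {}" using row_invariant[OF d] by blast
  from snoc.prems(1) show ?case
  proof (cases rule: row1_snoc_cases)
    case 1
    have "\<exists>i j. i < j \<and> j < length ?xs \<and> ?xs ! j < ?xs ! i \<and> y \<le> ?xs ! j"
      if zy: "z \<in> set (bumps xs)" "y \<in> set (row1 ?xs)" "y < z" for z y
    proof -
      have "y = x \<or> y \<in> set (row1 xs)" using zy(2) unfolding 1(3) by blast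
      then show ?thesis
      proof
        assume "y = x"
        then show ?thesis using last[OF bx[OF zy(1)], of y] zy(3) by simp
      next
        assume "y \<in> set (row1 xs)"
        then show ?thesis by (rule lift[OF IH2[OF zy(1) _ zy(3)]])
      qed
    qed
    then show ?thesis unfolding 1(2) using IH1 by simp
  next
    case (2 v)
    have vx: "v \<in> set xs" using set_row1[OF d] 2(1) by auto
    have lt: "z < v" if z: "z \<in> set (bumps xs)" for z
    proof (rule ccontr)
      assume "\<not> z < v"
      then have "v < z" using z 2(1) dis by (metis disjoint_iff linorder_neqE_nat)
      then obtain i j where ij: "i < j" "j < length xs" "xs ! j < xs ! i" "v \<le> xs ! j" using IH2[OF z 2(1)] by blast
      then show False using snoc.prems(2)[of i j "length xs"] 2(2) by (simp add: nth_append)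
    qed
    have "\<exists>i j. i < j \<and> j < length ?xs \<and> ?xs ! j < ?xs ! i \<and> y \<le> ?xs ! j"
      if zy: "z \<in> set (bumps xs @ [v])" "y \<in> set (row1 ?xs)" "y < z" for z y
    proof -
      have y: "y = x \<or> y \<in> set (row1 xs) \<and> y \<noteq> v" using zy(2) unfolding 2(5) by blast
      show ?thesis
      proof (cases "z = v")
        case True
        then have "y \<le> x" using y 2(3)[of y] zy(3) by (metis le_less_linear order_refl leD)
        then show ?thesis by (rule last[OF vx 2(2)])
      next
        case False
        then have z: "z \<in> set (bumps xs)" using zy(1) by simp
        from y show ?thesis
        proof
          assume "y = x"
          then show ?thesis using last[OF bx[OF z], of y] zy(3) by simp
        next
          assume "y \<in> set (row1 xs) \<and> y \<noteq> v"
          then have "y \<in> set (row1 xs)" by simp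
          then show ?thesis by (rule lift[OF IH2[OF z _ zy(3)]])
        qed
      qed
    qed
    then show ?thesis unfolding 2(4) sorted_wrt_append using IH1 lt by simp
  qed
qed simp

text \<open>The bumped letters increase, so there are at most two rows and the weight is the length
  of the second.\<close>

theorem shape_weight_321_avoiding:
  assumes "distinct xs" and "\<And>i j k. i < j \<Longrightarrow> j < k \<Longrightarrow> k < length xs \<Longrightarrow> \<not> (xs ! k < xs ! j \<and> xs ! j < xs ! i)"
  shows "shape_weight (tableau_shape xs) = length xs - length (row1 xs)"
proof (cases "xs = []")
  case False
  have "shape_weight (tableau_shape (bumps xs)) = 0"
  proof (cases "bumps xs = []")
    case ne: False
    have "bumps (bumps xs) = []" using row1_increasing bumps_increasing[OF assms] by blast
    then show ?thesis using shape_weight_rec[OF ne] by simp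
  qed simp
  then show ?thesis using shape_weight_rec[OF False] length_row1_bumps[of xs] by simp
qed simp

section \<open>Monotone runs\<close>


text \<open>The rightmost letter acts first, so the product of the letters from \<open>x\<close> to
  \<open>y\<close> written in reversed order raises the point \<open>x\<close> to
  \<open>Suc y\<close>; \<open>asc\<close> and \<open>desc\<close> refer to this motion, not to the
  order in the list.\<close>

definition asc :: "nat list \<Rightarrow> nat \<Rightarrow> nat \<Rightarrow> bool" where
  "asc w x y \<longleftrightarrow> x \<le> y \<and> subseq (rev [x..<Suc y]) w"

definition desc :: "nat list \<Rightarrow> nat \<Rightarrow> nat \<Rightarrow> bool" where
  "desc w x y \<longleftrightarrow> x \<le> y \<and> subseq [x..<Suc y] w"

text \<open>
  For \<open>x \<le> y\<close>, \<open>up p x y\<close> and \<open>dn p x y\<close> say that \<open>p\<close> lies above the cycle with the ascending, respectively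
  descending, run of letters \<open>{x..y}\<close>.  Passing to the reversed word and the inverse permutation
  exchanges \<open>asc\<close> with \<open>desc\<close> and \<open>up\<close> with \<open>dn\<close>.
\<close>

definition up :: "(nat \<Rightarrow> nat) \<Rightarrow> nat \<Rightarrow> nat \<Rightarrow> bool" where
  "up p x y \<longleftrightarrow> (\<exists>k\<le>x. y < p k)"

definition dn :: "(nat \<Rightarrow> nat) \<Rightarrow> nat \<Rightarrow> nat \<Rightarrow> bool" where
  "dn p x y \<longleftrightarrow> (\<exists>k>y. p k \<le> x)"

lemma subseq_rev_iff: "subseq (rev xs) (rev ys) \<longleftrightarrow> subseq xs ys"
proof -
  have "subseq (rev xs) (rev ys)" if "subseq xs ys" for xs ys :: "'a list"
    using that
  proof (induction rule: list_emb.induct)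
    case (list_emb_Cons xs ys y)
    then show ?case by (simp add: subseq_rev_drop_many)
  next
    case (list_emb_Cons2 x y xs ys)
    then show ?case by (simp add: list_emb_append_mono)
  qed simp
  from this[of xs ys] this[of "rev xs" "rev ys"] show ?thesis by auto
qed

lemma desc_rev: "desc (rev w) x y \<longleftrightarrow> asc w x y"
  using subseq_rev_iff[of "rev [x..<Suc y]" w] by (simp add: asc_def desc_def)

lemma asc_rev: "asc (rev w) x y \<longleftrightarrow> desc w x y"
  using desc_rev[of "rev w"] by simp

lemma subseq_middle: "subseq ys (xs @ ys @ zs)"
  by (intro subseq_drop_many subseq_rev_drop_many subseq_order.order_refl)

lemma upt_middle:
  assumes "x \<le> x'" "x' \<le> y'" "y' \<le> (y::nat)"
  shows "[x..<Suc y] = [x..<x'] @ [x'..<Suc y'] @ [Suc y'..<Suc y]"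
  using upt_add_eq_append[of x x' "Suc y - x'"] upt_add_eq_append[of x' "Suc y'" "y - y'"] assms
  by (simp del: upt_Suc)

lemma desc_sub: "desc w x y \<Longrightarrow> x \<le> x' \<Longrightarrow> x' \<le> y' \<Longrightarrow> y' \<le> y \<Longrightarrow> desc w x' y'"
  unfolding desc_def using upt_middle[of x x' y' y] subseq_middle by (metis subseq_order.order_trans)

lemma asc_sub: "asc w x y \<Longrightarrow> x \<le> x' \<Longrightarrow> x' \<le> y' \<Longrightarrow> y' \<le> y \<Longrightarrow> asc w x' y'"
  using desc_sub[of "rev w"] by (simp add: desc_rev)

lemma desc_mem: "desc w x y \<Longrightarrow> x \<le> k \<Longrightarrow> k \<le> y \<Longrightarrow> k \<in> set w"
  unfolding desc_def using subseq_mem[of "[x..<Suc y]" w k] by (simp add: less_Suc_eq_le del: upt_Suc)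

lemma asc_mem: "asc w x y \<Longrightarrow> x \<le> k \<Longrightarrow> k \<le> y \<Longrightarrow> k \<in> set w"
  using desc_mem[of "rev w"] by (simp add: desc_rev)

lemma asc_single: "asc w x x \<longleftrightarrow> x \<in> set w"
  by (simp add: asc_def subseq_singleton_left)

lemma desc_single: "desc w x x \<longleftrightarrow> x \<in> set w"
  by (simp add: desc_def subseq_singleton_left)

lemma subseq_join:
  "distinct w \<Longrightarrow> subseq (y # ys) w \<Longrightarrow> subseq [z, y] w \<Longrightarrow> z \<noteq> y \<Longrightarrow> subseq (z # y # ys) w"
proof (induction w)
  case (Cons a w)
  then show ?case by (auto simp: subseq_Cons2_iff subseq_singleton_left split: if_splits dest: subseq_mem[of _ w y])
qed simp

lemma asc_join:
  assumes "distinct w" "asc w x y" "asc w y (Suc y)"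
  shows "asc w x (Suc y)"
proof -
  have xy: "x \<le> y" using assms(2) by (simp add: asc_def)
  have "rev [y..<Suc (Suc y)] = [Suc y, y]" by simp
  then have "subseq [Suc y, y] w" using assms(3) by (simp only: asc_def)
  moreover have r: "rev [x..<Suc y] = y # rev [x..<y]" "rev [x..<Suc (Suc y)] = Suc y # y # rev [x..<y]" using xy by simp_all
  moreover have "subseq (y # rev [x..<y]) w" using assms(2) r by (simp only: asc_def)
  ultimately have "subseq (Suc y # y # rev [x..<y]) w" using subseq_join[OF assms(1)] by simp
  then show ?thesis unfolding asc_def r(2) using xy by simp
qed

lemma desc_join:
  assumes "distinct w" "desc w x y" "desc w y (Suc y)"
  shows "desc w x (Suc y)"
  using asc_join[of "rev w"] assms by (simp add: asc_rev)

lemma subseq_total: "a \<in> set w \<Longrightarrow> b \<in> set w \<Longrightarrow> a \<noteq> b \<Longrightarrow> subseq [a, b] w \<or> subseq [b, a] w"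
  by (induction w) (auto simp: subseq_Cons2_iff subseq_singleton_left)

lemma subseq_antisym2: "distinct w \<Longrightarrow> subseq [a, b] w \<Longrightarrow> subseq [b, a] w \<Longrightarrow> a = b"
  by (induction w) (auto simp: subseq_Cons2_iff subseq_singleton_left split: if_splits dest: subseq_mem)

lemma edge_cases: "x \<in> set w \<Longrightarrow> Suc x \<in> set w \<Longrightarrow> asc w x (Suc x) \<or> desc w x (Suc x)"
  using subseq_total[of x w "Suc x"] by (auto simp: asc_def desc_def)

lemma asc_desc: 
  assumes "distinct w" "asc w x y" "desc w x y"
  shows "x = y"
proof (rule ccontr)
  assume "x \<noteq> y"
  then have "Suc x \<le> y" using assms(2) by (simp add: asc_def)
  then have "asc w x (Suc x)" "desc w x (Suc x)" using asc_sub[OF assms(2)] desc_sub[OF assms(3)] by auto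
  then show False using subseq_antisym2[OF assms(1), of x "Suc x"] by (auto simp: asc_def desc_def)
qed

lemma inv_Sn: "p \<in> Sn n \<Longrightarrow> inv p \<in> Sn n"
  by (simp add: Sn_def permutes_inv)

lemma Sn_inv_eq: "p \<in> Sn n \<Longrightarrow> p (inv p k) = k" "p \<in> Sn n \<Longrightarrow> inv p (p k) = k"
  by (auto simp: Sn_def permutes_inverses)

lemma up_inv: "p \<in> Sn n \<Longrightarrow> up (inv p) x y \<longleftrightarrow> dn p x y"
  unfolding up_def dn_def by (metis Sn_inv_eq)

lemma dn_inv: "p \<in> Sn n \<Longrightarrow> dn (inv p) x y \<longleftrightarrow> up p x y"
  unfolding up_def dn_def by (metis Sn_inv_eq)

lemma wprod_rev: "valid_word n w \<Longrightarrow> wprod (rev w) = inv (wprod w)"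
proof (induction w)
  case Nil
  then show ?case by simp
next
  case (Cons a w)
  then have v: "valid_word n w" "1 \<le> a" "a < n" by (auto simp: valid_word_def)
  have "bij (sref a)" "bij (wprod w)" using sref_Sn[OF v(2,3)] wprod_Sn[OF v(1)] permutes_bij by (auto simp: Sn_def)
  moreover have "inv (sref a) = sref a" unfolding sref_def by simp
  ultimately have "inv (sref a \<circ> wprod w) = inv (wprod w) \<circ> sref a" by (simp add: o_inv_distrib)
  moreover have "wprod (rev (a # w)) = wprod (rev w) \<circ> sref a"
    unfolding rev.simps wprod_append wprod.simps comp_id ..
  ultimately show ?case unfolding wprod.simps(2) Cons.IH[OF v(1)] by (simp only:)
qed

text \<open>There are \<open>Suc y\<close> positions up to \<open>y\<close> and \<open>Suc x\<close>
  values up to \<open>x\<close>. Counting both, the positions up to \<open>y\<close> with values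
  above \<open>x\<close> exceed \<open>y - x\<close> by the number of later positions with values at
  most \<open>x\<close>.\<close>

lemma rk_dn:
  assumes p: "p \<in> Sn n" and xy: "x \<le> y"
  shows "rk p y x = (y - x) + card {k. y < k \<and> p k \<le> x}"
proof -
  have b: "bij p" using p permutes_bij by (auto simp: Sn_def)
  have fin: "finite {k. p k \<le> x}" and c: "card {k. p k \<le> x} = Suc x"
  proof -
    have "{k. p k \<le> x} = p -` {..x}" by auto
    then show "finite {k. p k \<le> x}" "card {k. p k \<le> x} = Suc x"
      using b by (simp_all add: finite_vimageI bij_is_inj card_vimage_inj bij_is_surj)
  qed
  define A where "A = {k. k \<le> y \<and> p k \<le> x}"
  define B where "B = {k. y < k \<and> p k \<le> x}"
  define C where "C = {k. k \<le> y \<and> x < p k}"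
  have AB: "{k. p k \<le> x} = A \<union> B" "A \<inter> B = {}" and CA: "{..y} = C \<union> A" "C \<inter> A = {}"
    by (auto simp: A_def B_def C_def)
  have "finite A" "finite B" using fin unfolding AB(1) by simp_all
  then have "Suc x = card A + card B" using c unfolding AB(1) by (simp add: card_Un_disjoint AB(2))
  moreover have "card {..y} = card C + card A"
    unfolding CA(1) by (rule card_Un_disjoint) (auto simp: A_def B_def C_def)
  moreover have "rk p y x = card C" by (simp add: rk_def C_def)
  ultimately show ?thesis using xy by (simp add: B_def)
qed

lemma rk_up_iff: "rk p x y = 0 \<longleftrightarrow> \<not> up p x y"
  unfolding rk_def up_def by (auto simp: not_less)

lemma rk_dn_iff:
  assumes p: "p \<in> Sn n" and xy: "x \<le> y"
  shows "rk p y x = y - x \<longleftrightarrow> \<not> dn p x y"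
proof -
  have "inj p" using Sn_inj[OF p] by (auto intro: injI)
  then have "finite (p -` {..x})" by (intro finite_vimageI) auto
  then have "finite {k. y < k \<and> p k \<le> x}" by (rule rev_finite_subset) auto
  then have "card {k. y < k \<and> p k \<le> x} = 0 \<longleftrightarrow> {k. y < k \<and> p k \<le> x} = {}" by (rule card_0_eq)
  then show ?thesis unfolding rk_dn[OF p xy] dn_def by simp
qed

lemma up_dn_diag: "p \<in> Sn n \<Longrightarrow> up p x x \<longleftrightarrow> dn p x x"
  using rk_up_iff[of p x x] rk_dn_iff[of p n x x] by simp

lemma missing_runs_iff:
  assumes "p \<in> Sn n"
  shows "C \<in> missing_runs w p \<longleftrightarrow>
    (\<exists>x y. C = {x..y} \<and> (asc w x y \<and> \<not> up p x y \<or> desc w x y \<and> \<not> dn p x y))"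
proof
  assume "C \<in> missing_runs w p"
  then show "\<exists>x y. C = {x..y} \<and> (asc w x y \<and> \<not> up p x y \<or> desc w x y \<and> \<not> dn p x y)"
  proof (cases rule: missing_runs_cases)
    case (1 i j)
    then show ?thesis using rk_up_iff by (intro exI[of _ i] exI[of _ j]) (simp add: asc_def del: upt_Suc)
  next
    case (2 i j)
    then show ?thesis using rk_dn_iff[OF assms] by (intro exI[of _ i] exI[of _ j]) (simp add: desc_def del: upt_Suc)
  qed
next
  assume "\<exists>x y. C = {x..y} \<and> (asc w x y \<and> \<not> up p x y \<or> desc w x y \<and> \<not> dn p x y)"
  then obtain x y where xy: "C = {x..y}" "asc w x y \<and> \<not> up p x y \<or> desc w x y \<and> \<not> dn p x y" by blast
  from xy(2) show "C \<in> missing_runs w p"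
  proof
    assume "asc w x y \<and> \<not> up p x y"
    then show ?thesis using missing_runs_ascI[of x y w p] rk_up_iff[of p x y] xy(1) by (simp add: asc_def del: upt_Suc)
  next
    assume "desc w x y \<and> \<not> dn p x y"
    then show ?thesis using missing_runs_descI[of x y w p] rk_dn_iff[OF assms, of x y] xy(1) by (simp add: desc_def del: upt_Suc)
  qed
qed

section \<open>Inversions of a boolean permutation\<close>

locale boolean_word =
  fixes n :: nat and w :: "nat list"
  assumes d: "distinct w" and val: "valid_word n w"
begin

abbreviation "v \<equiv> wprod w"

lemma vS: "v \<in> Sn n" by (rule wprod_Sn[OF val])

text \<open>The symmetry of the argument: \<open>rev w\<close> has product \<open>inv v\<close>, and
  interpreting the locale for it turns results on ascending runs into results on descending ones.
  The context is reopened at several places so that the interpretation contains what has been proved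
  before.\<close>

lemma boolean_word_rev: "boolean_word n (rev w)"
  using d val by unfold_locales (auto simp: valid_word_def)

lemma rk_v_up: "x \<le> y \<Longrightarrow> rk v x y = of_bool (asc w x y)"
  using rk_wprod[OF d valid_word_zero[OF val], of x y] by (simp add: asc_def del: upt_Suc)

lemma up_v: "x \<le> y \<Longrightarrow> up v x y \<longleftrightarrow> asc w x y"
  using rk_up_iff[of v x y] rk_v_up[of x y] by auto

lemma up_v_unique:
  assumes "x \<le> y" "k \<le> x" "y < v k" "k' \<le> x" "y < v k'"
  shows "k = k'"
proof -
  have "card {k. k \<le> x \<and> y < v k} \<le> Suc 0" using rk_v_up[OF assms(1)] by (simp add: rk_def)
  then have "\<forall>a\<in>{k. k \<le> x \<and> y < v k}. \<forall>b\<in>{k. k \<le> x \<and> y < v k}. a = b"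
    by (subst (asm) card_le_Suc0_iff_eq) auto
  then show ?thesis using assms by blast
qed

end

context boolean_word
begin

interpretation rev: boolean_word n "rev w" by (rule boolean_word_rev)

lemma v_rev: "wprod (rev w) = inv v" by (rule wprod_rev[OF val])

lemma dn_v: "x \<le> y \<Longrightarrow> dn v x y \<longleftrightarrow> desc w x y"
  using rev.up_v[of x y] unfolding v_rev up_inv[OF vS] asc_rev .

lemma dn_v_unique:
  assumes "x \<le> y" "y < k" "v k \<le> x" "y < k'" "v k' \<le> x"
  shows "k = k'"
proof -
  have "v k = v k'"
    using rev.up_v_unique[OF assms(1), of "v k" "v k'"] assms by (simp add: v_rev Sn_inv_eq[OF vS])
  then show ?thesis using Sn_inj[OF vS] by simp
qed

text \<open>Otherwise either \<open>k\<close> and \<open>l\<close>, both above \<open>k - 1\<close>,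
  are carried down to \<open>v k\<close> or below, against \<open>dn_v_unique\<close>, or
  \<open>k\<close> is a fixed point passed in both directions, and the run from \<open>k - 1\<close>
  to \<open>k\<close> would be ascending and descending at once. The dual statement makes
  \<open>l\<close> deficient, so no position can be the middle of a decreasing triple.\<close>

lemma inversion_exceeds:
  assumes kl: "k < l" "v l < v k"
  shows "k < v k"
proof (rule ccontr)
  assume "\<not> k < v k"
  then consider "v k < k" | "v k = k" by linarith
  then show False
  proof cases
    case 1
    have "k = l" by (rule dn_v_unique[of "v k" "k - 1"]) (use 1 kl in auto)
    then show False using kl by simp
  next
    case 2
    then have vl: "v l \<le> k - 1" and k: "0 < k" using kl by auto
    have "dn v (k - 1) (k - 1)" unfolding dn_def using vl kl by (intro exI[of _ l]) auto
    then obtain m where m: "m \<le> k - 1" "k - 1 < v m" using up_dn_diag[OF vS] unfolding up_def by blast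
    have "v m \<noteq> v k" using m k Sn_inj[OF vS] by auto
    then have "up v (k - 1) k" unfolding up_def using m 2 by (intro exI[of _ m]) auto
    then have "asc w (k - 1) k" using up_v[of "k - 1" k] by simp
    moreover have "dn v (k - 1) k" unfolding dn_def using vl kl by (intro exI[of _ l]) auto
    then have "desc w (k - 1) k" using dn_v[of "k - 1" k] by simp
    ultimately show False using asc_desc[OF d, of "k - 1" k] k by simp
  qed
qed

end

context boolean_word
begin

interpretation rev: boolean_word n "rev w" by (rule boolean_word_rev)

lemma inversion_deficient: "k < l \<Longrightarrow> v l < v k \<Longrightarrow> v l < l"
  using rev.inversion_exceeds[of "v l" "v k"] by (simp add: v_rev Sn_inv_eq[OF vS])

lemma no_321: "i < j \<Longrightarrow> j < k \<Longrightarrow> \<not> (v k < v j \<and> v j < v i)"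
  using inversion_exceeds[of j k] inversion_deficient[of i j] by auto

definition run :: "nat \<Rightarrow> nat \<Rightarrow> bool" where
  "run x y \<longleftrightarrow> asc w x y \<or> desc w x y"

lemma run_sub: "run x y \<Longrightarrow> x \<le> x' \<Longrightarrow> x' \<le> y' \<Longrightarrow> y' \<le> y \<Longrightarrow> run x' y'"
  unfolding run_def using asc_sub desc_sub by blast

lemma run_mem: "run x y \<Longrightarrow> x \<le> k \<Longrightarrow> k \<le> y \<Longrightarrow> k \<in> set w"
  unfolding run_def using asc_mem desc_mem by blast

lemma run_le: "run x y \<Longrightarrow> x \<le> y"
  by (auto simp: run_def asc_def desc_def)

lemma run_single: "run x x \<longleftrightarrow> x \<in> set w"
  by (simp add: run_def asc_single desc_single)

lemma run_edge: "x \<in> set w \<Longrightarrow> Suc x \<in> set w \<Longrightarrow> run x (Suc x)"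
  unfolding run_def by (rule edge_cases)

lemma mem_bounds: "x \<in> set w \<Longrightarrow> 1 \<le> x \<and> x < n"
  using val by (auto simp: valid_word_def)

end

section \<open>Greedy covers by monotone runs\<close>


text \<open>
  A permutation of \<open>{s..Suc z}\<close> above the cycles of all proper subintervals of \<open>{s..z}\<close>, but not above
  the ascending cycle of \<open>{s..z}\<close> itself.
\<close>

definition asc_perm :: "nat \<Rightarrow> nat \<Rightarrow> nat \<Rightarrow> nat" where
  "asc_perm s z k = (if k < s then k else if k = s then z else if k = Suc s then Suc z
     else if k \<le> Suc z then k - 2 else k)"

lemma asc_perm_Sn:
  assumes "1 \<le> s" "s < z"
  shows "asc_perm s z \<in> Sn (Suc z)"
  unfolding Sn_def
proof (intro CollectI bij_imp_permutes)
  let ?g = "\<lambda>k. if k < s then k else if k < z then k + 2 else if k = z then s else if k = Suc z then Suc s else k"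
  show "bij_betw (asc_perm s z) {1..Suc z} {1..Suc z}"
    by (rule bij_betw_byWitness[where f' = ?g]) (use assms in \<open>auto simp: asc_perm_def\<close>)
qed (use assms in \<open>auto simp: asc_perm_def\<close>)

lemma Sn_mono: "m \<le> n \<Longrightarrow> p \<in> Sn m \<Longrightarrow> p \<in> Sn n"
  unfolding Sn_def by (auto intro: permutes_subset)

lemma fix_le_iff:
  assumes "Q \<in> Sn N" "\<And>k. k \<le> m \<Longrightarrow> Q k = k" "d \<le> m"
  shows "Q j \<le> d \<longleftrightarrow> j \<le> d"
proof
  assume "Q j \<le> d"
  then have "Q (Q j) = Q j" using assms by simp
  then have "Q j = j" using Sn_inj[OF assms(1)] by simp
  then show "j \<le> d" using \<open>Q j \<le> d\<close> by simp
next
  assume "j \<le> d"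
  then show "Q j \<le> d" using assms by simp
qed

lemma up_comp_right: "(\<And>k. k \<le> m \<Longrightarrow> Q k = k) \<Longrightarrow> d1 \<le> m \<Longrightarrow> up (P \<circ> Q) d1 d2 \<longleftrightarrow> up P d1 d2"
  unfolding up_def by auto

lemma dn_comp_right:
  assumes "Q \<in> Sn N" "\<And>k. k \<le> m \<Longrightarrow> Q k = k" "d2 \<le> m"
  shows "dn (P \<circ> Q) d1 d2 \<longleftrightarrow> dn P d1 d2"
proof
  assume "dn (P \<circ> Q) d1 d2"
  then obtain k where "d2 < k" "P (Q k) \<le> d1" by (auto simp: dn_def)
  then show "dn P d1 d2" unfolding dn_def using fix_le_iff[OF assms, of k] by (intro exI[of _ "Q k"]) auto
next
  assume "dn P d1 d2"
  then obtain k where "d2 < k" "P k \<le> d1" by (auto simp: dn_def)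
  then show "dn (P \<circ> Q) d1 d2" unfolding dn_def using fix_le_iff[OF assms, of "inv Q k"] Sn_inv_eq[OF assms(1)]
    by (intro exI[of _ "inv Q k"]) auto
qed

lemma up_comp_left:
  assumes "Q \<in> Sn N" "\<And>k. k \<le> m \<Longrightarrow> Q k = k" "d2 \<le> m"
  shows "up (Q \<circ> P) d1 d2 \<longleftrightarrow> up P d1 d2"
  unfolding up_def using fix_le_iff[OF assms] by (auto simp: not_le[symmetric])

lemma dn_comp_left:
  assumes "Q \<in> Sn N" "\<And>k. k \<le> m \<Longrightarrow> Q k = k" "d1 \<le> m"
  shows "dn (Q \<circ> P) d1 d2 \<longleftrightarrow> dn P d1 d2"
  unfolding dn_def using fix_le_iff[OF assms] by auto

context boolean_word
begin

text \<open>That no run contains two starting points makes the cover minimal and also separates the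
  inversions counted for the a-function. The last clause concerns a block ending at \<open>m\<close>
  with a letter following at once: it has at least two letters and could not be prolonged, so the
  direction changes at \<open>m\<close>.\<close>

definition cover_state :: "nat \<Rightarrow> (nat \<times> nat) set \<Rightarrow> bool" where
  "cover_state m Cs \<longleftrightarrow> finite Cs \<and> (\<forall>x y. (x, y) \<in> Cs \<longrightarrow> run x y \<and> y \<le> m) \<and>
     (\<forall>k\<in>set w. k \<le> m \<longrightarrow> (\<exists>x y. (x, y) \<in> Cs \<and> x \<le> k \<and> k \<le> y)) \<and>
     (\<forall>x y x' y'. (x, y) \<in> Cs \<longrightarrow> (x', y') \<in> Cs \<longrightarrow> x \<le> x' \<longrightarrow> x' \<le> y \<longrightarrow> x = x' \<and> y = y') \<and>
     (\<forall>x y x' y'. (x, y) \<in> Cs \<longrightarrow> (x', y') \<in> Cs \<longrightarrow> x < x' \<longrightarrow> \<not> run x x') \<and>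
     (m \<in> set w \<longrightarrow> Suc m \<in> set w \<longrightarrow> (\<exists>x<m. (x, m) \<in> Cs \<and> \<not> run x (Suc m)))"

lemma cover_stateD:
  assumes "cover_state m Cs"
  shows "finite Cs" "(x, y) \<in> Cs \<Longrightarrow> run x y" "(x, y) \<in> Cs \<Longrightarrow> y \<le> m" "(x, y) \<in> Cs \<Longrightarrow> x \<le> y"
    "k \<in> set w \<Longrightarrow> k \<le> m \<Longrightarrow> \<exists>x y. (x, y) \<in> Cs \<and> x \<le> k \<and> k \<le> y"
    "(x, y) \<in> Cs \<Longrightarrow> (x', y') \<in> Cs \<Longrightarrow> x \<le> x' \<Longrightarrow> x' \<le> y \<Longrightarrow> x = x' \<and> y = y'"
    "(x, y) \<in> Cs \<Longrightarrow> (x', y') \<in> Cs \<Longrightarrow> x < x' \<Longrightarrow> \<not> run x x'"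
    "m \<in> set w \<Longrightarrow> Suc m \<in> set w \<Longrightarrow> \<exists>x<m. (x, m) \<in> Cs \<and> \<not> run x (Suc m)"
proof -
  show "(x, y) \<in> Cs \<Longrightarrow> x \<le> y" using assms run_le unfolding cover_state_def by blast
  show "(x, y) \<in> Cs \<Longrightarrow> (x', y') \<in> Cs \<Longrightarrow> x < x' \<Longrightarrow> \<not> run x x'"
    using assms unfolding cover_state_def by (elim conjE) blast
  show "m \<in> set w \<Longrightarrow> Suc m \<in> set w \<Longrightarrow> \<exists>x<m. (x, m) \<in> Cs \<and> \<not> run x (Suc m)"
    using assms unfolding cover_state_def by (elim conjE) blast
qed (use assms in \<open>unfold cover_state_def, (elim conjE, simp)+\<close>)

text \<open>
  The last condition keeps the runs that start at \<open>m\<close> and continue into the next block below the permutation.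
\<close>

definition perm_state :: "nat \<Rightarrow> (nat \<times> nat) set \<Rightarrow> (nat \<Rightarrow> nat) \<Rightarrow> bool" where
  "perm_state m Cs P \<longleftrightarrow> P \<in> Sn (Suc m) \<and>
     (\<forall>x y. (x, y) \<in> Cs \<longrightarrow> (asc w x y \<longrightarrow> \<not> up P x y) \<and> (desc w x y \<longrightarrow> \<not> dn P x y)) \<and>
     (\<forall>a b. b \<le> m \<longrightarrow> (\<forall>x y. (x, y) \<in> Cs \<longrightarrow> \<not> (a \<le> x \<and> y \<le> b)) \<longrightarrow>
        (asc w a b \<longrightarrow> up P a b) \<and> (desc w a b \<longrightarrow> dn P a b)) \<and>
     (m \<in> set w \<longrightarrow> Suc m \<in> set w \<longrightarrow> P (Suc m) \<noteq> Suc m)"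

end

locale greedy_step = boolean_word +
  fixes m :: nat and Cs and s z :: nat
  assumes cov: "cover_state m Cs" and s: "s \<in> set w" "m < s" and gap: "\<And>k. m < k \<Longrightarrow> k < s \<Longrightarrow> k \<notin> set w"
    and z: "run s z" "\<not> run s (Suc z)"
begin

lemma sz: "s \<le> z" using z(1) by (rule run_le)

text \<open>If all letters from \<open>a\<close> up to \<open>s\<close> are present, there is no gap
  between \<open>m\<close> and \<open>s\<close>, so the new block is adjacent to the previous one
  and the last clause of \<open>cover_state\<close> applies.\<close>

lemma junction:
  assumes "a < s" "a \<le> m \<or> a \<in> set w" "\<And>k. a \<le> k \<Longrightarrow> k \<le> s \<Longrightarrow> k \<in> set w"
  obtains x where "s = Suc m" "m \<in> set w" "a \<le> m" "x < m" "(x, m) \<in> Cs" "\<not> run x (Suc m)"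
proof -
  have am: "a \<le> m" using assms gap[of a] by force
  have "Suc m \<in> set w" "m \<in> set w" using assms(3)[of "Suc m"] assms(3)[of m] am s(2) by auto
  then have "s = Suc m" using gap[of "Suc m"] s(2) by (metis lessI linorder_neqE_nat not_less_eq)
  then show ?thesis using that am cover_stateD(8)[OF cov \<open>m \<in> set w\<close> \<open>Suc m \<in> set w\<close>] \<open>m \<in> set w\<close> by blast
qed

lemma cover_step: "cover_state z (insert (s, z) Cs)"
  unfolding cover_state_def
proof (intro conjI allI impI ballI)
  show "finite (insert (s, z) Cs)" using cover_stateD(1)[OF cov] by simp
next
  fix x y assume "(x, y) \<in> insert (s, z) Cs"
  then show "run x y" "y \<le> z" using z(1) cover_stateD(2,3)[OF cov, of x y] s(2) sz by auto
next
  fix k assume k: "k \<in> set w" "k \<le> z"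
  show "\<exists>x y. (x, y) \<in> insert (s, z) Cs \<and> x \<le> k \<and> k \<le> y"
  proof (cases "k \<le> m")
    case True
    then show ?thesis using cover_stateD(5)[OF cov k(1)] by blast
  next
    case False
    then have "s \<le> k" using gap[of k] k(1) by force
    then show ?thesis using k by blast
  qed
next
  fix x y x' y' assume *: "(x, y) \<in> insert (s, z) Cs" "(x', y') \<in> insert (s, z) Cs" "x \<le> x'" "x' \<le> y"
  have o: "b \<le> m" "a \<le> b" if "(a, b) \<in> Cs" for a b using cover_stateD(3,4)[OF cov that] .
  have "x = x' \<and> y = y'"
  proof (cases "(x, y) = (s, z)"; cases "(x', y') = (s, z)")
    assume "(x, y) = (s, z)" "(x', y') \<noteq> (s, z)"
    then show ?thesis using * o[of x' y'] s(2) by auto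
  next
    assume "(x, y) \<noteq> (s, z)" "(x', y') = (s, z)"
    then show ?thesis using * o[of x y] s(2) by auto
  next
    assume "(x, y) \<noteq> (s, z)" "(x', y') \<noteq> (s, z)"
    then have "(x, y) \<in> Cs" "(x', y') \<in> Cs" using *(1,2) by auto
    then show ?thesis by (rule cover_stateD(6)[OF cov _ _ *(3,4)])
  qed simp
  then show "x = x'" "y = y'" by auto
next
  fix x y x' y' assume *: "(x, y) \<in> insert (s, z) Cs" "(x', y') \<in> insert (s, z) Cs" "x < x'"
  have o: "b \<le> m" "a \<le> b" if "(a, b) \<in> Cs" for a b using cover_stateD(3,4)[OF cov that] .
  show "\<not> run x x'"
  proof (cases "(x', y') = (s, z)")
    case False
    then have 1: "(x', y') \<in> Cs" using *(2) by (metis insert_iff)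
    have "x \<noteq> s" using *(3) o[OF 1] s(2) by simp
    then have "(x, y) \<in> Cs" using *(1) by simp
    then show ?thesis by (rule cover_stateD(7)[OF cov _ 1 *(3)])
  next
    case True
    then have xy: "(x, y) \<in> Cs" using * by auto
    then have 1: "(x, y) \<in> Cs" "x' = s" "x \<le> m" using o[OF xy] True by auto
    show ?thesis
    proof
      \<comment> \<open>Such a run would contain the last block from its start \<open>x0\<close>
        together with the letter \<open>Suc m\<close>, against maximality, unless \<open>x\<close>
        lies inside that block after \<open>x0\<close>, against disjointness.\<close>
      assume r: "run x x'"
      obtain x0 where x0: "s = Suc m" "x0 < m" "(x0, m) \<in> Cs" "\<not> run x0 (Suc m)"
        using junction[of x] run_mem[OF r] * 1 by metis
      show False
      proof (cases "x \<le> x0")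
        case True
        then have "run x0 (Suc m)" using run_sub[OF r, of x0 "Suc m"] 1 x0 by simp
        then show False using x0 by simp
      next
        case False
        then show False using cover_stateD(6)[OF cov x0(3) 1(1)] 1(3) by simp
      qed
    qed
  qed
next
  assume e: "z \<in> set w" "Suc z \<in> set w"
  have "s \<noteq> z" using run_edge[OF e] z(2) by auto
  then show "\<exists>x<z. (x, z) \<in> insert (s, z) Cs \<and> \<not> run x (Suc z)" using sz z(2) by (intro exI[of _ s]) auto
qed

text \<open>Only the third case crosses between blocks. The last old block has at least two letters
  and cannot be prolonged by \<open>Suc m\<close>, so the direction changes at \<open>m\<close>, and
  a run across the junction that contains no block has to start at \<open>m\<close>.\<close>

lemma new_run_cases:
  assumes ab: "run a b" and b: "b \<le> z" and no: "\<And>x y. (x, y) \<in> insert (s, z) Cs \<Longrightarrow> \<not> (a \<le> x \<and> y \<le> b)"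
  obtains "b \<le> m" | "s \<le> a" "s < a \<or> b < z" | "s = Suc m" "m \<in> set w" "a = m" "s \<le> b" "b < z"
proof (cases "b \<le> m")
  case False
  have "b \<in> set w" using run_mem[OF ab] run_le[OF ab] by blast
  then have sb: "s \<le> b" using gap[of b] False by force
  have nz: "\<not> (a \<le> s \<and> z \<le> b)" using no by blast
  show ?thesis
  proof (cases "s \<le> a")
    case True
    then show ?thesis using that(2) nz by force
  next
    case as: False
    then have bz: "b < z" using nz by auto
    have mem: "k \<in> set w" if "a \<le> k" "k \<le> s" for k using run_mem[OF ab] that sb by simp
    obtain x0 where x0: "s = Suc m" "m \<in> set w" "a \<le> m" "x0 < m" "(x0, m) \<in> Cs" "\<not> run x0 (Suc m)"
      using junction[of a] as mem by (metis linorder_not_less order_refl less_imp_le)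
    have "\<not> a \<le> x0" using no[of x0 m] x0 sb by auto
    have "a = m"
    proof (rule ccontr)
      assume "a \<noteq> m"
      then have am: "a \<le> m - 1" "x0 \<le> m - 1" "m - 1 < m" using x0 by auto
      have r0: "run x0 m" by (rule cover_stateD(2)[OF cov x0(5)])
      from ab show False unfolding run_def
      proof
        assume D: "asc w a b"
        have e: "asc w (m - 1) m" "asc w m (Suc m)" using asc_sub[OF D] am x0 sb by auto
        from r0 show False unfolding run_def
        proof
          assume "asc w x0 m"
          then show False using asc_join[OF d _ e(2)] x0(6) by (simp add: run_def)
        next
          assume "desc w x0 m"
          then have "desc w (m - 1) m" by (rule desc_sub) (use am in auto)
          then show False using asc_desc[OF d e(1)] am by simp
        qed
      next
        assume D: "desc w a b"
        have e: "desc w (m - 1) m" "desc w m (Suc m)" using desc_sub[OF D] am x0 sb by auto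
        from r0 show False unfolding run_def
        proof
          assume "desc w x0 m"
          then show False using desc_join[OF d _ e(2)] x0(6) by (simp add: run_def)
        next
          assume "asc w x0 m"
          then have "asc w (m - 1) m" by (rule asc_sub) (use am in auto)
          then show False using asc_desc[OF d _ e(1)] am by simp
        qed
      qed
    qed
    then show ?thesis using that(3) x0 sb bz by blast
  qed
qed (use that in blast)

text \<open>A one-letter block needs no new factor, since \<open>P\<close> carries no point across
  \<open>s\<close>. For a longer block \<open>P\<close> is multiplied by
  \<open>asc_perm s z\<close>, and the side is dictated by the junction with the previous
  block.\<close>

lemma perm_step_asc:
  assumes P: "perm_state m Cs P" and az: "asc w s z"
  shows "\<exists>P'. perm_state z (insert (s, z) Cs) P'"
proof -
  have PS: "P \<in> Sn (Suc m)" using P by (simp add: perm_state_def)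
  have Pe: "(asc w x y \<longrightarrow> \<not> up P x y) \<and> (desc w x y \<longrightarrow> \<not> dn P x y)" if "(x, y) \<in> Cs" for x y
    using P that unfolding perm_state_def by blast
  have Pf: "(asc w a b \<longrightarrow> up P a b) \<and> (desc w a b \<longrightarrow> dn P a b)"
    if "b \<le> m" "\<And>x y. (x, y) \<in> insert (s, z) Cs \<Longrightarrow> \<not> (a \<le> x \<and> y \<le> b)" for a b
    using P that unfolding perm_state_def by blast
  have Pm: "P (Suc m) \<noteq> Suc m" if "s = Suc m" "m \<in> set w" using P that s(1) unfolding perm_state_def by blast
  have Pfix: "P k = k" if "Suc m < k" for k using Sn_outside[OF PS] that by blast
  have Ple: "P k \<le> Suc m" if "k \<le> Suc m" for k
    using Sn_range[OF PS, of k] Sn_outside[OF PS, of k] that by (cases "k = 0") auto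
  have PSz: "P \<in> Sn (Suc z)" by (rule Sn_mono[OF _ PS]) (use s(2) sz in simp)
  have s1: "1 \<le> s" using mem_bounds[OF s(1)] by simp
  have old: "x \<le> m \<and> y \<le> m" if "(x, y) \<in> Cs" for x y using cover_stateD(3,4)[OF cov that] by simp
  show ?thesis
  proof (cases "s = z")
    case True
    have "\<not> up P s s" unfolding up_def using Ple Pfix s(2) by (metis Suc_leI leD le_less_linear le_trans)
    then have ns: "\<not> up P s s \<and> \<not> dn P s s" using up_dn_diag[OF PS] by blast
    have "perm_state z (insert (s, z) Cs) P" unfolding perm_state_def
    proof (intro conjI allI impI)
      show "P \<in> Sn (Suc z)" by (rule PSz)
      show "\<not> up P x y" if "(x, y) \<in> insert (s, z) Cs" "asc w x y" for x y using that ns Pe True by auto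
      show "\<not> dn P x y" if "(x, y) \<in> insert (s, z) Cs" "desc w x y" for x y using that ns Pe True by auto
      have bm: "b \<le> m" if r: "run a b" and b: "b \<le> z" and no: "\<And>x y. (x, y) \<in> insert (s, z) Cs \<Longrightarrow> \<not> (a \<le> x \<and> y \<le> b)" for a b
        using r b no
      proof (rule new_run_cases)
        assume "s \<le> a" "s < a \<or> b < z"
        then show ?thesis using True run_le[OF r] b by simp
      next
        assume "s \<le> b" "b < z"
        then show ?thesis using True by simp
      qed
      fix a b
      assume b: "b \<le> z" and no: "\<forall>x y. (x, y) \<in> insert (s, z) Cs \<longrightarrow> \<not> (a \<le> x \<and> y \<le> b)"
      have no': "\<not> (a \<le> x \<and> y \<le> b)" if "(x, y) \<in> insert (s, z) Cs" for x y using no that by blast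
      show "up P a b" if D: "asc w a b"
      proof -
        have "b \<le> m" by (rule bm[OF _ b no']) (use D in \<open>simp add: run_def\<close>)
        then show ?thesis using Pf[OF _ no'] D by blast
      qed
      show "dn P a b" if D: "desc w a b"
      proof -
        have "b \<le> m" by (rule bm[OF _ b no']) (use D in \<open>simp add: run_def\<close>)
        then show ?thesis using Pf[OF _ no'] D by blast
      qed
    next
      \<comment> \<open>Vacuous: two adjacent letters form a run, so the block could be
        prolonged.\<close>
      show "P (Suc z) \<noteq> Suc z" if "z \<in> set w" "Suc z \<in> set w"
        using run_edge[OF that] z(2) True by simp
    qed
    then show ?thesis by blast
  next
    case False
    then have lt: "s < z" using sz by simp
    define Q where "Q = asc_perm s z"
    have QS: "Q \<in> Sn (Suc z)" unfolding Q_def by (rule asc_perm_Sn[OF s1 lt])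
    have Qfix: "Q k = k" if "k \<le> m" for k using that s(2) by (simp add: Q_def asc_perm_def)
    have Qv: "Q s = z" "Q (Suc s) = Suc z" "Q (Suc z) = z - 1" "Q (Suc (Suc s)) = s"
      "\<And>k. k < s \<Longrightarrow> Q k = k"
      using lt by (auto simp: Q_def asc_perm_def)
    have nd: "\<not> desc w s z" using asc_desc[OF d az] lt by blast
    have sub_asc: "asc w a b" if "run a b" "s \<le> a" "b \<le> z" for a b
      using asc_sub[OF az that(2) run_le[OF that(1)] that(3)] .
    \<comment> \<open>At an adjacent junction \<open>P\<close> moves \<open>s = Suc m\<close>. In
      \<open>Q \<circ> P\<close> the point that \<open>P\<close> sends to \<open>s\<close> is
      carried on to \<open>z\<close>, which serves ascending runs from \<open>m\<close>; in
      \<open>P \<circ> Q\<close> the point that \<open>Q\<close> sends to \<open>s\<close> is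
      carried on below \<open>s\<close>, which serves a descending one. The two directions cannot
      both occur.\<close>
    define P' where "P' = (if s = Suc m \<and> m \<in> set w \<and> asc w m s then Q \<circ> P else P \<circ> Q)"
    have PT: "P' = Q \<circ> P" if "s = Suc m \<and> m \<in> set w \<and> asc w m s"
      unfolding P'_def by (rule if_P[OF that])
    have PF: "P' = P \<circ> Q" if "\<not> (s = Suc m \<and> m \<in> set w \<and> asc w m s)"
      unfolding P'_def by (rule if_not_P[OF that])
    have P'S: "P' \<in> Sn (Suc z)" unfolding P'_def using Sn_comp[OF QS PSz] Sn_comp[OF PSz QS] by simp
    have up_old: "up P' a b \<longleftrightarrow> up P a b" and dn_old: "dn P' a b \<longleftrightarrow> dn P a b" if "a \<le> m" "b \<le> m" for a b
      unfolding P'_def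
      using up_comp_left[OF QS Qfix that(2)] up_comp_right[OF Qfix that(1)]
        dn_comp_left[OF QS Qfix that(1)] dn_comp_right[OF QS Qfix that(2)] by simp_all
    have Pk: "P k \<le> s" if "k \<le> s" for k
      using Ple[of k] Pfix[of k] s(2) that by (cases "k \<le> Suc m") auto
    have new_C: "\<not> up P' s z"
    proof
      assume "up P' s z"
      then obtain k where k: "k \<le> s" "z < P' k" by (auto simp: up_def)
      show False
      proof (cases "s = Suc m \<and> m \<in> set w \<and> asc w m s")
        case True
        have "z < Q (P k)" using k(2) unfolding PT[OF True] by simp
        moreover have "P k \<le> s" by (rule Pk[OF k(1)])
        ultimately show False using Qv(1) Qv(5)[of "P k"] lt by (cases "P k = s") auto
      next
        case False
        have zk: "z < P (Q k)" using k(2) unfolding PF[OF False] by simp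
        have "P z = z" using Pfix lt s(2) by simp
        then show False using zk Pk[of k] Qv(1) Qv(5)[of k] k(1) lt by (cases "k = s") auto
      qed
    qed
    have sub_up: "up P' a b" if "s < a \<and> b \<le> z \<or> s \<le> a \<and> b < z" for a b
    proof -
      have 1: "P' (Suc s) = Suc z" if "s \<le> z"
      proof -
        have "P (Suc s) = Suc s" "P (Suc z) = Suc z" using Pfix s(2) lt by auto
        then show ?thesis using Qv(2) PT PF by (metis comp_apply)
      qed
      have 2: "\<exists>k\<le>s. P' k = z"
      proof (cases "s = Suc m \<and> m \<in> set w \<and> asc w m s")
        case True
        have "P (inv P s) = s" by (rule Sn_inv_eq[OF PS])
        moreover have "inv P s \<le> s"
          using Sn_range[OF inv_Sn[OF PS], of s] True by simp
        ultimately show ?thesis unfolding PT[OF True] using Qv(1) by (intro exI[of _ "inv P s"]) simp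
      next
        case False
        have "P' s = P (Q s)" unfolding PF[OF False] by simp
        then show ?thesis using Qv(1) Pfix[of z] s(2) lt by (intro exI[of _ s]) simp
      qed
      show ?thesis
      proof (cases "s < a")
        case True
        then show ?thesis unfolding up_def using 1 lt that by (intro exI[of _ "Suc s"]) auto
      next
        case False
        then have "s \<le> a" "b < z" using that by auto
        moreover obtain k where "k \<le> s" "P' k = z" using 2 by blast
        ultimately show ?thesis unfolding up_def by (intro exI[of _ k]) simp
      qed
    qed
    have junc_asc: "up P' m b" if j: "s = Suc m" "m \<in> set w" and "b < z" "asc w m b" "s \<le> b" for b
    proof -
      have "asc w m s" using asc_sub[OF that(4), of m s] j that(5) by simp
      then have P': "P' = Q \<circ> P" using j by (intro PT) simp
      have e: "P (inv P s) = s" by (rule Sn_inv_eq[OF PS])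
      have "inv P s \<noteq> s" using Pm[OF j] e j by auto
      moreover have "inv P s \<le> s" using Sn_range[OF inv_Sn[OF PS], of s] j by simp
      ultimately have "inv P s \<le> m" using j by simp
      then show ?thesis unfolding up_def P' using e Qv(1) that(3) by (intro exI[of _ "inv P s"]) simp
    qed
    have junc_desc: "dn P' m b" if j: "s = Suc m" "m \<in> set w" and "b < z" "desc w m b" "s \<le> b" for b
    proof -
      have ds: "desc w m s" using desc_sub[OF that(4), of m s] j that(5) by simp
      then have "\<not> asc w m s" using asc_desc[OF d, of m s] j by auto
      then have P': "P' = P \<circ> Q" by (intro PF) simp
      \<comment> \<open>The block ascends, so a descending run starting at \<open>m\<close> cannot
        go beyond \<open>s\<close>.\<close>
      have "b = s"
      proof (rule ccontr)
        assume "b \<noteq> s"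
        then have "desc w s (Suc s)" using desc_sub[OF that(4), of s "Suc s"] j that(5) by simp
        moreover have "asc w s (Suc s)" using asc_sub[OF az, of s "Suc s"] lt by simp
        ultimately show False using asc_desc[OF d] by (metis n_not_Suc_n)
      qed
      moreover have "P (Suc m) \<le> m" using Pm[OF j] Ple[of "Suc m"] by simp
      ultimately show ?thesis unfolding dn_def P' using Qv(4) j by (intro exI[of _ "Suc (Suc s)"]) simp
    qed
    have "perm_state z (insert (s, z) Cs) P'" unfolding perm_state_def
    proof (intro conjI allI impI)
      show "P' \<in> Sn (Suc z)" by (rule P'S)
      show "\<not> up P' x y" if "(x, y) \<in> insert (s, z) Cs" "asc w x y" for x y
        using that new_C Pe old[of x y] up_old by auto
      show "\<not> dn P' x y" if "(x, y) \<in> insert (s, z) Cs" "desc w x y" for x y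
        using that nd Pe old[of x y] dn_old by auto
    next
      fix a b assume b: "b \<le> z" and no: "\<forall>x y. (x, y) \<in> insert (s, z) Cs \<longrightarrow> \<not> (a \<le> x \<and> y \<le> b)" and D: "asc w a b"
      then have r: "run a b" by (simp add: run_def)
      from r b show "up P' a b"
      proof (rule new_run_cases)
        show "\<not> (a \<le> x \<and> y \<le> b)" if "(x, y) \<in> insert (s, z) Cs" for x y using no that by blast
      next
        assume "b \<le> m"
        then show ?thesis using Pf[of b a] no D up_old[of a b] run_le[OF r] by simp
      next
        assume "s \<le> a" "s < a \<or> b < z"
        then show ?thesis using sub_up b by blast
      next
        assume "s = Suc m" "m \<in> set w" "a = m" "s \<le> b" "b < z"
        then show ?thesis using junc_asc D by simp
      qed
    next
      fix a b assume b: "b \<le> z" and no: "\<forall>x y. (x, y) \<in> insert (s, z) Cs \<longrightarrow> \<not> (a \<le> x \<and> y \<le> b)" and D: "desc w a b"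
      then have r: "run a b" by (simp add: run_def)
      from r b show "dn P' a b"
      proof (rule new_run_cases)
        show "\<not> (a \<le> x \<and> y \<le> b)" if "(x, y) \<in> insert (s, z) Cs" for x y using no that by blast
      next
        assume "b \<le> m"
        then show ?thesis using Pf[of b a] no D dn_old[of a b] run_le[OF r] by simp
      next
        assume a: "s \<le> a" "s < a \<or> b < z"
        \<comment> \<open>Inside an ascending block the only descending runs are single letters,
          where \<open>up\<close> and \<open>dn\<close> agree.\<close>
        have "a = b" using asc_desc[OF d sub_asc[OF r a(1) b] D] .
        then show ?thesis using sub_up[of a b] a b up_dn_diag[OF P'S, of a] by blast
      next
        assume "s = Suc m" "m \<in> set w" "a = m" "s \<le> b" "b < z"
        then show ?thesis using junc_desc D by simp
      qed
    next
      assume "z \<in> set w" "Suc z \<in> set w"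
      show "P' (Suc z) \<noteq> Suc z"
      proof (cases "s = Suc m \<and> m \<in> set w \<and> asc w m s")
        case True
        show ?thesis unfolding PT[OF True] using Pfix[of "Suc z"] Qv(3) s(2) lt by simp
      next
        case False
        have "P' (Suc z) = P (z - 1)" unfolding PF[OF False] using Qv(3) by simp
        moreover have "P (Suc z) = Suc z" using Pfix s(2) lt by simp
        then have "P (z - 1) \<noteq> Suc z" using Sn_inj[OF PS, of "z - 1" "Suc z"] by simp
        ultimately show ?thesis by simp
      qed
    qed
    then show ?thesis by blast
  qed
qed

end

context boolean_word
begin

interpretation rev: boolean_word n "rev w" by (rule boolean_word_rev)

lemma run_rev: "rev.run x y \<longleftrightarrow> run x y"
  by (auto simp: run_def rev.run_def asc_rev desc_rev)

lemma cover_state_rev: "rev.cover_state m Cs \<longleftrightarrow> cover_state m Cs"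
  unfolding cover_state_def rev.cover_state_def by (simp only: run_rev set_rev)

lemma perm_state_rev:
  assumes "P \<in> Sn (Suc m)"
  shows "rev.perm_state m Cs (inv P) \<longleftrightarrow> perm_state m Cs P"
proof -
  have "inv P (Suc m) = Suc m \<longleftrightarrow> P (Suc m) = Suc m" using Sn_inv_eq[OF assms] by metis
  then show ?thesis unfolding perm_state_def rev.perm_state_def
    using assms inv_Sn[OF assms] by (simp add: asc_rev desc_rev up_inv[OF assms] dn_inv[OF assms]) blast
qed

text \<open>\<open>s\<close> is the next letter and \<open>z\<close> the end of the longest run from
  it. If this run descends, the step is carried out for the reversed word and the inverse
  permutation.\<close>

lemma greedy_extend:
  assumes cov: "cover_state m Cs" and P: "perm_state m Cs P" and ex: "\<exists>k\<in>set w. m < k"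
  obtains z Cs' P' where "m < z" "z < n" "cover_state z Cs'" "perm_state z Cs' P'"
proof -
  define s where "s = (LEAST k. k \<in> set w \<and> m < k)"
  have s: "s \<in> set w \<and> m < s" unfolding s_def by (rule LeastI_ex) (use ex in blast)
  have gap: "k \<notin> set w" if "m < k" "k < s" for k using not_less_Least[of k "\<lambda>k. k \<in> set w \<and> m < k"] that unfolding s_def by blast
  define z where "z = (GREATEST z. run s z)"
  have bdry: "y \<le> n" if "run s y" for y using run_mem[OF that, of y] run_le[OF that] mem_bounds by force
  have rz: "run s z" unfolding z_def by (rule GreatestI_nat[of _ s n]) (use s run_single bdry in auto)
  have nz: "\<not> run s (Suc z)"
  proof
    assume "run s (Suc z)"
    then have "Suc z \<le> z" unfolding z_def by (rule Greatest_le_nat[of _ _ n]) (use bdry in auto)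
    then show False by simp
  qed
  interpret g: greedy_step n w m Cs s z by unfold_locales (use cov s gap rz nz in auto)
  have mz: "m < z" using s g.sz by simp
  from rz have "\<exists>P'. perm_state z (insert (s, z) Cs) P'" unfolding run_def
  proof
    assume "asc w s z"
    then show ?thesis by (rule g.perm_step_asc[OF P])
  next
    assume D: "desc w s z"
    interpret r: greedy_step n "rev w" m Cs s z
      by unfold_locales (use cov s gap rz nz in \<open>auto simp: cover_state_rev run_rev\<close>)
    have PS: "P \<in> Sn (Suc m)" using P by (simp add: perm_state_def)
    have "\<exists>P'. rev.perm_state z (insert (s, z) Cs) P'"
      by (rule r.perm_step_asc[of "inv P"]) (use P D perm_state_rev[OF PS] asc_rev in simp_all)
    then obtain R where R: "rev.perm_state z (insert (s, z) Cs) R" by blast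
    then have RS: "R \<in> Sn (Suc z)" by (simp add: rev.perm_state_def)
    have "inv (inv R) = R" using RS permutes_bij by (intro inv_inv_eq) (auto simp: Sn_def)
    then have "perm_state z (insert (s, z) Cs) (inv R)"
      using perm_state_rev[OF inv_Sn[OF RS]] R by simp
    then show ?thesis by blast
  qed
  moreover have "z < n" using run_mem[OF rz, of z] g.sz mem_bounds by simp
  ultimately show ?thesis using that[OF mz _ g.cover_step] by blast
qed

lemma greedy_exists:
  assumes n: "1 \<le> n"
  obtains m Cs P where "cover_state m Cs" "perm_state m Cs P" "\<And>k. k \<in> set w \<Longrightarrow> k \<le> m" "m < n"
proof -
  have ind: "\<exists>m' Cs' P'. cover_state m' Cs' \<and> perm_state m' Cs' P' \<and> (\<forall>k\<in>set w. k \<le> m') \<and> m' < n"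
    if "cover_state m Cs" "perm_state m Cs P" "m < n" for m Cs P
    using that
  proof (induction "n - m" arbitrary: m Cs P rule: less_induct)
    case less
    show ?case
    proof (cases "\<exists>k\<in>set w. m < k")
      case False
      then show ?thesis using less.prems by (metis leI)
    next
      case True
      obtain z Cs' P' where z: "m < z" "z < n" "cover_state z Cs'" "perm_state z Cs' P'"
        using greedy_extend[OF less.prems(1,2) True] .
      then show ?thesis using less.hyps[of z Cs' P'] less.prems(3) by simp
    qed
  qed
  have w0: "0 \<notin> set w" using mem_bounds by force
  have "cover_state 0 {}" using w0 unfolding cover_state_def by (auto intro: gr0I)
  moreover have "perm_state 0 {} id"
  proof -
    have "\<not> asc w a 0" "\<not> desc w a 0" for a
      using asc_mem[of w a 0 0] desc_mem[of w a 0 0] w0 by (auto simp: asc_def desc_def)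
    then show ?thesis unfolding perm_state_def using w0 by (simp add: id_Sn)
  qed
  ultimately have "\<exists>m' Cs' P'. cover_state m' Cs' \<and> perm_state m' Cs' P' \<and> (\<forall>k\<in>set w. k \<le> m') \<and> m' < n"
    using n by (intro ind[of 0 "{}" id]) auto
  then show ?thesis using that by blast
qed

end

section \<open>The grade\<close>


locale greedy_cover = boolean_word +
  fixes m :: nat and Cs :: "(nat \<times> nat) set"
  assumes cov: "cover_state m Cs" and all: "\<And>k. k \<in> set w \<Longrightarrow> k \<le> m"
begin

lemmas Cs_fin = cover_stateD(1)[OF cov]
lemmas Cs_run = cover_stateD(2)[OF cov]
lemmas Cs_le = cover_stateD(4)[OF cov]
lemmas Cs_disj = cover_stateD(6)[OF cov]
lemmas Cs_antichain = cover_stateD(7)[OF cov]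

lemma Cs_cover: "k \<in> set w \<Longrightarrow> \<exists>x y. (x, y) \<in> Cs \<and> x \<le> k \<and> k \<le> y"
  using cover_stateD(5)[OF cov] all by blast

lemma Cs_start: "(x, y) \<in> Cs \<Longrightarrow> x \<in> set w"
  using run_mem[OF Cs_run, of x y x] Cs_le[of x y] by blast

lemma Cs_start_inj: "(x, y) \<in> Cs \<Longrightarrow> (x, y') \<in> Cs \<Longrightarrow> y = y'"
  using Cs_disj[of x y x y'] Cs_le by blast

lemma ex_inversion_at:
  assumes "x \<in> set w"
  shows "\<exists>k l. 1 \<le> k \<and> k \<le> x \<and> x < v k \<and> x < l \<and> l \<le> n \<and> v l \<le> x"
proof -
  have "up v x x" "dn v x x" using up_v dn_v assms by (simp_all add: asc_single desc_single)
  then obtain k l where kl: "k \<le> x" "x < v k" "x < l" "v l \<le> x" by (auto simp: up_def dn_def)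
  have "k \<noteq> 0" using kl Sn_outside[OF vS, of 0] by (metis not_less_zero)
  moreover have "\<not> n < l" using kl Sn_outside[OF vS, of l] by auto
  ultimately show ?thesis using kl by (intro exI[of _ k] exI[of _ l]) simp
qed

text \<open>Each start \<open>x\<close> of a block has an inversion straddling it, at positions
  \<open>U \<le> x < L\<close> with \<open>v L \<le> x < v U\<close>. A position shared by the pairs
  of two starts would create a run through both, so the pairs are disjoint, and an increasing
  subsequence misses a position of each.\<close>

lemma increasing_le:
  assumes A: "incr_at (map v [1..<Suc n]) A"
  shows "card A + card Cs \<le> n"
proof -
  let ?xs = "map v [1..<Suc n]"
  have nth: "?xs ! i = v (Suc i)" if "i < n" for i using that by (simp del: upt_Suc)
  have An: "A \<subseteq> {..<n}" using A by (simp add: incr_at_def del: upt_Suc)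
  have "\<exists>k l. 1 \<le> k \<and> k \<le> fst c \<and> fst c < v k \<and> fst c < l \<and> l \<le> n \<and> v l \<le> fst c" if "c \<in> Cs" for c
    using ex_inversion_at[OF Cs_start[of "fst c" "snd c"]] that by simp
  then obtain U L where UL: "\<And>c. c \<in> Cs \<Longrightarrow> 1 \<le> U c \<and> U c \<le> fst c \<and> fst c < v (U c) \<and> fst c < L c \<and> L c \<le> n \<and> v (L c) \<le> fst c"
    by metis
  define e where "e c = (if U c - 1 \<in> A then L c - 1 else U c - 1)" for c
  have eA: "e c \<in> {..<n} - A" if c: "c \<in> Cs" for c
  proof -
    note u = UL[OF c]
    have lt: "U c - 1 < n" "L c - 1 < n" "U c - 1 < L c - 1" using u by auto
    have "L c - 1 \<notin> A" if "U c - 1 \<in> A"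
    proof
      assume "L c - 1 \<in> A"
      then have "?xs ! (U c - 1) < ?xs ! (L c - 1)" using A that lt unfolding incr_at_def by blast
      then show False using u nth lt by simp
    qed
    then show ?thesis using lt by (auto simp: e_def)
  qed
  have lt_False: False if c: "c \<in> Cs" "c' \<in> Cs" "fst c < fst c'" "e c = e c'" for c c'
  proof -
    note u = UL[OF c(1)] and u' = UL[OF c(2)]
    have nr: "\<not> run (fst c) (fst c')" using Cs_antichain[of "fst c" "snd c" "fst c'" "snd c'"] c by simp
    have "e c = U c - 1 \<or> e c = L c - 1" "e c' = U c' - 1 \<or> e c' = L c' - 1" by (auto simp: e_def)
    then consider "U c = U c'" | "L c = L c'" | "U c = L c'" | "L c = U c'" using c(4) u u' by force
    then show False
    proof cases
      case 1
      then have "up v (fst c) (fst c')" using u u' unfolding up_def by (intro exI[of _ "U c"]) simp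
      then show False using up_v c(3) nr by (simp add: run_def)
    next
      case 2
      then have "dn v (fst c) (fst c')" using u u' unfolding dn_def by (intro exI[of _ "L c"]) simp
      then show False using dn_v c(3) nr by (simp add: run_def)
    qed (use u u' c(3) in auto)
  qed
  have "inj_on e Cs"
  proof (rule inj_onI)
    fix c c' assume c: "c \<in> Cs" "c' \<in> Cs" "e c = e c'"
    have "fst c = fst c'" using lt_False[OF c(1,2)] lt_False[OF c(2,1)] c(3) by (metis linorder_neqE_nat)
    then show "c = c'" using Cs_start_inj[of "fst c" "snd c" "snd c'"] c by (metis prod.collapse)
  qed
  then have "card Cs \<le> card ({..<n} - A)" by (rule card_inj_on_le) (use eA in auto)
  also have "\<dots> = n - card A" using An by (simp add: card_Diff_subset finite_subset)
  finally show ?thesis using card_mono[OF _ An] by simp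
qed

text \<open>For each block one position is deleted, whose point crosses the whole block in the
  direction of the run. Every inversion straddles some letter \<open>h\<close>, and uniqueness of
  the point crossing \<open>h\<close> in a given direction puts one of its two positions among the
  deleted.\<close>

lemma ex_increasing:
  "\<exists>A. incr_at (map v [1..<Suc n]) A \<and> n \<le> card A + card Cs"
proof -
  let ?xs = "map v [1..<Suc n]"
  have nth: "?xs ! i = v (Suc i)" if "i < n" for i using that by (simp del: upt_Suc)
  have "\<exists>r. if asc w (fst c) (snd c) then r \<le> fst c \<and> snd c < v r else snd c < r \<and> v r \<le> fst c" if c: "c \<in> Cs" for c
  proof -
    have r: "run (fst c) (snd c)" using Cs_run[of "fst c" "snd c"] c by simp
    then show ?thesis using up_v[OF run_le[OF r]] dn_v[OF run_le[OF r]]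
      by (auto simp: run_def up_def dn_def)
  qed
  then obtain r where r: "\<And>c. c \<in> Cs \<Longrightarrow> if asc w (fst c) (snd c) then r c \<le> fst c \<and> snd c < v (r c) else snd c < r c \<and> v (r c) \<le> fst c"
    by metis
  define A where "A = {i. i < n \<and> Suc i \<notin> r ` Cs}"
  have "incr_at ?xs A" unfolding incr_at_def
  proof (intro conjI ballI impI)
    show "A \<subseteq> {..<length ?xs}" by (auto simp: A_def simp del: upt_Suc)
    fix a b assume ab: "a \<in> A" "b \<in> A" "a < b"
    then have abn: "a < n" "b < n" by (auto simp: A_def)
    show "?xs ! a < ?xs ! b"
    proof (rule ccontr)
      assume "\<not> ?xs ! a < ?xs ! b"
      then have "\<not> v (Suc a) < v (Suc b)" using nth abn by (simp del: upt_Suc)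
      then have inv: "v (Suc b) < v (Suc a)" using Sn_inj[OF vS, of "Suc a" "Suc b"] ab(3) by simp
      have 1: "Suc a < v (Suc a)" "v (Suc b) < Suc b"
        using inversion_exceeds[OF _ inv] inversion_deficient[OF _ inv] ab(3) by simp_all
      \<comment> \<open>A letter straddled by the two positions and by the two values at once; it
        exists since \<open>v\<close> raises \<open>Suc a\<close> and lowers
        \<open>Suc b\<close>.\<close>
      define h where "h = max (Suc a) (v (Suc b))"
      have h: "Suc a \<le> h" "h < v (Suc a)" "h < Suc b" "v (Suc b) \<le> h"
        using 1 inv ab(3) by (auto simp: h_def)
      have "up v h h" unfolding up_def using h by blast
      then have "h \<in> set w" using up_v[of h h] by (simp add: asc_single)
      then obtain x y where xy: "(x, y) \<in> Cs" "x \<le> h" "h \<le> y" using Cs_cover by blast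
      have "r (x, y) = Suc a \<or> r (x, y) = Suc b"
      proof (cases "asc w x y")
        case True
        then have "r (x, y) \<le> h" "h < v (r (x, y))" using r[OF xy(1)] xy by auto
        then show ?thesis using up_v_unique[of h h "r (x, y)" "Suc a"] h by simp
      next
        case False
        then have "h < r (x, y)" "v (r (x, y)) \<le> h" using r[OF xy(1)] xy by auto
        then show ?thesis using dn_v_unique[of h h "r (x, y)" "Suc b"] h by simp
      qed
      then show False using ab xy(1) unfolding A_def by (metis (mono_tags, lifting) image_eqI mem_Collect_eq)
    qed
  qed
  moreover have "{..<n} \<subseteq> A \<union> (\<lambda>c. r c - 1) ` Cs"
  proof
    fix i assume "i \<in> {..<n}"
    then show "i \<in> A \<union> (\<lambda>c. r c - 1) ` Cs" by (cases "Suc i \<in> r ` Cs") (force simp: A_def)+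
  qed
  then have "card {..<n} \<le> card (A \<union> (\<lambda>c. r c - 1) ` Cs)"
    by (rule card_mono[rotated]) (use Cs_fin in \<open>simp add: A_def\<close>)
  then have "n \<le> card A + card ((\<lambda>c. r c - 1) ` Cs)" using card_Un_le[of A] by (metis card_lessThan le_trans)
  then have "n \<le> card A + card Cs" using card_image_le[OF Cs_fin, of "\<lambda>c. r c - 1"] by linarith
  ultimately show ?thesis by blast
qed

lemma a_fun_v:
  assumes n: "1 \<le> n"
  shows "a_fun n v = card Cs"
proof -
  let ?xs = "map v [1..<Suc n]"
  have dx: "distinct ?xs" by (rule distinct_one_line[OF vS])
  obtain A where A: "incr_at ?xs A" "card A = length (row1 ?xs)" using Schensted_ex[OF dx] by blast
  obtain B where B: "incr_at ?xs B" "n \<le> card B + card Cs" using ex_increasing by blast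
  have "length (row1 ?xs) + card Cs = n"
    using increasing_le[OF A(1)] A(2) Schensted_ge[OF dx B(1)] B(2) by simp
  moreover have "\<not> (?xs ! k < ?xs ! j \<and> ?xs ! j < ?xs ! i)" if ijk: "i < j" "j < k" "k < length ?xs" for i j k
  proof -
    have "k < n" "j < n" "i < n" using ijk by (simp_all del: upt_Suc)
    then have "?xs ! k = v (Suc k)" "?xs ! j = v (Suc j)" "?xs ! i = v (Suc i)" by (simp_all del: upt_Suc)
    then show ?thesis using no_321[of "Suc i" "Suc j" "Suc k"] ijk by simp
  qed
  then have "shape_weight (tableau_shape ?xs) = length ?xs - length (row1 ?xs)" by (rule shape_weight_321_avoiding[OF dx])
  ultimately have "shape_weight (tableau_shape ?xs) = card Cs" by (simp del: upt_Suc)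
  then show ?thesis unfolding a_fun_eq[OF n] rs_shape_eq if_P[OF vS] .
qed

definition blocks :: "nat set set" where
  "blocks = (\<lambda>(x, y). {x..y}) ` Cs"

lemma blocks_card: "card blocks = card Cs"
  unfolding blocks_def by (rule card_image) (use Cs_le in \<open>auto simp: inj_on_def Icc_eq_Icc\<close>)

lemma blocks_disjoint: "disjoint blocks"
  unfolding disjoint_def
proof (intro ballI impI)
  fix C C' assume C: "C \<in> blocks" "C' \<in> blocks" "C \<noteq> C'"
  obtain x y x' y' where xy: "(x, y) \<in> Cs" "C = {x..y}" "(x', y') \<in> Cs" "C' = {x'..y'}"
    using C(1,2) by (auto simp: blocks_def)
  show "C \<inter> C' = {}"
  proof (rule ccontr)
    assume "C \<inter> C' \<noteq> {}"
    then obtain k where "k \<in> C" "k \<in> C'" by blast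
    then have k: "x \<le> k" "k \<le> y" "x' \<le> k" "k \<le> y'" using xy by auto
    then show False using Cs_disj[OF xy(1,3)] Cs_disj[OF xy(3,1)] C(3) xy by (metis le_trans nat_le_linear)
  qed
qed

lemma blocks_nonempty: "{} \<notin> blocks"
  using Cs_le by (auto simp: blocks_def)

lemma blocks_union: "\<Union>blocks = set w"
proof (intro equalityI subsetI)
  fix k assume "k \<in> \<Union>blocks"
  then obtain x y where "(x, y) \<in> Cs" "x \<le> k" "k \<le> y" by (auto simp: blocks_def)
  then show "k \<in> set w" using run_mem[OF Cs_run] by blast
next
  fix k assume "k \<in> set w"
  then obtain x y where xy: "(x, y) \<in> Cs" "x \<le> k" "k \<le> y" using Cs_cover by blast
  have "{x..y} \<in> blocks" unfolding blocks_def using xy(1) by force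
  then show "k \<in> \<Union>blocks" using xy by (intro UnionI[of "{x..y}"]) auto
qed

text \<open>A missing run contains at most one starting letter of the greedy cover, and all of these
  must be covered.\<close>

lemma card_cover_ge:
  assumes p: "p \<in> Sn n" and D: "\<D> \<subseteq> missing_runs w p" "set w \<subseteq> \<Union>\<D>"
  shows "card Cs \<le> card \<D>"
proof -
  have "\<exists>D. D \<in> \<D> \<and> fst c \<in> D" if "c \<in> Cs" for c
    using D(2) Cs_start[of "fst c" "snd c"] that by auto
  then obtain g where g: "\<And>c. c \<in> Cs \<Longrightarrow> g c \<in> \<D> \<and> fst c \<in> g c" by metis
  have lt: False if c: "c \<in> Cs" "c' \<in> Cs" "fst c < fst c'" "g c = g c'" for c c'
  proof -
    have "g c \<in> missing_runs w p" using g[OF c(1)] D(1) by blast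
    then obtain a b where ab: "g c = {a..b}" "run a b" unfolding missing_runs_iff[OF p] run_def by blast
    have "run (fst c) (fst c')" by (rule run_sub[OF ab(2)]) (use g[OF c(1)] g[OF c(2)] c(3,4) ab(1) in auto)
    then show False using Cs_antichain[of "fst c" "snd c" "fst c'" "snd c'"] c by simp
  qed
  have "inj_on g Cs"
  proof (rule inj_onI)
    fix c c' assume c: "c \<in> Cs" "c' \<in> Cs" "g c = g c'"
    have "fst c = fst c'" using lt[OF c(1,2)] lt[OF c(2,1)] c(3) by (metis linorder_neqE_nat)
    then show "c = c'" using Cs_start_inj[of "fst c" "snd c" "snd c'"] c by (metis prod.collapse)
  qed
  moreover have "finite \<D>" by (rule finite_subset[OF D(1) finite_missing_runs])
  moreover have "g ` Cs \<subseteq> \<D>" using g by blast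
  ultimately show ?thesis by (metis card_inj_on_le)
qed

text \<open>The blocks are themselves missing runs of \<open>P\<close>, and every missing run of
  \<open>P\<close> contains a block; so the blocks are the minimal nonfaces.\<close>

lemma subword_le_greedy_iff:
  assumes P: "perm_state m Cs P" and m: "m < n"
  shows "P \<in> Sn n" "bruhat n (subword w T) P \<longleftrightarrow> (\<forall>C\<in>blocks. \<not> C \<subseteq> T)"
proof -
  show PS: "P \<in> Sn n" using P Sn_mono[of "Suc m" n P] m by (simp add: perm_state_def)
  have "\<exists>C\<in>blocks. C \<subseteq> D" if D: "D \<in> missing_runs w P" for D
  proof -
    obtain a b where ab: "D = {a..b}" "asc w a b \<and> \<not> up P a b \<or> desc w a b \<and> \<not> dn P a b"
      using D unfolding missing_runs_iff[OF PS] by blast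
    then have r: "run a b" by (auto simp: run_def)
    then have "b \<le> m" using all run_mem[OF r, of b] run_le[OF r] by simp
    then obtain x y where xy: "(x, y) \<in> Cs" "a \<le> x" "y \<le> b" using P ab(2) unfolding perm_state_def by blast
    have "{x..y} \<in> blocks" unfolding blocks_def using xy(1) by force
    moreover have "{x..y} \<subseteq> D" using xy ab(1) by auto
    ultimately show ?thesis by blast
  qed
  moreover have "C \<in> missing_runs w P" if C: "C \<in> blocks" for C
  proof -
    obtain x y where xy: "(x, y) \<in> Cs" "C = {x..y}" using C by (auto simp: blocks_def)
    have "(asc w x y \<longrightarrow> \<not> up P x y) \<and> (desc w x y \<longrightarrow> \<not> dn P x y)" using P xy(1) unfolding perm_state_def by blast
    then show ?thesis using Cs_run[OF xy(1)] xy(2) unfolding missing_runs_iff[OF PS] run_def by blast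
  qed
  ultimately show "bruhat n (subword w T) P \<longleftrightarrow> (\<forall>C\<in>blocks. \<not> C \<subseteq> T)"
    unfolding subword_le_iff[OF d val PS] by (meson subset_trans)
qed

end

theorem theorem6p7:
  fixes n :: nat and v :: "nat \<Rightarrow> nat"
  assumes "n \<ge> 1"
    and "v \<in> Sn n"
    and "boolean_perm n v"
  shows "has_grade (Sn n) (bruhat n)
           (simple_rep v :: (nat \<Rightarrow> nat, nat \<Rightarrow> nat, 'k::{alg_closed_field, field_char_0}) rep)
           (regular_rep (Sn n) (bruhat n) :: (nat \<Rightarrow> nat, nat \<Rightarrow> nat, 'k) rep)
           (a_fun n v)"
proof -
  obtain w where w: "distinct w" "valid_word n w" "wprod w = v"
    "{u \<in> Sn n. bruhat n u v} = subword w ` Pow (set w)"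
    using boolean_perm_word[OF assms(2,3)] .
  interpret bw: boolean_word n w by unfold_locales (rule w)+
  obtain m Cs P where st: "bw.cover_state m Cs" "bw.perm_state m Cs P" "\<And>k. k \<in> set w \<Longrightarrow> k \<le> m" "m < n"
    using bw.greedy_exists[OF assms(1)] by metis
  interpret gc: greedy_cover n w m Cs by unfold_locales (use st in auto)
  have top: "subword w (set w) = v" using w(3) by (simp add: filter_id_conv)
  interpret bi: boolean_interval "Sn n" "bruhat n" "set w" "subword w"
  proof unfold_locales
    show "finite (Sn n)" by (rule finite_Sn)
    show "infinite (UNIV :: (nat \<Rightarrow> nat) set)" by (metis finite_fun_UNIVD2 infinite_UNIV_nat finite_imageI range_eqI)
    show "bruhat n x x" for x by (rule bruhat_refl)
    show "bruhat n x z" if "bruhat n x y" "bruhat n y z" for x y z using bruhat_trans that .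
    show "subword w T \<in> Sn n" for T by (rule wprod_Sn[OF valid_word_filter[OF w(2)]])
    show "bruhat n (subword w T) (subword w U) \<longleftrightarrow> T \<subseteq> U" if "T \<subseteq> set w" for T U
      by (rule subword_mono_iff[OF w(1,2) that])
    show "\<exists>T\<subseteq>set w. x = subword w T" if "x \<in> Sn n" "bruhat n x (subword w (set w))" for x
      using that w(4) unfolding top by blast
  qed simp_all
  have "has_grade (Sn n) (bruhat n)
           (simple_rep (subword w (set w)) :: (nat \<Rightarrow> nat, nat \<Rightarrow> nat, 'k) rep)
           (regular_rep (Sn n) (bruhat n) :: (nat \<Rightarrow> nat, nat \<Rightarrow> nat, 'k) rep) (card Cs)"
  proof (rule bi.grade_boolean_interval[where \<C> = "missing_runs w" and p = P and \<K> = gc.blocks])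
    show "finite (missing_runs w p)" for p by (rule finite_missing_runs)
    show "bruhat n (subword w T) p \<longleftrightarrow> (\<forall>C\<in>missing_runs w p. \<not> C \<subseteq> T)" if "p \<in> Sn n" for p T
      by (rule subword_le_iff[OF w(1,2) that])
    show "card Cs \<le> card \<D>" if "p \<in> Sn n" "\<D> \<subseteq> missing_runs w p" "set w \<subseteq> \<Union>\<D>" for p \<D>
      by (rule gc.card_cover_ge[OF that])
    show "P \<in> Sn n" by (rule gc.subword_le_greedy_iff(1)[OF st(2,4)])
    show "bruhat n (subword w T) P \<longleftrightarrow> (\<forall>C\<in>gc.blocks. \<not> C \<subseteq> T)" for T
      by (rule gc.subword_le_greedy_iff(2)[OF st(2,4)])
    show "finite gc.blocks" using gc.Cs_fin by (simp add: gc.blocks_def)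
  qed (rule gc.blocks_disjoint gc.blocks_nonempty gc.blocks_union gc.blocks_card)+
  then show ?thesis unfolding top using gc.a_fun_v[OF assms(1)] w(3) by simp
qed

end
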